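(* Let $L_0$ be a subfield of $\overline{\mathbb{Q}}$ with the Northcott property and let $(K_i)_{i\in\mathbb{N}}$ be a sequence of number fields (subfields of $\overline{\mathbb{Q}}$) of degrees $d_i=[K_i:\mathbb{Q}]>1$. Suppose that the family $L_0,K_1,K_2,K_3,\ldots$ is linearly disjoint over $\mathbb{Q}$, and that the degrees $d_i$ are uniformly bounded from above. Let $L_n=L_0\prod_{i=1}^nK_i$, $R_n=\mathcal{O}_{L_0}\prod_{i=1}^n\mathcal{O}_{K_i}$ and $R=\bigcup_nR_n$. Suppose moreover that for every $n\in\mathbb{N}$ there is no proper intermediate field between $L_{n-1}$ and $L_n$. Then $R$ also has the Northcott property.
   Context: $\overline{\mathbb{Q}}$ is a fixed algebraic closure of $\mathbb{Q}$. For a field $K\subseteq\overline{\mathbb{Q}}$ (possibly of infinite degree over $\mathbb{Q}$), $\mathcal{O}_K$ is its ring of algebraic integers. For subrings $S_i$ of $\overline{\mathbb{Q}}$, the product $\prod_i S_i$ denotes the composite ring, i.e. the smallest subring of $\overline{\mathbb{Q}}$ containing all $S_i$. Thus $L_n$ is the compositum of the fields $L_0,K_1,\ldots,K_n$, and $R_n$ is the subring generated by $\mathcal{O}_{L_0},\mathcal{O}_{K_1},\ldots,\mathcal{O}_{K_n}$. A proper intermediate field between $L_{n-1}$ and $L_n$ is a field $M$ with $L_{n-1}\subsetneq M\subsetneq L_n$. A family $L_0,K_1,K_2,\ldots$ is linearly disjoint over $\mathbb{Q}$ if every finite subfamily is linearly disjoint over $\mathbb{Q}$ (the natural map from the tensor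 product over $\mathbb{Q}$ to $\overline{\mathbb{Q}}$ is injective); this is equivalent to $[L_n:L_{n-1}]=[K_n:\mathbb{Q}]$ for every $n\in\mathbb{N}=\{1,2,\ldots\}$. The absolute multiplicative Weil height of $\alpha$ in a number field $K$ is $H(\alpha)=\prod_v\max\{1,|\alpha|_v\}^{d_v/[K:\mathbb{Q}]}$, the product over all places $v$ of $K$, where $|\cdot|_v$ extends the usual archimedean or $p$-adic absolute value on $\mathbb{Q}$ and $d_v=[K_v:\mathbb{Q}_v]$; it is independent of the choice of $K\ni\alpha$. Put $h(\alpha)=\log H(\alpha)$. A set $S\subseteq\overline{\mathbb{Q}}$ has the Northcott property if $\#\{\alpha\in S: h(\alpha)\le X\}<\infty$ for every $X\ge 0$. *)

theory Defs
  imports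
    "HOL-Analysis.Analysis"
    "HOL-Algebra.Algebra"
    "HOL-Algebra.Algebraic_Closure_Type"
    "HOL-Library.Poly_Mapping"
begin

text \<open>
  The algebraic closure of the rationals is realised as the set of algebraic numbers inside
  the complex numbers; fields and rings of algebraic numbers are subsets of \<^typ>\<open>complex\<close>.
\<close>

abbreviation CC :: "complex ring" where
  "CC \<equiv> ring_of_type_algebra"

definition Qbar :: "complex set" where
  "Qbar = {x. algebraic x}"

definition number_field :: "complex set \<Rightarrow> bool" where
  "number_field K \<longleftrightarrow> subfield K CC \<and> ring.finite_dimension CC \<rat> K"

definition field_degree :: "complex set \<Rightarrow> nat" where
  "field_degree K = ring.dim CC \<rat> K"

definition ring_of_integers :: "complex set \<Rightarrow> complex set" where
  "ring_of_integers K = {x \<in> K. algebraic_int x}"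

definition composite_ring :: "complex set set \<Rightarrow> complex set" where
  "composite_ring \<S> = generate_ring CC (\<Union>\<S>)"

text \<open>
  The tensor product over the rationals of the spaces \<open>F i\<close>, \<open>i \<in> J\<close>, is the free rational
  vector space on the tuples in \<open>PiE J F\<close> modulo the subspace \<open>tensor_relations J F\<close>.
  The latter is generated by the multilinearity relations; the generators below carry an
  arbitrary coefficient \<open>q\<close>, which makes the set closed under scalar multiplication.
\<close>

inductive_set tensor_relations ::
    "nat set \<Rightarrow> (nat \<Rightarrow> complex set) \<Rightarrow> ((nat \<Rightarrow> complex) \<Rightarrow>\<^sub>0 rat) set"
  for J :: "nat set" and F :: "nat \<Rightarrow> complex set" where
    zero: "0 \<in> tensor_relations J F"
  | plus: "f \<in> tensor_relations J F \<Longrightarrow> g \<in> tensor_relations J F \<Longrightarrow> f + g \<in> tensor_relations J F"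
  | additive: "x \<in> PiE J F \<Longrightarrow> i \<in> J \<Longrightarrow> a \<in> F i \<Longrightarrow> b \<in> F i \<Longrightarrow>
      Poly_Mapping.single (x(i := a + b)) q - Poly_Mapping.single (x(i := a)) q
        - Poly_Mapping.single (x(i := b)) q \<in> tensor_relations J F"
  | homogeneous: "x \<in> PiE J F \<Longrightarrow> i \<in> J \<Longrightarrow> a \<in> F i \<Longrightarrow>
      Poly_Mapping.single (x(i := of_rat r * a)) q - Poly_Mapping.single (x(i := a)) (q * r)
        \<in> tensor_relations J F"

definition product_map :: "nat set \<Rightarrow> ((nat \<Rightarrow> complex) \<Rightarrow>\<^sub>0 rat) \<Rightarrow> complex" where
  "product_map J f = (\<Sum>x\<in>Poly_Mapping.keys f. of_rat (Poly_Mapping.lookup f x) * (\<Prod>i\<in>J. x i))"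

text \<open>
  Injectivity of the map induced by \<^const>\<open>product_map\<close> on the tensor product, expressed by
  triviality of its kernel.
\<close>

definition tensor_map_injective :: "nat set \<Rightarrow> (nat \<Rightarrow> complex set) \<Rightarrow> bool" where
  "tensor_map_injective J F \<longleftrightarrow>
     (\<forall>f. Poly_Mapping.keys f \<subseteq> PiE J F \<longrightarrow> product_map J f = 0 \<longrightarrow> f \<in> tensor_relations J F)"

definition linearly_disjoint_family :: "(nat \<Rightarrow> complex set) \<Rightarrow> bool" where
  "linearly_disjoint_family F \<longleftrightarrow> (\<forall>J. finite J \<longrightarrow> tensor_map_injective J F)"

definition padic_abs :: "nat \<Rightarrow> rat \<Rightarrow> real" where
  "padic_abs p q = (if q = 0 then 0 else
     case quotient_of q of (a, b) \<Rightarrow>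
       real p powi (int (multiplicity (int p) b) - int (multiplicity (int p) a)))"

text \<open>Extensionality makes an absolute value on \<open>K\<close> determined by its values on \<open>K\<close>.\<close>

definition absolute_value :: "complex set \<Rightarrow> (complex \<Rightarrow> real) \<Rightarrow> bool" where
  "absolute_value K v \<longleftrightarrow> v \<in> extensional K \<and>
     (\<forall>x\<in>K. 0 \<le> v x \<and> (v x = 0 \<longleftrightarrow> x = 0)) \<and>
     (\<forall>x\<in>K. \<forall>y\<in>K. v (x * y) = v x * v y) \<and>
     (\<forall>x\<in>K. \<forall>y\<in>K. v (x + y) \<le> v x + v y)"

text \<open>
  A place is represented by the unique absolute value in its class which extends the usual or
  a \<open>p\<close>-adic absolute value of the rationals.
\<close>

definition places :: "complex set \<Rightarrow> (complex \<Rightarrow> real) set" where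
  "places K = {v. absolute_value K v \<and>
     ((\<forall>q. v (of_rat q) = \<bar>real_of_rat q\<bar>) \<or>
      (\<exists>p. Factorial_Ring.prime p \<and> (\<forall>q. v (of_rat q) = padic_abs p q)))}"

definition cauchy_ring :: "complex set \<Rightarrow> (complex \<Rightarrow> real) \<Rightarrow> (nat \<Rightarrow> complex) ring" where
  "cauchy_ring K v = \<lparr>
     carrier = {s. range s \<subseteq> K \<and> (\<forall>e>0. \<exists>N. \<forall>m\<ge>N. \<forall>n\<ge>N. v (s m - s n) < e)},
     monoid.mult = (\<lambda>s t n. s n * t n),
     one = (\<lambda>n. 1),
     ring.zero = (\<lambda>n. 0),
     add = (\<lambda>s t n. s n + t n)\<rparr>"

definition null_sequences :: "complex set \<Rightarrow> (complex \<Rightarrow> real) \<Rightarrow> (nat \<Rightarrow> complex) set" where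
  "null_sequences K v = {s \<in> carrier (cauchy_ring K v). (\<lambda>n. v (s n)) \<longlonglongrightarrow> 0}"

definition completion :: "complex set \<Rightarrow> (complex \<Rightarrow> real) \<Rightarrow> (nat \<Rightarrow> complex) set ring" where
  "completion K v = cauchy_ring K v Quot null_sequences K v"

text \<open>The completion of the rationals, embedded in the completion of \<open>K\<close>.\<close>

definition rat_completion :: "complex set \<Rightarrow> (complex \<Rightarrow> real) \<Rightarrow> (nat \<Rightarrow> complex) set set" where
  "rat_completion K v =
     {null_sequences K v +>\<^bsub>cauchy_ring K v\<^esub> s | s. s \<in> carrier (cauchy_ring K v) \<and> range s \<subseteq> \<rat>}"

definition local_degree :: "complex set \<Rightarrow> (complex \<Rightarrow> real) \<Rightarrow> nat" where
  "local_degree K v = ring.dim (completion K v) (rat_completion K v) (carrier (completion K v))"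

text \<open>
  All but finitely many factors of the product over \<^term>\<open>places K\<close> are \<open>1\<close>; the product is
  restricted to the remaining ones because \<^const>\<open>prod\<close> over an infinite set is \<open>1\<close>.
\<close>

definition weil_height_in :: "complex set \<Rightarrow> complex \<Rightarrow> real" where
  "weil_height_in K \<alpha> = (\<Prod>v | v \<in> places K \<and> max 1 (v \<alpha>) \<noteq> 1.
     max 1 (v \<alpha>) powr (real (local_degree K v) / real (field_degree K)))"

text \<open>
  The value does not depend on the number field containing \<open>\<alpha>\<close>; the field generated by \<open>\<alpha>\<close>
  over the rationals is used.
\<close>

definition weil_height :: "complex \<Rightarrow> real" where
  "weil_height \<alpha> = weil_height_in (generate_field CC {\<alpha>}) \<alpha>"

definition log_weil_height :: "complex \<Rightarrow> real" where
  "log_weil_height \<alpha> = ln (weil_height \<alpha>)"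

definition northcott :: "complex set \<Rightarrow> bool" where
  "northcott S \<longleftrightarrow> (\<forall>B\<ge>0. finite {\<alpha> \<in> S. log_weil_height \<alpha> \<le> B})"

end

theory Submission
  imports Defs "Jordan_Normal_Form.Char_Poly"
begin

text \<open>
  Let \<open>\<alpha>\<close> be an element of the union \<open>R\<close> outside \<open>R 0\<close>, and let \<open>n\<close> be the least index with \<open>\<alpha> \<in> R n\<close>.
  An integral basis \<open>\<omega>\<close> of \<open>K n\<close> is by linear disjointness (\<open>disjoint_family_indep\<close>) independent over the
  field \<open>L (n - 1)\<close>, and \<open>R n\<close> consists of its combinations with coefficients in \<open>R (n - 1)\<close>.  Comparing
  coordinates, \<open>R n\<close> meets \<open>L (n - 1)\<close> in \<open>R (n - 1)\<close> only, so \<open>\<alpha>\<close> lies outside \<open>L (n - 1)\<close>.  In the absence of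
  intermediate fields \<open>\<alpha>\<close> therefore generates \<open>L n\<close> over \<open>L (n - 1)\<close>, and the powers \<open>1, \<alpha>, \<dots>, \<alpha>\<^sup>d\<^sup>-\<^sup>1\<close> form a
  second basis of \<open>L n\<close>.

  The matrix \<open>C\<close> that expresses these powers by \<open>\<omega>\<close> has entries in \<open>R (n - 1)\<close>, so its determinant is a
  nonzero algebraic integer.  Apply an embedding \<open>\<tau>\<close> of a number field containing the entries of \<open>C\<close>, and
  all its extensions to the compositum with \<open>K n\<close>: the Vandermonde determinant of the images of \<open>\<alpha>\<close> is the
  product of \<open>\<tau> (det C)\<close> and the determinant of the embeddings of \<open>\<omega>\<close>, whose square has the discriminant of
  \<open>K n\<close> as its modulus.  In the product over all \<open>\<tau>\<close> the norm of \<open>det C\<close> is at least \<open>1\<close> in modulus, and the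
  Vandermonde determinants are bounded by the height of \<open>\<alpha>\<close>.  Hence the discriminant of \<open>K n\<close> is bounded in terms of
  the degree of \<open>K n\<close> and the height of \<open>\<alpha>\<close> (\<open>discr_le_height\<close>).

  When \<open>\<alpha>\<close> varies over the elements of height at most \<open>B\<close>, only finitely many fields can occur as \<open>K n\<close> by
  Hermite's theorem (\<open>hermite_finiteness\<close>).  The fields \<open>K n\<close> are pairwise distinct by disjointness, so only
  finitely many indices \<open>n\<close> occur.  It remains to see that each \<open>R n\<close> has the Northcott property.  This goes by
  induction: an element of \<open>R n\<close> is a root of the characteristic polynomial of its multiplication map on the
  free module with basis \<open>\<omega>\<close>, a monic polynomial over \<open>R (n - 1)\<close> whose coefficients have bounded height
  (\<open>northcott_span_of\<close>).

  All elements involved are algebraic integers, for which only the archimedean places contribute to the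
  height.  These places are given by the conjugates, so that the height becomes an average over the
  conjugates (\<open>log_weil_height_algebraic_int\<close>); from there on the argument speaks of embeddings only.
\<close>

hide_const (open) up_ring.coeff up_ring.monom Coset.order Polynomials.lead_coeff Polynomials.degree

section \<open>Subrings and characteristic polynomials\<close>

definition is_subring :: "'a::comm_ring_1 set \<Rightarrow> bool" where
  "is_subring S \<longleftrightarrow> 0 \<in> S \<and> 1 \<in> S \<and> (\<forall>x\<in>S. - x \<in> S) \<and> (\<forall>x\<in>S. \<forall>y\<in>S. x + y \<in> S \<and> x * y \<in> S)"

lemma is_subringD:
  assumes "is_subring S"
  shows "0 \<in> S" "1 \<in> S" "x \<in> S \<Longrightarrow> - x \<in> S" "x \<in> S \<Longrightarrow> y \<in> S \<Longrightarrow> x + y \<in> S"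
    "x \<in> S \<Longrightarrow> y \<in> S \<Longrightarrow> x * y \<in> S" "x \<in> S \<Longrightarrow> y \<in> S \<Longrightarrow> x - y \<in> S"
proof -
  show *: "0 \<in> S" "1 \<in> S" "x \<in> S \<Longrightarrow> - x \<in> S" "x \<in> S \<Longrightarrow> y \<in> S \<Longrightarrow> x + y \<in> S"
    "x \<in> S \<Longrightarrow> y \<in> S \<Longrightarrow> x * y \<in> S" for x y
    using assms unfolding is_subring_def by auto
  show "x \<in> S \<Longrightarrow> y \<in> S \<Longrightarrow> x - y \<in> S" using *(4)[of x "-y"] *(3)[of y] by simp
qed

lemma is_subring_sum:
  assumes "is_subring S" "\<And>i. i \<in> I \<Longrightarrow> f i \<in> S"
  shows "sum f I \<in> S"
  using assms(2) by (induction I rule: infinite_finite_induct) (auto intro: is_subringD[OF assms(1)])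

lemma is_subring_prod:
  assumes "is_subring S" "\<And>i. i \<in> I \<Longrightarrow> f i \<in> S"
  shows "prod f I \<in> S"
  using assms(2) by (induction I rule: infinite_finite_induct) (auto intro: is_subringD[OF assms(1)])

lemma is_subring_power: "is_subring S \<Longrightarrow> x \<in> S \<Longrightarrow> x ^ n \<in> S"
  by (induction n) (auto intro: is_subringD)

lemma is_subring_of_nat: "is_subring S \<Longrightarrow> of_nat n \<in> S"
  by (induction n) (auto intro: is_subringD)

lemma is_subring_of_int: "is_subring S \<Longrightarrow> of_int n \<in> S"
  by (cases n rule: int_cases2) (auto intro: is_subringD is_subring_of_nat)

lemma is_subring_Ints: "is_subring (\<int> :: 'a::comm_ring_1 set)"
  by (auto simp: is_subring_def)

lemma is_subring_Rats: "is_subring (\<rat> :: 'a::field_char_0 set)"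
  by (auto simp: is_subring_def)

lemma det_in_subring:
  assumes S: "is_subring S" and A: "A \<in> carrier_mat n n"
    and "\<And>i j. i < n \<Longrightarrow> j < n \<Longrightarrow> A $$ (i, j) \<in> S"
  shows "det A \<in> S"
  unfolding det_def'[OF A]
proof (rule is_subring_sum[OF S])
  fix p assume "p \<in> {p. p permutes {0..<n}}"
  hence p: "p permutes {0..<n}" by simp
  have "(\<Prod>i = 0..<n. A $$ (i, p i)) \<in> S"
    using p permutes_in_image[OF p] assms(3) by (intro is_subring_prod[OF S]) auto
  thus "signof p * (\<Prod>i = 0..<n. A $$ (i, p i)) \<in> S"
    by (cases "sign p = 1") (auto simp: sign_def intro: is_subringD[OF S])
qed

lemma is_subring_poly_coeffs:
  assumes S: "is_subring S"
  shows "is_subring {p :: 'a::comm_ring_1 poly. \<forall>i. coeff p i \<in> S}"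
  unfolding is_subring_def
  by (auto simp: coeff_mult coeff_1 intro!: is_subringD[OF S] is_subring_sum[OF S])

text \<open>
  The polynomials with coefficients in \<open>S\<close> form a subring, which contains the entries of the characteristic matrix.
\<close>

lemma char_poly_coeffs_in_subring:
  assumes S: "is_subring S" and A: "A \<in> carrier_mat n n"
    and "\<And>i j. i < n \<Longrightarrow> j < n \<Longrightarrow> A $$ (i, j) \<in> S"
  shows "coeff (char_poly A) k \<in> S"
proof -
  have "char_poly A \<in> {p. \<forall>i. coeff p i \<in> S}"
    unfolding char_poly_def
  proof (rule det_in_subring[OF is_subring_poly_coeffs[OF S]])
    show "char_poly_matrix A \<in> carrier_mat n n" using A by simp
    fix i j assume "i < n" "j < n"
    thus "char_poly_matrix A $$ (i, j) \<in> {p. \<forall>k. coeff p k \<in> S}"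
      using A assms(3) unfolding char_poly_matrix_def
      by (auto simp: coeff_pCons split: nat.split intro!: is_subringD[OF S])
  qed
  thus ?thesis by simp
qed

text \<open>
  The equations say that the nonzero vector \<open>b\<close> is an eigenvector of \<open>A\<close> with eigenvalue \<open>z\<close>.
\<close>

lemma char_poly_eigenvalue:
  fixes A :: "complex mat"
  assumes A: "A \<in> carrier_mat n n" and k: "k < n" "b k \<noteq> 0"
    and eq: "\<And>i. i < n \<Longrightarrow> z * b i = (\<Sum>j<n. A $$ (i, j) * b j)"
  shows "poly (char_poly A) z = 0"
proof -
  have "eigenvector A (vec n b) z"
    unfolding eigenvector_def
  proof (intro conjI)
    show "vec n b \<in> carrier_vec (dim_row A)" using A by simp
    show "vec n b \<noteq> 0\<^sub>v (dim_row A)"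
      using k A by (metis carrier_matD(1) index_vec index_zero_vec(1))
    show "A *\<^sub>v vec n b = z \<cdot>\<^sub>v vec n b"
      using A eq by (intro eq_vecI) (auto simp: scalar_prod_def lessThan_atLeast0)
  qed
  hence "eigenvalue A z" unfolding eigenvalue_def by blast
  thus ?thesis using eigenvalue_root_char_poly[OF A] by simp
qed

text \<open>
  Every row of \<open>W\<close> is an eigenvector of \<open>A\<close>.  In matrix form, \<open>D W = W A\<^sup>T\<close> with the diagonal matrix \<open>D\<close> of
  the eigenvalues, so \<open>A\<^sup>T\<close> is similar to \<open>D\<close>.
\<close>

lemma char_poly_diagonalised:
  fixes A W :: "complex mat"
  assumes A: "A \<in> carrier_mat n n" and W: "W \<in> carrier_mat n n" and "det W \<noteq> 0"
    and eq: "\<And>i j. i < n \<Longrightarrow> j < n \<Longrightarrow> x i * W $$ (i, j) = (\<Sum>k<n. A $$ (j, k) * W $$ (i, k))"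
  shows "char_poly A = (\<Prod>i<n. [:- x i, 1:])"
proof -
  define D where "D = mat n n (\<lambda>(i, j). if i = j then x i else 0)"
  have D: "D \<in> carrier_mat n n" by (simp add: D_def)
  have WT: "transpose_mat W \<in> carrier_mat n n" using W by simp
  have "det (transpose_mat W) \<noteq> 0" using det_transpose[OF W] assms(3) by simp
  hence "transpose_mat W \<in> Units (ring_mat TYPE(complex) n ())"
    using det_non_zero_imp_unit[OF WT, of "()"] by blast
  then obtain V where V: "V \<in> carrier_mat n n" "transpose_mat W * V = 1\<^sub>m n" "V * transpose_mat W = 1\<^sub>m n"
    unfolding Units_def ring_mat_def by auto
  have AW: "A * transpose_mat W = transpose_mat W * D"
  proof (rule eq_matI)
    fix i j assume "i < dim_row (transpose_mat W * D)" "j < dim_col (transpose_mat W * D)"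
    hence ij: "i < n" "j < n" using W D by auto
    have "(A * transpose_mat W) $$ (i, j) = (\<Sum>k<n. A $$ (i, k) * W $$ (j, k))"
      using ij A W by (simp add: scalar_prod_def lessThan_atLeast0)
    also have "\<dots> = x j * W $$ (j, i)" using eq[OF ij(2) ij(1)] by simp
    also have "\<dots> = (\<Sum>k<n. W $$ (k, i) * (if k = j then x k else 0))"
      using ij by (simp add: if_distrib sum.delta cong: if_cong)
    also have "\<dots> = (transpose_mat W * D) $$ (i, j)"
      using ij W by (simp add: scalar_prod_def lessThan_atLeast0 D_def)
    finally show "(A * transpose_mat W) $$ (i, j) = (transpose_mat W * D) $$ (i, j)" .
  qed (use A W D in auto)
  have "A = A * (transpose_mat W * V)" using A V by simp
  also have "\<dots> = (A * transpose_mat W) * V" using A WT V by simp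
  also have "\<dots> = transpose_mat W * D * V" by (simp add: AW)
  finally have "similar_mat A D"
    unfolding similar_mat_def similar_mat_wit_def Let_def using A V WT D
    by (intro exI[of _ "transpose_mat W"] exI[of _ V]) auto
  hence "char_poly A = char_poly D" by (rule char_poly_similar)
  also have "\<dots> = (\<Prod>a\<leftarrow>diag_mat D. [:- a, 1:])"
    using D by (intro char_poly_upper_triangular) (auto simp: D_def)
  also have "diag_mat D = map x [0..<n]"
    by (auto simp: diag_mat_def D_def intro!: nth_equalityI)
  also have "(\<Prod>a\<leftarrow>map x [0..<n]. [:- a, 1:]) = (\<Prod>i<n. [:- x i, 1:])"
    using prod.distinct_set_conv_list[of "[0..<n]" "\<lambda>i. [:- x i, 1:]"] by (simp add: o_def lessThan_atLeast0)
  finally show ?thesis .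
qed

section \<open>Algebraic integers form a ring\<close>

definition span_over :: "complex set \<Rightarrow> complex set \<Rightarrow> complex set" where
  "span_over S V = {\<Sum>v\<in>V. c v * v | c. \<forall>v\<in>V. c v \<in> S}"

lemma span_over_add:
  assumes "is_subring S" "x \<in> span_over S V" "y \<in> span_over S V"
  shows "x + y \<in> span_over S V"
proof -
  from assms obtain c d where "x = (\<Sum>v\<in>V. c v * v)" "\<forall>v\<in>V. c v \<in> S"
    "y = (\<Sum>v\<in>V. d v * v)" "\<forall>v\<in>V. d v \<in> S" unfolding span_over_def by blast
  thus ?thesis unfolding span_over_def
    by (auto intro!: exI[of _ "\<lambda>v. c v + d v"] is_subringD[OF assms(1)] simp: sum.distrib ring_distribs)
qed

lemma span_over_smult:
  assumes "is_subring S" "x \<in> span_over S V" "a \<in> S"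
  shows "a * x \<in> span_over S V"
proof -
  from assms obtain c where "x = (\<Sum>v\<in>V. c v * v)" "\<forall>v\<in>V. c v \<in> S"
    unfolding span_over_def by blast
  thus ?thesis unfolding span_over_def
    by (auto intro!: exI[of _ "\<lambda>v. a * c v"] is_subringD[OF assms(1)] assms(3) simp: sum_distrib_left mult_ac)
qed

lemma span_over_base:
  assumes "is_subring S" "finite V" "v \<in> V"
  shows "v \<in> span_over S V"
  unfolding span_over_def using assms
  by (auto intro!: exI[of _ "\<lambda>w. if w = v then 1 else 0"] is_subringD[OF assms(1)]
      simp: if_distrib[of "\<lambda>a. a * _"] sum.delta cong: if_cong)

lemma span_over_sum:
  assumes "is_subring S" "\<And>i. i \<in> I \<Longrightarrow> f i \<in> span_over S V"
  shows "sum f I \<in> span_over S V"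
proof -
  have "0 \<in> span_over S V" unfolding span_over_def by (auto intro!: exI[of _ "\<lambda>v. 0"] is_subringD[OF assms(1)])
  with assms(2) show ?thesis
    by (induction I rule: infinite_finite_induct) (auto intro!: span_over_add[OF assms(1)])
qed

lemma span_over_stable:
  assumes S: "is_subring S" and "\<And>v. v \<in> V \<Longrightarrow> z * v \<in> span_over S V" and "x \<in> span_over S V"
  shows "z * x \<in> span_over S V"
proof -
  from assms obtain c where c: "x = (\<Sum>v\<in>V. c v * v)" "\<forall>v\<in>V. c v \<in> S"
    unfolding span_over_def by blast
  have "z * x = (\<Sum>v\<in>V. c v * (z * v))" by (simp add: c sum_distrib_left mult_ac)
  also have "\<dots> \<in> span_over S V"
  proof (rule span_over_sum[OF S])
    fix v assume "v \<in> V"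
    thus "c v * (z * v) \<in> span_over S V" using c assms(2) span_over_smult[OF S] by blast
  qed
  finally show ?thesis .
qed

text \<open>
  Multiplication by \<open>z\<close> acts on the generators \<open>V\<close> by a matrix over \<open>S\<close>.  Its characteristic polynomial
  vanishes at \<open>z\<close>, as the vector of generators is an eigenvector.
\<close>

lemma monic_poly_of_stable_span:
  assumes S: "is_subring S" and V: "finite V" "v0 \<in> V" "v0 \<noteq> 0"
    and "\<And>v. v \<in> V \<Longrightarrow> z * v \<in> span_over S V"
  shows "\<exists>p. lead_coeff p = 1 \<and> (\<forall>i. coeff p i \<in> S) \<and> poly p z = 0"
proof -
  obtain b where b: "bij_betw b {..<card V} V"
    using ex_bij_betw_nat_finite[OF V(1)] by (auto simp: lessThan_atLeast0)
  have "\<forall>v\<in>V. \<exists>c. z * v = (\<Sum>w\<in>V. c w * w) \<and> (\<forall>w\<in>V. c w \<in> S)"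
    using assms(5) unfolding span_over_def by fastforce
  then obtain c where c: "\<And>v. v \<in> V \<Longrightarrow> z * v = (\<Sum>w\<in>V. c v w * w)" "\<And>v w. v \<in> V \<Longrightarrow> w \<in> V \<Longrightarrow> c v w \<in> S"
    by metis
  define n where "n = card V"
  define A where "A = mat n n (\<lambda>(i, j). c (b i) (b j))"
  have A: "A \<in> carrier_mat n n" by (simp add: A_def)
  have bV: "b i \<in> V" if "i < n" for i using b that by (auto simp: bij_betw_def n_def)
  have "v0 \<in> b ` {..<n}" using b V(2) unfolding bij_betw_def n_def by simp
  then obtain k where k: "k < n" "b k = v0" by auto
  have "poly (char_poly A) z = 0"
  proof (rule char_poly_eigenvalue[OF A, of k b])
    fix i assume i: "i < n"
    have "z * b i = (\<Sum>w\<in>V. c (b i) w * w)" using c(1)[OF bV[OF i]] .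
    also have "\<dots> = (\<Sum>j<n. c (b i) (b j) * b j)"
      unfolding n_def by (rule sum.reindex_bij_betw[OF b, symmetric])
    finally show "z * b i = (\<Sum>j<n. A $$ (i, j) * b j)" using i by (simp add: A_def)
  qed (use k V in auto)
  moreover have "coeff (char_poly A) i \<in> S" for i
    using c(2) bV by (intro char_poly_coeffs_in_subring[OF S A]) (auto simp: A_def)
  moreover have "lead_coeff (char_poly A) = 1" using degree_monic_char_poly[OF A] by simp
  ultimately show ?thesis by blast
qed

text \<open>
  If \<open>x\<close> and \<open>y\<close> are integral over \<open>S\<close>, the finitely many monomials \<open>x\<^sup>i y\<^sup>j\<close> below the degrees of
  the equations span a module that is stable under both.
\<close>

lemma common_stable_span:
  assumes S: "is_subring S"
    and p: "lead_coeff p = 1" "\<And>i. coeff p i \<in> S" "poly p x = 0"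
    and q: "lead_coeff q = 1" "\<And>i. coeff q i \<in> S" "poly q y = 0"
  obtains V where "finite V" "1 \<in> V"
    "\<And>v. v \<in> V \<Longrightarrow> x * v \<in> span_over S V" "\<And>v. v \<in> V \<Longrightarrow> y * v \<in> span_over S V"
proof -
  \<comment> \<open>below the degrees, higher powers are reduced by the two equations\<close>
  define V where "V = (\<lambda>(i, j). x ^ i * y ^ j) ` ({..<degree p} \<times> {..<degree q})"
  have fin: "finite V" by (simp add: V_def)
  have deg: "degree r > 0" if "lead_coeff r = 1" "poly r z = 0" for r :: "complex poly" and z
    using that by (metis degree_eq_zeroE lead_coeff_pCons(2) not_gr_zero mult_zero_right
        one_neq_zero poly_pCons add.right_neutral poly_0 pCons_0_0)
  have red: "z ^ degree r = (\<Sum>i<degree r. - coeff r i * z ^ i)"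
    if "lead_coeff r = 1" "poly r z = 0" for r :: "complex poly" and z
  proof -
    have "0 = (\<Sum>i\<le>degree r. coeff r i * z ^ i)" using that by (simp add: poly_altdef)
    also have "{..degree r} = insert (degree r) {..<degree r}" by auto
    also have "(\<Sum>i\<in>\<dots>. coeff r i * z ^ i) = z ^ degree r + (\<Sum>i<degree r. coeff r i * z ^ i)"
      using that by simp
    finally show ?thesis by (simp add: sum_negf add_eq_0_iff)
  qed
  have "1 \<in> V" unfolding V_def using deg[OF p(1,3)] deg[OF q(1,3)]
    by (auto intro!: image_eqI[of _ _ "(0, 0)"])
  moreover have "x * v \<in> span_over S V" if "v \<in> V" for v
  proof -
    from that obtain i j where ij: "i < degree p" "j < degree q" "v = x ^ i * y ^ j"
      by (auto simp: V_def)
    show ?thesis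
    proof (cases "Suc i < degree p")
      case True
      hence "x * v \<in> V" using ij by (auto simp: V_def intro!: image_eqI[of _ _ "(Suc i, j)"])
      thus ?thesis by (rule span_over_base[OF S fin])
    next
      case False
      hence "Suc i = degree p" using ij by simp
      hence "x * v = x ^ degree p * y ^ j" by (simp add: ij flip: power_Suc)
      also have "\<dots> = (\<Sum>k<degree p. - coeff p k * (x ^ k * y ^ j))"
        by (simp only: red[OF p(1,3)] sum_distrib_right mult.assoc)
      also have "\<dots> \<in> span_over S V"
        using ij by (intro span_over_sum[OF S] span_over_smult[OF S] span_over_base[OF S fin])
          (auto simp: V_def intro: is_subringD[OF S] p)
      finally show ?thesis .
    qed
  qed
  moreover have "y * v \<in> span_over S V" if "v \<in> V" for v
  proof -
    from that obtain i j where ij: "i < degree p" "j < degree q" "v = x ^ i * y ^ j"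
      by (auto simp: V_def)
    show ?thesis
    proof (cases "Suc j < degree q")
      case True
      hence "y * v \<in> V" using ij by (auto simp: V_def intro!: image_eqI[of _ _ "(i, Suc j)"])
      thus ?thesis by (rule span_over_base[OF S fin])
    next
      case False
      hence "Suc j = degree q" using ij by simp
      hence "y * v = x ^ i * y ^ degree q" by (simp add: ij flip: power_Suc)
      also have "\<dots> = (\<Sum>k<degree q. - coeff q k * (x ^ i * y ^ k))"
        by (simp add: red[OF q(1,3)] sum_distrib_left sum_distrib_right mult_ac)
      also have "\<dots> \<in> span_over S V"
        using ij by (intro span_over_sum[OF S] span_over_smult[OF S] span_over_base[OF S fin])
          (auto simp: V_def intro: is_subringD[OF S] q)
      finally show ?thesis .
    qed
  qed
  ultimately show thesis using that fin by blast
qed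

lemma integral_closed:
  assumes S: "is_subring S"
    and p: "lead_coeff p = 1" "\<And>i. coeff p i \<in> S" "poly p x = 0"
    and q: "lead_coeff q = 1" "\<And>i. coeff q i \<in> S" "poly q y = 0"
  shows "\<exists>r. lead_coeff r = 1 \<and> (\<forall>i. coeff r i \<in> S) \<and> poly r (x + y) = (0::complex)"
    and "\<exists>r. lead_coeff r = 1 \<and> (\<forall>i. coeff r i \<in> S) \<and> poly r (x * y) = (0::complex)"
proof -
  from common_stable_span[OF assms] obtain V where V: "finite V" "1 \<in> V"
    "\<And>v. v \<in> V \<Longrightarrow> x * v \<in> span_over S V" "\<And>v. v \<in> V \<Longrightarrow> y * v \<in> span_over S V" by blast
  show "\<exists>r. lead_coeff r = 1 \<and> (\<forall>i. coeff r i \<in> S) \<and> poly r (x + y) = (0::complex)"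
    by (rule monic_poly_of_stable_span[OF S V(1,2)])
      (auto simp: distrib_right intro: span_over_add[OF S] V)
  show "\<exists>r. lead_coeff r = 1 \<and> (\<forall>i. coeff r i \<in> S) \<and> poly r (x * y) = (0::complex)"
    by (rule monic_poly_of_stable_span[OF S V(1,2)])
      (auto simp: mult.assoc intro: span_over_stable[OF S] V)
qed

lemma algebraic_int_iff:
  "algebraic_int x \<longleftrightarrow> (\<exists>p. lead_coeff p = 1 \<and> (\<forall>i. coeff p i \<in> \<int>) \<and> poly p x = 0)"
  unfolding algebraic_int.simps by auto

lemma algebraic_int_add: "algebraic_int x \<Longrightarrow> algebraic_int y \<Longrightarrow> algebraic_int (x + y :: complex)"
  and algebraic_int_mult: "algebraic_int x \<Longrightarrow> algebraic_int y \<Longrightarrow> algebraic_int (x * y :: complex)"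
  unfolding algebraic_int_iff using integral_closed[OF is_subring_Ints] by metis+

lemma is_subring_algebraic_int: "is_subring {x :: complex. algebraic_int x}"
  unfolding is_subring_def by (auto intro: algebraic_int_add algebraic_int_mult int_imp_algebraic_int)

lemma algebraic_iff_monic:
  "algebraic (x::complex) \<longleftrightarrow> (\<exists>p. lead_coeff p = 1 \<and> (\<forall>i. coeff p i \<in> \<rat>) \<and> poly p x = 0)"
proof
  assume "algebraic x"
  then obtain p where p: "\<forall>i. coeff p i \<in> \<rat>" "p \<noteq> 0" "poly p x = 0"
    unfolding algebraic_altdef by blast
  hence "lead_coeff (Polynomial.smult (inverse (lead_coeff p)) p) = 1" by simp
  moreover have "\<forall>i. coeff (Polynomial.smult (inverse (lead_coeff p)) p) i \<in> \<rat>" using p by auto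
  moreover have "poly (Polynomial.smult (inverse (lead_coeff p)) p) x = 0" using p by simp
  ultimately show "\<exists>p. lead_coeff p = 1 \<and> (\<forall>i. coeff p i \<in> \<rat>) \<and> poly p x = 0" by blast
next
  assume "\<exists>p. lead_coeff p = 1 \<and> (\<forall>i. coeff p i \<in> \<rat>) \<and> poly p x = 0"
  thus "algebraic x" unfolding algebraic_altdef by force
qed

lemma algebraic_add: "algebraic x \<Longrightarrow> algebraic y \<Longrightarrow> algebraic (x + y :: complex)"
  and algebraic_mult: "algebraic x \<Longrightarrow> algebraic y \<Longrightarrow> algebraic (x * y :: complex)"
  unfolding algebraic_iff_monic using integral_closed[OF is_subring_Rats] by metis+

lemma is_subring_algebraic: "is_subring {x :: complex. algebraic x}"
  unfolding is_subring_def by (auto intro: algebraic_add algebraic_mult rat_imp_algebraic)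

section \<open>Simple algebraic extensions of the rationals and their embeddings\<close>

lemma map_poly_of_rat:
  "map_poly of_rat (f - g) = (map_poly of_rat f - map_poly of_rat g :: 'a::field_char_0 poly)"
  "map_poly of_rat (- g) = (- map_poly of_rat g :: 'a::field_char_0 poly)"
  "map_poly of_rat (f * g) = (map_poly of_rat f * map_poly of_rat g :: 'a::field_char_0 poly)"
  "map_poly of_rat (f ^ n) = (map_poly of_rat f ^ n :: 'a::field_char_0 poly)"
  "map_poly of_rat (sum h I) = (\<Sum>i\<in>I. map_poly of_rat (h i) :: 'a::field_char_0 poly)"
  "map_poly of_rat g = (0 :: 'a::field_char_0 poly) \<longleftrightarrow> g = 0"
proof -
  interpret map_poly_inj_idom_hom "of_rat :: rat \<Rightarrow> 'a" ..
  show "map_poly of_rat (f - g) = (map_poly of_rat f - map_poly of_rat g :: 'a poly)"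
    "map_poly of_rat (- g) = (- map_poly of_rat g :: 'a poly)"
    "map_poly of_rat (f * g) = (map_poly of_rat f * map_poly of_rat g :: 'a poly)"
    "map_poly of_rat (f ^ n) = (map_poly of_rat f ^ n :: 'a poly)"
    "map_poly of_rat (sum h I) = (\<Sum>i\<in>I. map_poly of_rat (h i) :: 'a poly)"
    "map_poly of_rat g = (0 :: 'a poly) \<longleftrightarrow> g = 0"
    by (simp_all only: hom_minus hom_uminus hom_mult hom_power hom_sum hom_0_iff)
qed

definition qeval :: "rat poly \<Rightarrow> complex \<Rightarrow> complex" where
  "qeval g x = poly (map_poly of_rat g) x"

lemma qeval_simps [simp]:
  "qeval 0 x = 0" "qeval 1 x = 1" "qeval [:c:] x = of_rat c" "qeval [:0, 1:] x = x"
  "qeval (f + g) x = qeval f x + qeval g x" "qeval (f - g) x = qeval f x - qeval g x"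
  "qeval (- g) x = - qeval g x" "qeval (f * g) x = qeval f x * qeval g x"
  "qeval (Polynomial.smult c g) x = of_rat c * qeval g x" "qeval (pCons c g) x = of_rat c + x * qeval g x"
  by (simp_all add: qeval_def hom_distribs map_poly_of_rat)

lemma qeval_power [simp]: "qeval (g ^ n) x = qeval g x ^ n"
  by (induction n) auto

lemma qeval_sum [simp]: "qeval (sum f I) x = (\<Sum>i\<in>I. qeval (f i) x)"
  by (induction I rule: infinite_finite_induct) auto

lemma qeval_altdef: "qeval g x = (\<Sum>i\<le>degree g. of_rat (coeff g i) * x ^ i)"
  by (simp add: qeval_def poly_altdef)

lemma qeval_monom [simp]: "qeval (Polynomial.monom c n) x = of_rat c * x ^ n"
  by (simp add: qeval_def poly_monom hom_distribs)

lemma qeval_pcompose [simp]: "qeval (g \<circ>\<^sub>p f) x = qeval g (qeval f x)"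
  by (simp add: qeval_def poly_pcompose hom_distribs)

lemma complex_of_real_of_rat: "complex_of_real (real_of_rat q) = of_rat q"
proof -
  obtain b c where "q = Rat.Fract b c" "c > 0" by (cases q) auto
  thus ?thesis by (simp add: of_rat_rat)
qed

lemma cmod_of_rat: "cmod (of_rat q) = \<bar>real_of_rat q\<bar>"
proof -
  obtain a b where "q = Rat.Fract a b" "b > 0" by (cases q) auto
  thus ?thesis by (simp add: of_rat_rat norm_divide)
qed

lemma Rats_coeffs_imp_rat_poly:
  assumes "\<And>i. coeff p i \<in> \<rat>"
  obtains q :: "rat poly" where "p = map_poly of_rat q"
proof -
  have "\<exists>r. coeff p i = of_rat r" for i using assms[of i] by (blast elim: Rats_cases)
  then obtain r where r: "\<And>i. coeff p i = of_rat (r i)" using choice[of "\<lambda>i r. coeff p i = of_rat r"] by blast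
  have "p = (\<Sum>i\<le>degree p. Polynomial.monom (coeff p i) i)"
    by (simp add: poly_as_sum_of_monoms)
  also have "\<dots> = (\<Sum>i\<le>degree p. Polynomial.monom (of_rat (r i)) i)" by (simp only: r)
  also have "\<dots> = map_poly of_rat (\<Sum>i\<le>degree p. Polynomial.monom (r i) i)"
    by (simp add: map_poly_of_rat)
  finally show thesis using that by blast
qed

lemma algebraic_iff_qeval: "algebraic x \<longleftrightarrow> (\<exists>g. g \<noteq> 0 \<and> qeval g x = 0)"
proof
  assume "algebraic x"
  then obtain p where p: "\<And>i. coeff p i \<in> \<rat>" "p \<noteq> 0" "poly p x = 0"
    unfolding algebraic_altdef by blast
  from Rats_coeffs_imp_rat_poly[OF p(1)] obtain q where q: "p = map_poly of_rat q" by blast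
  have "q \<noteq> 0" using p(2) q by auto
  moreover have "qeval q x = 0" using p(3) q by (simp add: qeval_def)
  ultimately show "\<exists>g. g \<noteq> 0 \<and> qeval g x = 0" by blast
next
  assume "\<exists>g. g \<noteq> 0 \<and> qeval g x = 0"
  then obtain g where g: "g \<noteq> 0" "qeval g x = 0" by blast
  have "(map_poly of_rat g :: complex poly) \<noteq> 0" using g(1) unfolding map_poly_of_rat .
  moreover have "\<forall>i. coeff (map_poly of_rat g :: complex poly) i \<in> \<rat>" by simp
  ultimately show "algebraic x" unfolding algebraic_altdef using g(2)[unfolded qeval_def] by blast
qed

text \<open>
  For a number that is not algebraic the value is arbitrary; the same holds for the degree and the conjugates below.
\<close>

definition minpoly :: "complex \<Rightarrow> rat poly" where
  "minpoly x = (ARG_MIN degree p. p \<noteq> 0 \<and> lead_coeff p = 1 \<and> qeval p x = 0)"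

definition deg :: "complex \<Rightarrow> nat" where
  "deg x = degree (minpoly x)"

definition conjs :: "complex \<Rightarrow> complex set" where
  "conjs x = {a. qeval (minpoly x) a = 0}"

lemma minpoly:
  assumes "algebraic x"
  shows "lead_coeff (minpoly x) = 1" "qeval (minpoly x) x = 0"
    and "\<And>g. g \<noteq> 0 \<Longrightarrow> qeval g x = 0 \<Longrightarrow> deg x \<le> degree g"
proof -
  have *: "\<exists>h. degree h = degree g \<and> h \<noteq> 0 \<and> lead_coeff h = 1 \<and> qeval h x = 0"
    if "g \<noteq> 0" "qeval g x = 0" for g
    using that by (intro exI[of _ "Polynomial.smult (inverse (lead_coeff g)) g"]) auto
  obtain g where "g \<noteq> 0 \<and> lead_coeff g = 1 \<and> qeval g x = 0"
    using assms * unfolding algebraic_iff_qeval by blast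
  note min = arg_min_nat_lemma[of "\<lambda>p. p \<noteq> 0 \<and> lead_coeff p = 1 \<and> qeval p x = 0", OF this, of degree,
      folded minpoly_def]
  show "lead_coeff (minpoly x) = 1" "qeval (minpoly x) x = 0" using min by auto
  fix g assume "g \<noteq> 0" "qeval g x = 0"
  thus "deg x \<le> degree g" using min * unfolding deg_def by metis
qed

lemma minpoly_nonzero: "algebraic x \<Longrightarrow> minpoly x \<noteq> 0"
  using minpoly(1) by force

lemma deg_pos:
  assumes "algebraic x" shows "deg x > 0"
proof (rule ccontr)
  assume "\<not> deg x > 0"
  hence "degree (minpoly x) = 0" by (simp add: deg_def)
  then obtain c where c: "minpoly x = [:c:]" by (rule degree_eq_zeroE)
  thus False using minpoly(1,2)[OF assms] by simp
qed

lemma qeval_mod_minpoly: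
  assumes "algebraic x"
  shows "qeval (g mod minpoly x) x = qeval g x" "degree (g mod minpoly x) < deg x"
proof -
  have "qeval g x = qeval (g div minpoly x * minpoly x + g mod minpoly x) x" by simp
  also have "\<dots> = qeval (g mod minpoly x) x"
    using minpoly(2)[OF assms] by (simp only: qeval_simps) simp
  finally show "qeval (g mod minpoly x) x = qeval g x" by simp
  show "degree (g mod minpoly x) < deg x"
    using degree_mod_less'[of "minpoly x" g] minpoly_nonzero[OF assms] deg_pos[OF assms]
    by (cases "g mod minpoly x = 0") (auto simp: deg_def)
qed

lemma qeval_eq_0_iff:
  assumes "algebraic x"
  shows "qeval g x = 0 \<longleftrightarrow> minpoly x dvd g"
proof
  assume "qeval g x = 0"
  hence z: "qeval (g mod minpoly x) x = 0" by (simp only: qeval_mod_minpoly[OF assms])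
  have "g mod minpoly x = 0"
  proof (rule ccontr)
    assume "g mod minpoly x \<noteq> 0"
    from minpoly(3)[OF assms this z] qeval_mod_minpoly(2)[OF assms, of g] show False by simp
  qed
  thus "minpoly x dvd g" by (simp add: dvd_eq_mod_eq_0)
next
  assume "minpoly x dvd g"
  thus "qeval g x = 0" using minpoly(2)[OF assms] by (auto elim!: dvdE)
qed

lemma conjs_self: "algebraic x \<Longrightarrow> x \<in> conjs x"
  by (simp add: conjs_def minpoly)

lemma conjs_algebraic: "algebraic x \<Longrightarrow> a \<in> conjs x \<Longrightarrow> algebraic a"
  unfolding algebraic_iff_qeval[of a] conjs_def using minpoly_nonzero[of x] by blast

text \<open>Irreducibility of the minimal polynomial: a rational polynomial vanishes at all conjugates or at none.\<close>

lemma qeval_conj_eq_0_iff: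
  assumes x: "algebraic x" and a: "a \<in> conjs x"
  shows "qeval g a = 0 \<longleftrightarrow> qeval g x = 0"
proof -
  note alg = conjs_algebraic[OF assms]
  have "minpoly a dvd minpoly x" using a qeval_eq_0_iff[OF alg] by (simp add: conjs_def)
  then obtain h where h: "minpoly x = minpoly a * h" by (auto elim: dvdE)
  have "qeval (minpoly a) x = 0"
  proof (rule ccontr)
    assume "qeval (minpoly a) x \<noteq> 0"
    hence "qeval h x = 0" using minpoly(2)[OF x] unfolding h by simp
    moreover have "h \<noteq> 0" using minpoly_nonzero[OF x] h by auto
    ultimately have "deg x \<le> degree h" using minpoly(3)[OF x] by blast
    moreover have "deg x = deg a + degree h"
      unfolding deg_def h using minpoly_nonzero[OF alg] \<open>h \<noteq> 0\<close> by (rule degree_mult_eq)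
    ultimately show False using deg_pos[OF alg] by simp
  qed
  hence "minpoly x dvd minpoly a" using qeval_eq_0_iff[OF x] by blast
  thus ?thesis unfolding qeval_eq_0_iff[OF x] qeval_eq_0_iff[OF alg]
    using \<open>minpoly a dvd minpoly x\<close> by (metis dvd_trans)
qed

lemma rsquarefree_minpoly:
  assumes x: "algebraic x"
  shows "rsquarefree (map_poly of_rat (minpoly x) :: complex poly)"
  unfolding rsquarefree_roots
proof (intro allI notI)
  fix a :: complex assume a: "poly (map_poly of_rat (minpoly x)) a = 0 \<and> poly (pderiv (map_poly of_rat (minpoly x))) a = 0"
  hence "a \<in> conjs x" by (simp add: conjs_def qeval_def)
  moreover have "qeval (pderiv (minpoly x)) a = 0" using a by (simp add: qeval_def hom_distribs)
  ultimately have "qeval (pderiv (minpoly x)) x = 0" using qeval_conj_eq_0_iff[OF x] by blast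
  moreover have "pderiv (minpoly x) \<noteq> 0" using deg_pos[OF x] by (simp add: deg_def pderiv_eq_0_iff)
  ultimately have "deg x \<le> degree (pderiv (minpoly x))" using minpoly(3)[OF x] by blast
  thus False using deg_pos[OF x] by (simp add: deg_def degree_pderiv)
qed

lemma minpoly_factorization:
  assumes x: "algebraic x"
  shows "map_poly of_rat (minpoly x) = (\<Prod>a\<in>conjs x. [:- a, 1:])"
  using complex_poly_decompose_rsquarefree[OF rsquarefree_minpoly[OF x]] minpoly(1)[OF x]
  by (simp add: conjs_def qeval_def)

lemma finite_conjs: "algebraic x \<Longrightarrow> finite (conjs x)"
  unfolding conjs_def qeval_def using minpoly_nonzero by (intro poly_roots_finite) simp

lemma degree_prod_linear: "finite I \<Longrightarrow> degree (\<Prod>i\<in>I. [:- e i, 1 :: complex:]) = card I"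
  by (subst degree_prod_eq_sum_degree) auto

lemma card_conjs:
  assumes x: "algebraic x" shows "card (conjs x) = deg x"
  using degree_prod_linear[OF finite_conjs[OF x], of "\<lambda>a. a"] minpoly_factorization[OF x]
  by (metis deg_def of_rat_hom.degree_map_poly_hom)

definition is_subfield :: "complex set \<Rightarrow> bool" where
  "is_subfield S \<longleftrightarrow> is_subring S \<and> (\<forall>x\<in>S. inverse x \<in> S)"

lemma is_subfieldD:
  assumes "is_subfield S"
  shows "is_subring S" "x \<in> S \<Longrightarrow> inverse x \<in> S" "x \<in> S \<Longrightarrow> y \<in> S \<Longrightarrow> x / y \<in> S" "of_rat q \<in> S"
proof -
  show *: "is_subring S" "\<And>x. x \<in> S \<Longrightarrow> inverse x \<in> S" using assms by (auto simp: is_subfield_def)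
  show **: "x \<in> S \<Longrightarrow> y \<in> S \<Longrightarrow> x / y \<in> S" for x y
    by (simp add: divide_inverse * is_subringD(5)[OF *(1)])
  obtain a b where "q = Rat.Fract a b" "b > 0" by (cases q) auto
  hence "of_rat q = (of_int a / of_int b :: complex)" by (simp add: of_rat_rat)
  thus "of_rat q \<in> S" using ** is_subring_of_int[OF *(1)] by simp
qed

text \<open>
  The ring generated by \<open>x\<close> over the rationals.  It is the field generated by \<open>x\<close>, as \<open>x\<close> is algebraic wherever
  the field structure matters.
\<close>

definition Qadj :: "complex \<Rightarrow> complex set" where
  "Qadj x = range (\<lambda>g. qeval g x)"

lemma qeval_in_subfield: "is_subfield S \<Longrightarrow> x \<in> S \<Longrightarrow> qeval g x \<in> S"
  unfolding qeval_altdef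
  by (intro is_subring_sum is_subringD is_subring_power) (auto dest: is_subfieldD(1) is_subfieldD(4))

lemma Qadj_subset: "is_subfield S \<Longrightarrow> x \<in> S \<Longrightarrow> Qadj x \<subseteq> S"
  unfolding Qadj_def using qeval_in_subfield by auto

lemma Qadj_qeval [simp, intro]: "qeval g x \<in> Qadj x"
  by (simp add: Qadj_def)

lemma Qadj_self [simp, intro]: "x \<in> Qadj x"
  using Qadj_qeval[of "[:0, 1:]" x] by simp

lemma is_subring_Qadj: "is_subring (Qadj x)"
proof -
  have mem: "\<exists>h. y = qeval h x" if "y \<in> Qadj x" for y using that by (auto simp: Qadj_def)
  have "0 \<in> Qadj x" "1 \<in> Qadj x" using Qadj_qeval[of 0 x] Qadj_qeval[of 1 x] by simp_all
  moreover have "- y \<in> Qadj x" if "y \<in> Qadj x" for y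
  proof -
    from mem[OF that] obtain h where "y = qeval h x" by blast
    thus ?thesis using Qadj_qeval[of "- h" x] by simp
  qed
  moreover have "y + z \<in> Qadj x \<and> y * z \<in> Qadj x" if "y \<in> Qadj x" "z \<in> Qadj x" for y z
  proof -
    from mem[OF that(1)] mem[OF that(2)] obtain h g where "y = qeval h x" "z = qeval g x" by blast
    thus ?thesis using Qadj_qeval[of "h + g" x] Qadj_qeval[of "h * g" x] by simp
  qed
  ultimately show ?thesis unfolding is_subring_def by blast
qed

lemma Qadj_qeval_mem:
  assumes "y \<in> Qadj x"
  shows "qeval g y \<in> Qadj x"
proof -
  from assms obtain h where "y = qeval h x" by (auto simp: Qadj_def)
  thus ?thesis using Qadj_qeval[of "g \<circ>\<^sub>p h" x] by simp
qed

lemma Qadj_mono: "y \<in> Qadj x \<Longrightarrow> Qadj y \<subseteq> Qadj x"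
  using Qadj_qeval_mem by (auto simp: Qadj_def[of y])

lemma qeval_algebraic: "algebraic x \<Longrightarrow> algebraic (qeval g x)"
proof -
  assume x: "algebraic x"
  have "qeval g x \<in> {x. algebraic x}"
    unfolding qeval_altdef using x
    by (intro is_subring_sum[OF is_subring_algebraic] is_subringD[OF is_subring_algebraic]
        is_subring_power[OF is_subring_algebraic]) (auto intro: rat_imp_algebraic)
  thus ?thesis by simp
qed

lemma Qadj_algebraic: "algebraic x \<Longrightarrow> y \<in> Qadj x \<Longrightarrow> algebraic y"
  by (auto simp: Qadj_def qeval_algebraic)

text \<open>The constant coefficient of the minimal polynomial exhibits an inverse as a polynomial expression.\<close>

lemma inverse_in_Qadj:
  assumes "algebraic x"
  shows "inverse x \<in> Qadj x"
proof (cases "x = 0")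
  case False
  obtain c h where ch: "minpoly x = pCons c h" by (cases "minpoly x") auto
  have h: "h \<noteq> 0" using minpoly(1)[OF assms] deg_pos[OF assms] by (auto simp: ch deg_def split: if_splits)
  have eq: "of_rat c + x * qeval h x = 0" using minpoly(2)[OF assms] by (simp add: ch)
  have "c \<noteq> 0"
  proof
    assume "c = 0"
    hence "qeval h x = 0" using eq False by simp
    hence "deg x \<le> degree h" using minpoly(3)[OF assms h] by blast
    thus False using h by (simp add: deg_def ch)
  qed
  hence "qeval h x = - of_rat c / x" using eq False by (simp add: field_simps add_eq_0_iff)
  hence "inverse x = qeval (Polynomial.smult (- inverse c) h) x"
    using \<open>c \<noteq> 0\<close> False by (simp add: of_rat_inverse of_rat_minus of_rat_divide field_simps)
  thus ?thesis by (simp only: Qadj_qeval)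
qed (use is_subringD(1)[OF is_subring_Qadj] in simp)

lemma is_subfield_Qadj: "algebraic x \<Longrightarrow> is_subfield (Qadj x)"
  unfolding is_subfield_def
  by (intro conjI ballI is_subring_Qadj) (rule subsetD[OF Qadj_mono inverse_in_Qadj[OF Qadj_algebraic]])

lemma Qadj_repr:
  assumes "algebraic x" "y \<in> Qadj x"
  obtains g where "y = qeval g x" "degree g < deg x"
proof -
  from assms(2) obtain g where "y = qeval g x" by (auto simp: Qadj_def)
  thus thesis using that[of "g mod minpoly x"] qeval_mod_minpoly[OF assms(1), of g] by simp
qed

lemma qeval_lessThan:
  assumes "degree g < n"
  shows "qeval g x = (\<Sum>k<n. of_rat (coeff g k) * x ^ k)"
proof -
  have "(\<Sum>k<n. of_rat (coeff g k) * x ^ k) = (\<Sum>k\<le>degree g. of_rat (coeff g k) * x ^ k)"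
    using assms by (intro sum.mono_neutral_right) (auto simp: coeff_eq_0)
  thus ?thesis by (simp add: qeval_altdef)
qed

text \<open>For a conjugate \<open>a\<close> of \<open>x\<close> this is the field homomorphism from \<open>Qadj x\<close> that maps \<open>x\<close> to \<open>a\<close>.\<close>

definition emb :: "complex \<Rightarrow> complex \<Rightarrow> complex \<Rightarrow> complex" where
  "emb x a y = qeval (SOME g. qeval g x = y) a"

lemma emb_qeval:
  assumes "algebraic x" "a \<in> conjs x"
  shows "emb x a (qeval g x) = qeval g a"
proof -
  define h where "h = (SOME h. qeval h x = qeval g x)"
  have "qeval h x = qeval g x" unfolding h_def by (rule someI[of _ g]) simp
  hence "qeval (h - g) x = 0" by simp
  hence "qeval (h - g) a = 0" using qeval_conj_eq_0_iff[OF assms] by blast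
  thus ?thesis by (simp add: emb_def h_def)
qed

context
  fixes x a assumes x: "algebraic x" and a: "a \<in> conjs x"
begin

lemma emb_self: "emb x a x = a"
  using emb_qeval[OF x a, of "[:0, 1:]"] by simp

lemma emb_of_rat: "emb x a (of_rat q) = of_rat q"
  using emb_qeval[OF x a, of "[:q:]"] by simp

lemma emb_0: "emb x a 0 = 0" and emb_1: "emb x a 1 = 1"
  using emb_of_rat[of 0] emb_of_rat[of 1] by simp_all

lemma emb_add: "y \<in> Qadj x \<Longrightarrow> z \<in> Qadj x \<Longrightarrow> emb x a (y + z) = emb x a y + emb x a z"
  and emb_mult: "y \<in> Qadj x \<Longrightarrow> z \<in> Qadj x \<Longrightarrow> emb x a (y * z) = emb x a y * emb x a z"
  and emb_diff: "y \<in> Qadj x \<Longrightarrow> z \<in> Qadj x \<Longrightarrow> emb x a (y - z) = emb x a y - emb x a z"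
  unfolding Qadj_def by (auto simp: emb_qeval[OF x a] simp flip: qeval_simps(5,6,8))

lemma emb_sum: "(\<And>i. i \<in> I \<Longrightarrow> f i \<in> Qadj x) \<Longrightarrow> emb x a (sum f I) = (\<Sum>i\<in>I. emb x a (f i))"
  by (induction I rule: infinite_finite_induct)
    (auto simp: emb_0 emb_add is_subring_sum[OF is_subring_Qadj])

lemma emb_power: "y \<in> Qadj x \<Longrightarrow> emb x a (y ^ n) = emb x a y ^ n"
  by (induction n) (auto simp: emb_1 emb_mult is_subring_power[OF is_subring_Qadj])

lemma emb_qeval_comp: "y \<in> Qadj x \<Longrightarrow> emb x a (qeval g y) = qeval g (emb x a y)"
proof -
  assume "y \<in> Qadj x"
  then obtain h where "y = qeval h x" by (auto simp: Qadj_def)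
  thus ?thesis using emb_qeval[OF x a, of "g \<circ>\<^sub>p h"] emb_qeval[OF x a, of h] by simp
qed

lemma emb_eq_0_iff: "y \<in> Qadj x \<Longrightarrow> emb x a y = 0 \<longleftrightarrow> y = 0"
  unfolding Qadj_def by (auto simp: emb_0 emb_qeval[OF x a] qeval_conj_eq_0_iff[OF x a])

lemma emb_in_conjs: "y \<in> Qadj x \<Longrightarrow> emb x a y \<in> conjs y"
  using emb_qeval_comp[of y "minpoly y"] minpoly(2)[OF Qadj_algebraic[OF x]] emb_0
  by (simp add: conjs_def)

end

lemma conjs_algebraic_int:
  assumes y: "algebraic_int y" and b: "b \<in> conjs y"
  shows "algebraic_int b"
proof -
  from y obtain p where p: "lead_coeff p = 1" "\<And>i. coeff p i \<in> \<int>" "poly p y = 0"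
    unfolding algebraic_int_iff by blast
  obtain q :: "rat poly" where q: "p = map_poly of_rat q"
    using Rats_coeffs_imp_rat_poly[of p] p(2) Ints_subset_Rats by blast
  have "qeval q b = 0"
    using qeval_conj_eq_0_iff[OF algebraic_int_imp_algebraic[OF y] b, of q] p(3) q by (simp add: qeval_def)
  hence "poly p b = 0" by (simp add: qeval_def q)
  thus ?thesis unfolding algebraic_int_iff using p by blast
qed

lemma emb_algebraic_int:
  "algebraic x \<Longrightarrow> a \<in> conjs x \<Longrightarrow> y \<in> Qadj x \<Longrightarrow> algebraic_int y \<Longrightarrow> algebraic_int (emb x a y)"
  using conjs_algebraic_int emb_in_conjs by blast

text \<open>Independence of the embeddings: test them against the Lagrange polynomial of a conjugate.\<close>

lemma emb_independent:
  assumes x: "algebraic x" and eq: "\<And>y. y \<in> Qadj x \<Longrightarrow> (\<Sum>a\<in>conjs x. c a * emb x a y) = 0"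
    and a: "a \<in> conjs x"
  shows "c a = 0"
proof -
  have pow: "(\<Sum>b\<in>conjs x. c b * b ^ k) = 0" for k
  proof -
    have "(\<Sum>b\<in>conjs x. c b * b ^ k) = (\<Sum>b\<in>conjs x. c b * emb x b (x ^ k))"
      by (intro sum.cong) (auto simp: emb_power emb_self x)
    also have "\<dots> = 0" by (intro eq is_subring_power is_subring_Qadj Qadj_self)
    finally show ?thesis .
  qed
  have poly: "(\<Sum>b\<in>conjs x. c b * poly P b) = 0" for P
  proof -
    have "(\<Sum>b\<in>conjs x. c b * poly P b) = (\<Sum>b\<in>conjs x. \<Sum>k\<le>degree P. coeff P k * (c b * b ^ k))"
      by (simp add: poly_altdef sum_distrib_left mult_ac)
    also have "\<dots> = (\<Sum>k\<le>degree P. coeff P k * (\<Sum>b\<in>conjs x. c b * b ^ k))"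
      by (subst sum.swap) (simp add: sum_distrib_left)
    finally show ?thesis by (simp add: pow)
  qed
  define P where "P = (\<Prod>b\<in>conjs x - {a}. [:- b, 1:])"
  have "0 = (\<Sum>b\<in>conjs x. c b * poly P b)" using poly by simp
  also have "\<dots> = (\<Sum>b\<in>conjs x. if b = a then c a * poly P a else 0)"
    using finite_conjs[OF x] by (intro sum.cong) (auto simp: P_def poly_prod)
  also have "\<dots> = c a * poly P a" using finite_conjs[OF x] a by simp
  finally show ?thesis using finite_conjs[OF x] by (auto simp: P_def poly_prod)
qed

text \<open>
  A fixed enumeration of the conjugates, which indexes the rows of matrices by numbers.
\<close>

definition cj :: "complex \<Rightarrow> nat \<Rightarrow> complex" where
  "cj x = (SOME f. bij_betw f {..<deg x} (conjs x))"

lemma bij_betw_cj: "algebraic x \<Longrightarrow> bij_betw (cj x) {..<deg x} (conjs x)"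
  unfolding cj_def
  using someI_ex[OF ex_bij_betw_nat_finite[OF finite_conjs, of x]]
  by (simp add: card_conjs lessThan_atLeast0)

lemma cj_in_conjs: "algebraic x \<Longrightarrow> i < deg x \<Longrightarrow> cj x i \<in> conjs x"
  using bij_betw_cj by (auto simp: bij_betw_def)

definition emb_mat :: "complex \<Rightarrow> (nat \<Rightarrow> complex) \<Rightarrow> complex mat" where
  "emb_mat x \<omega> = mat (deg x) (deg x) (\<lambda>(i, j). emb x (cj x i) (\<omega> j))"

lemma emb_mat_carrier [simp]: "emb_mat x \<omega> \<in> carrier_mat (deg x) (deg x)"
  by (simp add: emb_mat_def)

definition qspan :: "nat \<Rightarrow> (nat \<Rightarrow> complex) \<Rightarrow> complex set" where
  "qspan n \<omega> = range (\<lambda>q. \<Sum>j<n. of_rat (q j) * \<omega> j)"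

text \<open>
  A vanishing combination of the rows would be a linear relation between the embeddings.
\<close>

lemma emb_mat_det_nonzero:
  assumes x: "algebraic x" and sp: "Qadj x \<subseteq> qspan (deg x) \<omega>" and \<omega>: "\<And>j. j < deg x \<Longrightarrow> \<omega> j \<in> Qadj x"
  shows "det (emb_mat x \<omega>) \<noteq> 0"
proof
  let ?n = "deg x" and ?W = "emb_mat x \<omega>"
  assume "det ?W = 0"
  hence "det (transpose_mat ?W) = 0" by (simp add: det_transpose[OF emb_mat_carrier])
  have WT: "transpose_mat ?W \<in> carrier_mat ?n ?n" by (rule transpose_carrier_mat[THEN iffD2, OF emb_mat_carrier])
  obtain v where v: "v \<in> carrier_vec ?n" "v \<noteq> 0\<^sub>v ?n" "transpose_mat ?W *\<^sub>v v = 0\<^sub>v ?n"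
    using iffD1[OF det_0_iff_vec_prod_zero[OF WT] \<open>det (transpose_mat ?W) = 0\<close>] by (elim exE conjE)
  define c where "c b = vec_index v (inv_into {..<?n} (cj x) b)" for b
  have c: "c (cj x i) = vec_index v i" if "i < ?n" for i
    using that bij_betw_cj[OF x] by (simp add: c_def bij_betw_def inv_into_f_f)
  have base: "(\<Sum>a\<in>conjs x. c a * emb x a (\<omega> j)) = 0" if j: "j < ?n" for j
  proof -
    have "(\<Sum>a\<in>conjs x. c a * emb x a (\<omega> j)) = (\<Sum>i<?n. c (cj x i) * emb x (cj x i) (\<omega> j))"
      by (rule sum.reindex_bij_betw[OF bij_betw_cj[OF x], symmetric])
    also have "\<dots> = vec_index (transpose_mat ?W *\<^sub>v v) j"
      using v(1) j by (simp add: scalar_prod_def emb_mat_def c lessThan_atLeast0 mult.commute)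
    finally show ?thesis using v j by simp
  qed
  have "c a = 0" if "a \<in> conjs x" for a
  proof (rule emb_independent[OF x _ that])
    fix y assume "y \<in> Qadj x"
    with sp obtain q where q: "y = (\<Sum>j<?n. of_rat (q j) * \<omega> j)" by (auto simp: qspan_def)
    have "emb x a y = (\<Sum>j<?n. of_rat (q j) * emb x a (\<omega> j))" if a: "a \<in> conjs x" for a
    proof -
      have *: "of_rat (q j) \<in> Qadj x" for j using is_subfieldD(4)[OF is_subfield_Qadj[OF x]] .
      show ?thesis unfolding q using \<omega>
        by (subst emb_sum[OF x a]) (auto simp: emb_mult[OF x a *] emb_of_rat[OF x a] intro: is_subringD[OF is_subring_Qadj] *)
    qed
    hence "(\<Sum>a\<in>conjs x. c a * emb x a y) = (\<Sum>a\<in>conjs x. \<Sum>j<?n. of_rat (q j) * (c a * emb x a (\<omega> j)))"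
      by (intro sum.cong) (auto simp: sum_distrib_left mult_ac)
    also have "\<dots> = (\<Sum>j<?n. of_rat (q j) * (\<Sum>a\<in>conjs x. c a * emb x a (\<omega> j)))"
      by (subst sum.swap) (simp add: sum_distrib_left)
    finally show "(\<Sum>a\<in>conjs x. c a * emb x a y) = 0" by (simp add: base)
  qed
  hence "vec_index v i = 0" if "i < ?n" for i using c[OF that] cj_in_conjs[OF x that] by simp
  hence "v = 0\<^sub>v ?n" using v by (intro eq_vecI) auto
  thus False using v by simp
qed

lemma Qadj_eq_qspan_powers: "algebraic x \<Longrightarrow> Qadj x = qspan (deg x) (\<lambda>j. x ^ j)"
proof (intro equalityI subsetI)
  fix y assume x: "algebraic x" and "y \<in> Qadj x"
  then obtain g where "y = qeval g x" "degree g < deg x" by (rule Qadj_repr)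
  thus "y \<in> qspan (deg x) (\<lambda>j. x ^ j)" by (auto simp: qspan_def qeval_lessThan)
next
  fix y assume x: "algebraic x" and "y \<in> qspan (deg x) (\<lambda>j. x ^ j)"
  thus "y \<in> Qadj x" unfolding qspan_def
    by (auto intro!: is_subring_sum is_subring_Qadj is_subringD[OF is_subring_Qadj] is_subring_power
        is_subfieldD(4)[OF is_subfield_Qadj])
qed

text \<open>
  Multiplication by \<open>y\<close> has a rational matrix in the basis of the powers of \<open>x\<close>, and the embeddings diagonalise
  this matrix.
\<close>

lemma prod_emb_rational:
  assumes x: "algebraic x" and y: "y \<in> Qadj x"
  obtains P :: "rat poly" where "map_poly of_rat P = (\<Prod>a\<in>conjs x. [:- emb x a y, 1:])"
proof -
  let ?n = "deg x" and ?W = "emb_mat x (\<lambda>j. x ^ j)"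
  have "y * x ^ j \<in> qspan ?n (\<lambda>j. x ^ j)" for j
    using y by (simp flip: Qadj_eq_qspan_powers[OF x] add: is_subringD[OF is_subring_Qadj] is_subring_power[OF is_subring_Qadj])
  hence "\<forall>j. \<exists>q. y * x ^ j = (\<Sum>k<?n. of_rat (q k) * x ^ k)" by (auto simp: qspan_def)
  then obtain q where q: "\<And>j. y * x ^ j = (\<Sum>k<?n. of_rat (q j k) * x ^ k)" by metis
  define A :: "complex mat" where "A = mat ?n ?n (\<lambda>(j, k). of_rat (q j k))"
  have A: "A \<in> carrier_mat ?n ?n" by (simp add: A_def)
  have "char_poly A = (\<Prod>i<?n. [:- emb x (cj x i) y, 1:])"
  proof (rule char_poly_diagonalised[OF A emb_mat_carrier])
    show "det ?W \<noteq> 0"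
      by (intro emb_mat_det_nonzero x is_subring_power is_subring_Qadj Qadj_self)
        (simp flip: Qadj_eq_qspan_powers[OF x])
    fix i j assume ij: "i < ?n" "j < ?n"
    note a = cj_in_conjs[OF x ij(1)]
    have *: "of_rat r \<in> Qadj x" "x ^ k \<in> Qadj x" for r k
      using is_subfieldD(4)[OF is_subfield_Qadj[OF x]] is_subring_power[OF is_subring_Qadj] by auto
    have "emb x (cj x i) y * emb x (cj x i) (x ^ j) = emb x (cj x i) (y * x ^ j)"
      using y by (simp add: emb_mult[OF x a] *)
    also have "\<dots> = (\<Sum>k<?n. of_rat (q j k) * emb x (cj x i) (x ^ k))"
      unfolding q using * by (simp add: emb_sum[OF x a] emb_mult[OF x a] emb_of_rat[OF x a] is_subringD[OF is_subring_Qadj])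
    finally show "emb x (cj x i) y * ?W $$ (i, j) = (\<Sum>k<?n. A $$ (j, k) * ?W $$ (i, k))"
      using ij by (simp add: emb_mat_def A_def)
  qed
  also have "\<dots> = (\<Prod>a\<in>conjs x. [:- emb x a y, 1:])"
    by (rule prod.reindex_bij_betw[OF bij_betw_cj[OF x]])
  finally have eq: "char_poly A = (\<Prod>a\<in>conjs x. [:- emb x a y, 1:])" .
  have "coeff (char_poly A) i \<in> \<rat>" for i
    by (rule char_poly_coeffs_in_subring[OF is_subring_Rats A]) (auto simp: A_def)
  from Rats_coeffs_imp_rat_poly[OF this] obtain P where "char_poly A = map_poly of_rat P" by blast
  thus thesis using that eq by metis
qed

text \<open>
  If \<open>P\<close> is not constant, it has a complex root, which is a conjugate of \<open>y\<close>, so the minimal polynomial of \<open>y\<close> divides it and the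
  quotient has a smaller degree.
\<close>

lemma power_of_minpoly:
  assumes y: "algebraic y" and "lead_coeff P = 1" and "\<And>b. qeval P b = 0 \<Longrightarrow> b \<in> conjs y"
  shows "\<exists>k. P = minpoly y ^ k"
  using assms(2,3)
proof (induction "degree P" arbitrary: P rule: less_induct)
  case less
  show ?case
  proof (cases "degree P = 0")
    case True
    then obtain c where "P = [:c:]" by (rule degree_eq_zeroE)
    hence "P = minpoly y ^ 0" using less.prems(1) by simp
    thus ?thesis by blast
  next
    case False
    hence "\<not> constant (poly (map_poly of_rat P :: complex poly))"
      by (simp add: constant_degree)
    then obtain b where b: "qeval P b = 0" using fundamental_theorem_of_algebra by (auto simp: qeval_def)
    have "qeval P y = 0" using b qeval_conj_eq_0_iff[OF y less.prems(2)[OF b]] by blast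
    then obtain Q where Q: "P = minpoly y * Q" using qeval_eq_0_iff[OF y] by (auto elim: dvdE)
    have "Q \<noteq> 0" using False Q by auto
    have lc: "lead_coeff Q = 1" using less.prems(1) minpoly(1)[OF y] by (simp add: Q lead_coeff_mult)
    have "degree P = deg y + degree Q"
      unfolding Q deg_def using minpoly_nonzero[OF y] \<open>Q \<noteq> 0\<close> by (rule degree_mult_eq)
    hence "degree Q < degree P" using deg_pos[OF y] by simp
    moreover have "qeval Q b = 0 \<Longrightarrow> b \<in> conjs y" for b using less.prems(2)[of b] by (simp add: Q)
    ultimately obtain k where "Q = minpoly y ^ k" using less.hyps lc by blast
    hence "P = minpoly y ^ Suc k" by (simp add: Q)
    thus ?thesis by blast
  qed
qed

lemma order_prod_linear:
  "finite I \<Longrightarrow> order b (\<Prod>i\<in>I. [:- e i, 1 :: complex:]) = card {i\<in>I. e i = b}"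
proof (induction I rule: finite_induct)
  case (insert i I)
  have nz: "(\<Prod>i\<in>I. [:- e i, 1:]) \<noteq> 0" using insert by (auto simp: prod_zero_iff)
  hence "order b ([:- e i, 1:] * (\<Prod>i\<in>I. [:- e i, 1:])) = order b [:- e i, 1:] + card {i\<in>I. e i = b}"
    using insert nz by (subst order_mult) (auto simp del: mult_pCons_left)
  moreover have "order b [:- e i, 1:] = (if e i = b then 1 else 0)"
    by (auto simp: order_linear' intro!: order_0I)
  moreover have "{j\<in>insert i I. e j = b} = (if e i = b then insert i {j\<in>I. e j = b} else {j\<in>I. e j = b})"
    by auto
  ultimately show ?case using insert by simp
qed (simp add: order_1_eq_0)

lemma order_power_eq: "p \<noteq> 0 \<Longrightarrow> order b (p ^ k) = k * order b (p :: 'a::idom poly)"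
  by (induction k) (auto simp: order_mult)

text \<open>
  The characteristic polynomial \<open>\<Prod> (X - emb x a y)\<close> is rational and all its roots are conjugates of \<open>y\<close>.  So it is a power
  of the minimal polynomial, and every conjugate of \<open>y\<close> is a root of the same multiplicity.
\<close>

lemma emb_fibre_card:
  assumes x: "algebraic x" and y: "y \<in> Qadj x"
  obtains k where "deg x = k * deg y" "\<And>b. b \<in> conjs y \<Longrightarrow> card {a\<in>conjs x. emb x a y = b} = k"
proof -
  note alg = Qadj_algebraic[OF x y]
  from prod_emb_rational[OF x y] obtain P :: "rat poly"
    where P: "map_poly of_rat P = (\<Prod>a\<in>conjs x. [:- emb x a y, 1:])" by blast
  have "lead_coeff (map_poly of_rat P :: complex poly) = 1" unfolding P by (simp add: lead_coeff_prod)
  hence lc: "lead_coeff P = 1" by (metis of_rat_eq_1_iff of_rat_hom.hom_lead_coeff)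
  have "b \<in> conjs y" if "qeval P b = 0" for b
    using that emb_in_conjs[OF x _ y] finite_conjs[OF x] by (auto simp: qeval_def P poly_prod)
  from power_of_minpoly[OF alg lc this] obtain k where k: "P = minpoly y ^ k" by blast
  have fib: "card {a\<in>conjs x. emb x a y = b} = k" if b: "b \<in> conjs y" for b
  proof -
    have "card {a\<in>conjs x. emb x a y = b} = order b (map_poly of_rat P)"
      unfolding P using order_prod_linear[OF finite_conjs[OF x]] by simp
    also have "map_poly of_rat P = (map_poly of_rat (minpoly y) ^ k :: complex poly)"
      unfolding k by (rule map_poly_of_rat)
    also have "order b \<dots> = k * order b (map_poly of_rat (minpoly y))"
      using minpoly_nonzero[OF alg] by (intro order_power_eq) simp
    also have "order b (map_poly of_rat (minpoly y)) = 1"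
      using b rsquarefree_root_order[OF rsquarefree_minpoly[OF alg], of b] minpoly_nonzero[OF alg]
      by (simp add: conjs_def qeval_def)
    finally show ?thesis by simp
  qed
  have "deg x = degree P"
    using degree_prod_linear[OF finite_conjs[OF x], of "\<lambda>a. emb x a y"] card_conjs[OF x] P
    by (metis of_rat_hom.degree_map_poly_hom)
  also have "\<dots> = k * deg y" using minpoly_nonzero[OF alg] by (simp add: k deg_def degree_power_eq)
  finally show thesis using that fib by blast
qed

lemma prod_over_embeddings:
  fixes f :: "complex \<Rightarrow> 'a::comm_semiring_1"
  assumes x: "algebraic x" and y: "y \<in> Qadj x"
  shows "(\<Prod>a\<in>conjs x. f (emb x a y)) = (\<Prod>b\<in>conjs y. f b) ^ (deg x div deg y)"
    and "deg y dvd deg x"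
proof -
  note alg = Qadj_algebraic[OF x y]
  from emb_fibre_card[OF x y] obtain k where k: "deg x = k * deg y"
    "\<And>b. b \<in> conjs y \<Longrightarrow> card {a\<in>conjs x. emb x a y = b} = k" by blast
  have "(\<Prod>a\<in>conjs x. f (emb x a y)) = (\<Prod>b\<in>conjs y. \<Prod>a | a \<in> conjs x \<and> emb x a y = b. f (emb x a y))"
    using emb_in_conjs[OF x _ y] by (intro prod.group[symmetric] finite_conjs x alg) auto
  also have "\<dots> = (\<Prod>b\<in>conjs y. f b ^ k)"
    using k(2) by (intro prod.cong) auto
  finally show "(\<Prod>a\<in>conjs x. f (emb x a y)) = (\<Prod>b\<in>conjs y. f b) ^ (deg x div deg y)"
    using deg_pos[OF alg] by (simp add: k(1) prod.distrib flip: prod_power_distrib)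
  show "deg y dvd deg x" by (simp add: k(1))
qed

lemma conjs_covered:
  assumes x: "algebraic x" and y: "y \<in> Qadj x"
  shows "conjs y = (\<lambda>a. emb x a y) ` conjs x"
proof -
  from emb_fibre_card[OF x y] obtain k where k: "deg x = k * deg y"
    "\<And>b. b \<in> conjs y \<Longrightarrow> card {a\<in>conjs x. emb x a y = b} = k" by blast
  have "k > 0" using deg_pos[OF x] k by (cases k) auto
  hence "{a\<in>conjs x. emb x a y = b} \<noteq> {}" if "b \<in> conjs y" for b
    using k(2)[OF that] by (metis card.empty less_irrefl)
  thus ?thesis using emb_in_conjs[OF x _ y] by blast
qed

lemma coeff_prod_linear:
  "finite I \<Longrightarrow> coeff (\<Prod>i\<in>I. [:- e i, 1 :: complex:]) (card I) = 1 \<and>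
    (I \<noteq> {} \<longrightarrow> coeff (\<Prod>i\<in>I. [:- e i, 1:]) (card I - 1) = - (\<Sum>i\<in>I. e i))"
proof (induction I rule: finite_induct)
  case (insert i I)
  hence deg: "degree (\<Prod>i\<in>I. [:- e i, 1:]) = card I" by (simp add: degree_prod_linear)
  have "coeff (\<Prod>i\<in>I. [:- e i, 1:]) (Suc (card I)) = 0" by (rule coeff_eq_0) (simp add: deg)
  thus ?case using insert by (cases "I = {}") (auto simp: coeff_pCons card_gt_0_iff split: nat.split)
qed auto

lemma trace_rational:
  assumes x: "algebraic x" and y: "y \<in> Qadj x"
  shows "(\<Sum>a\<in>conjs x. emb x a y) \<in> \<rat>"
proof -
  from prod_emb_rational[OF assms] obtain P :: "rat poly"
    where P: "map_poly of_rat P = (\<Prod>a\<in>conjs x. [:- emb x a y, 1:])" by blast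
  have "conjs x \<noteq> {}" using conjs_self[OF x] by auto
  hence "coeff (map_poly of_rat P) (card (conjs x) - 1) = - (\<Sum>a\<in>conjs x. emb x a y)"
    unfolding P using coeff_prod_linear[OF finite_conjs[OF x], of "\<lambda>a. emb x a y"] by simp
  hence "(\<Sum>a\<in>conjs x. emb x a y) = - of_rat (coeff P (card (conjs x) - 1))" by simp
  thus ?thesis by simp
qed

text \<open>
  The norm of a nonzero algebraic integer is a nonzero rational integer.
\<close>

lemma norm_ge_1:
  assumes x: "algebraic x" and y: "y \<in> Qadj x" "algebraic_int y" "y \<noteq> 0"
  shows "1 \<le> (\<Prod>a\<in>conjs x. cmod (emb x a y))"
proof -
  let ?N = "\<Prod>a\<in>conjs x. emb x a y"
  from prod_emb_rational[OF x y(1)] obtain P :: "rat poly"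
    where P: "map_poly of_rat P = (\<Prod>a\<in>conjs x. [:- emb x a y, 1:])" by blast
  have "qeval P 0 = (\<Prod>a\<in>conjs x. - emb x a y)" by (simp add: qeval_def P poly_prod)
  also have "\<dots> = (- 1) ^ card (conjs x) * ?N"
    by (simp flip: prod_constant prod.distrib)
  finally have "?N = (- 1) ^ card (conjs x) * qeval P 0"
    by (simp add: mult.assoc[symmetric] flip: power_mult_distrib)
  hence "?N \<in> \<rat>" by (simp add: qeval_def poly_0_coeff_0)
  moreover have "?N \<in> {z. algebraic_int z}"
    using y by (intro is_subring_prod[OF is_subring_algebraic_int]) (auto intro: emb_algebraic_int[OF x])
  ultimately have "?N \<in> \<int>" using rational_algebraic_int_is_int by blast
  moreover have "?N \<noteq> 0" using y finite_conjs[OF x] emb_eq_0_iff[OF x] by auto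
  ultimately have "cmod ?N \<ge> 1" by (auto elim!: Ints_cases)
  thus ?thesis by (simp add: prod_norm)
qed

section \<open>Primitive elements\<close>

text \<open>
  Division with remainder by a monic polynomial stays within the coefficient ring.  Only divisibility is recorded of the
  quotient, since the remainder is used through its values at the roots of \<open>h\<close>.
\<close>

lemma monic_division:
  fixes h p :: "complex poly"
  assumes S: "is_subring S" and h: "lead_coeff h = 1" "\<And>i. coeff h i \<in> S" and "\<And>i. coeff p i \<in> S"
  shows "\<exists>r. (\<forall>i. coeff r i \<in> S) \<and> h dvd p - r \<and> (r = 0 \<or> degree r < degree h)"
  using assms(4)
proof (induction "degree p" arbitrary: p rule: less_induct)
  case less
  show ?case
  proof (cases "p = 0 \<or> degree p < degree h")
    case True
    thus ?thesis using less.prems by (intro exI[of _ p]) auto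
  next
    case False
    define m where "m = Polynomial.monom (lead_coeff p) (degree p - degree h) * h"
    have hnz: "h \<noteq> 0" using h(1) by auto
    have pnz: "p \<noteq> 0" using False by simp
    have lp: "lead_coeff p \<noteq> 0" using pnz by simp
    have dm: "degree m = degree p"
    proof -
      have d1: "degree (Polynomial.monom (lead_coeff p) (degree p - degree h)) = degree p - degree h"
        by (rule degree_monom_eq[OF lp])
      have "Polynomial.monom (lead_coeff p) (degree p - degree h) \<noteq> 0" using lp by (simp only: monom_eq_0_iff) simp
      from degree_mult_eq[OF this hnz] show ?thesis unfolding m_def d1 using False by simp
    qed
    have "lead_coeff m = lead_coeff p" unfolding m_def lead_coeff_mult lead_coeff_monom using h(1) by simp
    hence cm: "coeff (p - m) (degree p) = 0" by (simp add: dm)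
    have mS: "coeff m i \<in> S" for i
      using less.prems h(2) by (auto simp: m_def coeff_monom_mult intro: is_subringD[OF S])
    have pmS: "coeff (p - m) i \<in> S" for i
      using less.prems mS by (simp add: is_subringD[OF S])
    have le: "degree (p - m) \<le> degree p" using degree_diff_le_max[of p m] by (simp add: dm)
    have hm: "h dvd m" by (simp add: m_def)
    show ?thesis
    proof (cases "p - m = 0")
      case True
      thus ?thesis using hm by (intro exI[of _ 0]) (auto intro: is_subringD[OF S])
    next
      case False
      hence "degree (p - m) \<noteq> degree p" using cm by (metis leading_coeff_0_iff)
      hence "degree (p - m) < degree p" using le by simp
      from less.hyps[OF this pmS] obtain r where
        r: "\<forall>i. coeff r i \<in> S" "h dvd p - m - r" "r = 0 \<or> degree r < degree h" by blast
      have "h dvd (p - m - r) + m" using r(2) hm by (rule dvd_add)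
      hence "h dvd p - r" by (simp add: algebra_simps)
      thus ?thesis using r by blast
    qed
  qed
qed

text \<open>
  Choosing \<open>c\<close> outside finitely many values, \<open>y\<close> is the only common root of its minimal polynomial
  and of the minimal polynomial of \<open>x\<close> transformed by \<open>X \<mapsto> x + c y - c X\<close>.  Hence the minimal
  polynomial of \<open>y\<close> over the field generated by \<open>x + c y\<close>, which divides both, is linear.
\<close>

lemma primitive_element_two:
  assumes x: "algebraic x" and y: "algebraic y"
  shows "\<exists>c. x \<in> Qadj (x + of_rat c * y) \<and> y \<in> Qadj (x + of_rat c * y)"
proof -
  \<comment> \<open>the values of the multiplier at which a conjugate of \<open>y\<close> other than \<open>y\<close> becomes a common root\<close>
  define B where "B = (\<lambda>(a, b). (a - x) / (y - b)) ` (conjs x \<times> conjs y)"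
  have "finite B" unfolding B_def using finite_conjs[OF x] finite_conjs[OF y] by simp
  moreover have "infinite (range (of_rat :: rat \<Rightarrow> complex))"
    using infinite_UNIV_char_0[where 'a=rat] by (auto dest!: finite_imageD simp: inj_on_def)
  ultimately obtain c where c: "of_rat c \<notin> B" by (metis finite_subset image_subsetI)
  define z where "z = x + of_rat c * y"
  have "algebraic (of_rat c :: complex)" by (rule rat_imp_algebraic) simp
  hence z: "algebraic z" unfolding z_def by (intro algebraic_add algebraic_mult x y)
  define S where "S = Qadj z"
  have sf: "is_subfield S" unfolding S_def by (rule is_subfield_Qadj[OF z])
  note S = is_subfieldD(1)[OF sf]
  define G :: "complex poly" where "G = map_poly of_rat (minpoly y)"
  \<comment> \<open>\<open>F\<close> is a polynomial over the field of \<open>z\<close>, and its value at \<open>y\<close> is that of the minimal polynomial of \<open>x\<close> at \<open>x\<close>\<close>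
  define F :: "complex poly" where "F = map_poly of_rat (minpoly x) \<circ>\<^sub>p [:z, - of_rat c:]"
  have zS: "z \<in> S" by (simp add: S_def)
  have GS: "coeff G i \<in> S" for i by (simp add: G_def is_subfieldD(4)[OF sf])
  have FS: "coeff F i \<in> S" for i
  proof -
    have "F = (\<Sum>k\<le>deg x. [:of_rat (coeff (minpoly x) k):] * [:z, - of_rat c:] ^ k)"
    proof -
      have "F = poly (map_poly (\<lambda>a. [:a:]) (map_poly of_rat (minpoly x))) [:z, - of_rat c:]"
        unfolding F_def by (rule pcompose_altdef)
      also have "\<dots> = (\<Sum>k\<le>deg x. [:of_rat (coeff (minpoly x) k):] * [:z, - of_rat c:] ^ k)"
        unfolding poly_altdef by (intro sum.cong) (auto simp: deg_def coeff_map_poly degree_map_poly)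
      finally show ?thesis .
    qed
    also have "\<dots> \<in> {p. \<forall>i. coeff p i \<in> S}"
      using zS is_subfieldD(4)[OF sf] is_subringD(1,3)[OF S]
      by (intro is_subring_sum is_subringD(5) is_subring_power is_subring_poly_coeffs[OF S])
        (auto simp: coeff_pCons split: nat.split)
    finally show ?thesis by simp
  qed
  have Fy: "poly F y = 0"
    using minpoly(2)[OF x] by (simp add: F_def poly_pcompose z_def qeval_def mult.commute)
  have Gy: "poly G y = 0" using minpoly(2)[OF y] by (simp add: G_def qeval_def)
  have common: "b = y" if "poly F b = 0" "poly G b = 0" for b
  proof (rule ccontr)
    assume "b \<noteq> y"
    have "b \<in> conjs y" using that by (simp add: conjs_def qeval_def G_def)
    moreover have "z - of_rat c * b \<in> conjs x"
      using that by (simp add: conjs_def qeval_def F_def poly_pcompose mult.commute)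
    moreover have "of_rat c = ((z - of_rat c * b) - x) / (y - b)"
      using \<open>b \<noteq> y\<close> by (simp add: z_def field_simps)
    ultimately have "of_rat c \<in> B" unfolding B_def by (intro image_eqI[of _ _ "(z - of_rat c * b, b)"]) auto
    with c show False by simp
  qed
  let ?P = "\<lambda>h. lead_coeff h = 1 \<and> (\<forall>i. coeff h i \<in> S) \<and> poly h y = 0"
  have lG: "lead_coeff G = 1" using minpoly(1)[OF y] by (simp add: G_def)
  have "?P G" using lG GS Gy by blast
  then obtain h where h: "?P h" and least: "\<And>g. ?P g \<Longrightarrow> degree h \<le> degree g"
    using ex_has_least_nat[of ?P G degree] by blast
  have dvd: "h dvd p" if "\<And>i. coeff p i \<in> S" "poly p y = 0" for p
  proof -
    have "\<exists>r. (\<forall>i. coeff r i \<in> S) \<and> h dvd p - r \<and> (r = 0 \<or> degree r < degree h)"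
      using h that(1) by (intro monic_division[OF S]) auto
    then obtain r where r: "\<forall>i. coeff r i \<in> S" "h dvd p - r" "r = 0 \<or> degree r < degree h" by blast
    from r(2) obtain k where k: "p - r = h * k" by (rule dvdE)
    have "poly (p - r) y = 0" unfolding k using h by simp
    hence ry: "poly r y = 0" using that(2) by simp
    have "r = 0"
    proof (rule ccontr)
      assume "r \<noteq> 0"
      let ?r = "Polynomial.smult (inverse (lead_coeff r)) r"
      have "?P ?r" using \<open>r \<noteq> 0\<close> r(1) ry by (auto intro!: is_subringD(5)[OF S] is_subfieldD(2)[OF sf])
      from least[OF this] r(3) \<open>r \<noteq> 0\<close> show False by simp
    qed
    thus ?thesis using r(2) by simp
  qed
  from dvd[OF FS Fy] obtain k1 where k1: "F = h * k1" by (rule dvdE)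
  from dvd[OF GS Gy] obtain k2 where k2: "G = h * k2" by (rule dvdE)
  have roots: "{b. poly h b = 0} = {y}" using common k1 k2 h by auto
  have "rsquarefree h"
    unfolding rsquarefree_roots
  proof (intro allI notI)
    fix b assume b: "poly h b = 0 \<and> poly (pderiv h) b = 0"
    hence "poly G b = 0 \<and> poly (pderiv G) b = 0" by (simp add: k2 pderiv_mult)
    thus False using rsquarefree_minpoly[OF y] unfolding rsquarefree_roots G_def by blast
  qed
  from complex_poly_decompose_rsquarefree[OF this] have "h = [:- y, 1:]" using h by (simp add: roots)
  hence "coeff h 0 = - y" by simp
  hence "- (- y) \<in> S" using h is_subringD(3)[OF S] by metis
  hence yS: "y \<in> S" by simp
  have "x = z - of_rat c * y" by (simp add: z_def)
  also have "\<dots> \<in> S" by (intro is_subringD[OF S] zS yS is_subfieldD(4)[OF sf])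
  finally show ?thesis using yS by (auto simp: S_def z_def)
qed

lemma primitive_element:
  assumes "finite A" "\<And>a. a \<in> A \<Longrightarrow> algebraic a"
  shows "\<exists>z. algebraic z \<and> A \<subseteq> Qadj z \<and> (\<forall>S. is_subfield S \<longrightarrow> A \<subseteq> S \<longrightarrow> z \<in> S)"
  using assms
proof (induction A rule: finite_induct)
  case empty
  have "0 \<in> S" if "is_subfield S" for S using is_subringD(1)[OF is_subfieldD(1)[OF that]] .
  thus ?case by (intro exI[of _ 0]) auto
next
  case (insert a A)
  then obtain z where z: "algebraic z" "A \<subseteq> Qadj z" "\<And>S. is_subfield S \<Longrightarrow> A \<subseteq> S \<Longrightarrow> z \<in> S" by auto
  from primitive_element_two[OF z(1), of a] insert.prems obtain c where
    c: "z \<in> Qadj (z + of_rat c * a)" "a \<in> Qadj (z + of_rat c * a)" by auto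
  have "algebraic (of_rat c :: complex)" by (rule rat_imp_algebraic) simp
  hence "algebraic (z + of_rat c * a)" using insert.prems by (intro algebraic_add algebraic_mult z) auto
  moreover have "insert a A \<subseteq> Qadj (z + of_rat c * a)"
    using c z(2) Qadj_mono[OF c(1)] by auto
  moreover have "z + of_rat c * a \<in> S" if S: "is_subfield S" "insert a A \<subseteq> S" for S
    using z(3)[OF S(1)] S(2) is_subfieldD(4)[OF S(1)] by (auto intro!: is_subringD[OF is_subfieldD(1)[OF S(1)]])
  ultimately show ?case by blast
qed

section \<open>Rational linear algebra\<close>

interpretation qvs: vector_space "\<lambda>(q::rat) (x::complex). of_rat q * x"
  by unfold_locales (auto simp: of_rat_add of_rat_mult algebra_simps)

definition qindep :: "nat \<Rightarrow> (nat \<Rightarrow> complex) \<Rightarrow> bool" where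
  "qindep n \<omega> \<longleftrightarrow> (\<forall>q. (\<Sum>j<n. of_rat (q j) * \<omega> j) = 0 \<longrightarrow> (\<forall>j<n. q j = 0))"

lemma qindepD: "qindep n \<omega> \<Longrightarrow> (\<Sum>j<n. of_rat (q j) * \<omega> j) = 0 \<Longrightarrow> j < n \<Longrightarrow> q j = 0"
  unfolding qindep_def by blast

lemma qindep_imp_inj:
  assumes "qindep n \<omega>" shows "inj_on \<omega> {..<n}"
proof (rule inj_onI, rule ccontr)
  fix i j assume ij: "i \<in> {..<n}" "j \<in> {..<n}" "\<omega> i = \<omega> j" "i \<noteq> j"
  define q :: "nat \<Rightarrow> rat" where "q k = (if k = i then 1 else 0) - (if k = j then 1 else 0)" for k
  have "(\<Sum>k<n. of_rat (q k) * \<omega> k) = (\<Sum>k<n. (if k = i then \<omega> i else 0) - (if k = j then \<omega> j else 0))"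
    by (intro sum.cong) (auto simp: q_def)
  also have "\<dots> = 0" using ij by (simp add: sum_subtractf)
  finally have "q i = 0" using qindepD[OF assms, of q i] ij by simp
  thus False using ij by (simp add: q_def)
qed

lemma qindep_imp_independent:
  assumes "qindep n \<omega>" shows "qvs.independent (\<omega> ` {..<n})"
proof -
  have "u v = 0" if u: "(\<Sum>v\<in>\<omega> ` {..<n}. of_rat (u v) * v) = 0" and v: "v \<in> \<omega> ` {..<n}" for u v
  proof -
    have "(\<Sum>j<n. of_rat (u (\<omega> j)) * \<omega> j) = 0"
      using u by (simp add: sum.reindex[OF qindep_imp_inj[OF assms]])
    from qindepD[OF assms this] v show ?thesis by auto
  qed
  thus ?thesis by (auto simp: qvs.dependent_finite)
qed

lemma qspan_subset_span: "qspan n \<omega> \<subseteq> qvs.span (\<omega> ` {..<n})"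
proof
  fix y assume "y \<in> qspan n \<omega>"
  then obtain q where q: "y = (\<Sum>j<n. of_rat (q j) * \<omega> j)" by (auto simp: qspan_def)
  have "of_rat (q j) * \<omega> j \<in> qvs.span (\<omega> ` {..<n})" if "j < n" for j
    using that by (intro qvs.span_scale qvs.span_base) auto
  thus "y \<in> qvs.span (\<omega> ` {..<n})" unfolding q by (intro qvs.span_sum) auto
qed

lemma span_subset_qspan:
  assumes "inj_on \<omega> {..<n}" shows "qvs.span (\<omega> ` {..<n}) \<subseteq> qspan n \<omega>"
proof
  fix y assume "y \<in> qvs.span (\<omega> ` {..<n})"
  then obtain u where "y = (\<Sum>v\<in>\<omega> ` {..<n}. of_rat (u v) * v)" by (auto simp: qvs.span_finite)
  hence "y = (\<Sum>j<n. of_rat (u (\<omega> j)) * \<omega> j)" by (simp add: sum.reindex[OF assms])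
  thus "y \<in> qspan n \<omega>" unfolding qspan_def by (auto intro!: image_eqI[of _ _ "\<lambda>j. u (\<omega> j)"])
qed

lemma qspan_memI: "(\<Sum>j<n. of_rat (q j) * \<omega> j) \<in> qspan n \<omega>"
  by (simp add: qspan_def)

lemma qspan_subset_Qadj:
  assumes x: "algebraic x" and "\<And>j. j < n \<Longrightarrow> \<omega> j \<in> Qadj x"
  shows "qspan n \<omega> \<subseteq> Qadj x"
  unfolding qspan_def using assms(2)
  by (auto intro!: is_subring_sum[OF is_subring_Qadj] is_subringD[OF is_subring_Qadj] is_subfieldD(4)[OF is_subfield_Qadj[OF x]])

lemma qindep_powers:
  assumes x: "algebraic x" shows "qindep (deg x) (\<lambda>j. x ^ j)"
  unfolding qindep_def
proof (intro allI impI)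
  fix q j assume eq: "(\<Sum>j<deg x. of_rat (q j) * x ^ j) = 0" and j: "j < deg x"
  define g where "g = (\<Sum>j<deg x. Polynomial.monom (q j) j)"
  have gx: "qeval g x = 0" using eq by (simp add: g_def)
  have cg: "coeff g k = (if k < deg x then q k else 0)" for k
    by (simp add: g_def coeff_sum coeff_monom)
  have "degree g \<le> deg x - 1" by (rule degree_le) (use cg in auto)
  hence "degree g < deg x" using deg_pos[OF x] by linarith
  hence "g = 0" using minpoly(3)[OF x _ gx] by linarith
  thus "q j = 0" using cg[of j] j by simp
qed

lemma qindep_le_deg:
  assumes x: "algebraic x" and ind: "qindep n \<omega>" and "\<And>j. j < n \<Longrightarrow> \<omega> j \<in> Qadj x"
  shows "n \<le> deg x"
proof -
  have "\<omega> ` {..<n} \<subseteq> qvs.span ((\<lambda>j. x ^ j) ` {..<deg x})"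
    using assms(3) Qadj_eq_qspan_powers[OF x] qspan_subset_span[of "deg x" "\<lambda>j. x ^ j"] by auto
  from qvs.independent_span_bound[OF _ qindep_imp_independent[OF ind] this]
  have "card (\<omega> ` {..<n}) \<le> card ((\<lambda>j. x ^ j) ` {..<deg x})" by simp
  also have "\<dots> \<le> deg x" using card_image_le[of "{..<deg x}" "\<lambda>j. x ^ j"] by simp
  finally show ?thesis by (simp add: card_image qindep_imp_inj[OF ind])
qed

lemma deg_le_of_spanning:
  assumes x: "algebraic x" and sp: "Qadj x \<subseteq> qspan n \<omega>"
  shows "deg x \<le> n"
proof -
  note ind = qindep_powers[OF x]
  have "x ^ j \<in> Qadj x" for j by (rule is_subring_power[OF is_subring_Qadj Qadj_self])
  hence "(\<lambda>j. x ^ j) ` {..<deg x} \<subseteq> qvs.span (\<omega> ` {..<n})"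
    using sp qspan_subset_span[of n \<omega>] by auto
  from qvs.independent_span_bound[OF _ qindep_imp_independent[OF ind] this]
  have "card ((\<lambda>j. x ^ j) ` {..<deg x}) \<le> card (\<omega> ` {..<n})" by simp
  also have "\<dots> \<le> n" using card_image_le[of "{..<n}" \<omega>] by simp
  finally show ?thesis by (simp add: card_image qindep_imp_inj[OF ind])
qed

lemma spanning_of_qindep:
  assumes x: "algebraic x" and ind: "qindep (deg x) \<omega>" and mem: "\<And>j. j < deg x \<Longrightarrow> \<omega> j \<in> Qadj x"
  shows "Qadj x = qspan (deg x) \<omega>"
proof
  show "qspan (deg x) \<omega> \<subseteq> Qadj x" by (rule qspan_subset_Qadj[OF x mem])
  show "Qadj x \<subseteq> qspan (deg x) \<omega>"
  proof
    fix y assume y: "y \<in> Qadj x"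
    let ?B = "\<omega> ` {..<deg x}" and ?P = "(\<lambda>j. x ^ j) ` {..<deg x}"
    have "y \<in> qvs.span ?B"
    proof (rule ccontr)
      assume nin: "y \<notin> qvs.span ?B"
      hence nin': "y \<notin> ?B" using qvs.span_base[of y ?B] by blast
      have i: "qvs.independent (insert y ?B)"
        by (rule qvs.independent_insertI[OF nin qindep_imp_independent[OF ind]])
      have "insert y ?B \<subseteq> qvs.span ?P"
        using mem y Qadj_eq_qspan_powers[OF x] qspan_subset_span[of "deg x" "\<lambda>j. x ^ j"] by auto
      from qvs.independent_span_bound[OF _ i this]
      have "card (insert y ?B) \<le> card ?P" by simp
      also have "\<dots> \<le> deg x" using card_image_le[of "{..<deg x}" "\<lambda>j. x ^ j"] by simp
      finally show False using nin' by (simp add: card_image qindep_imp_inj[OF ind])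
    qed
    thus "y \<in> qspan (deg x) \<omega>" using span_subset_qspan[OF qindep_imp_inj[OF ind]] by auto
  qed
qed

text \<open>
  Applying the embeddings to a rational relation between the members of \<open>\<omega>\<close> gives a relation between the columns.
\<close>

lemma qindep_of_emb_mat:
  assumes x: "algebraic x" and mem: "\<And>j. j < deg x \<Longrightarrow> \<omega> j \<in> Qadj x" and det: "det (emb_mat x \<omega>) \<noteq> 0"
  shows "qindep (deg x) \<omega>"
  unfolding qindep_def
proof (intro allI impI)
  fix q j assume eq: "(\<Sum>j<deg x. of_rat (q j) * \<omega> j) = 0" and j: "j < deg x"
  define v :: "complex Matrix.vec" where "v = vec (deg x) (\<lambda>j. of_rat (q j))"
  have "emb_mat x \<omega> *\<^sub>v v = 0\<^sub>v (deg x)"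
  proof (rule eq_vecI)
    fix i assume "i < dim_vec (0\<^sub>v (deg x))"
    hence i: "i < deg x" by simp
    note a = cj_in_conjs[OF x i]
    have qm: "of_rat r \<in> Qadj x" for r by (rule is_subfieldD(4)[OF is_subfield_Qadj[OF x]])
    have "0 = emb x (cj x i) (\<Sum>j<deg x. of_rat (q j) * \<omega> j)" by (simp add: eq emb_0[OF x a])
    also have "\<dots> = (\<Sum>j<deg x. of_rat (q j) * emb x (cj x i) (\<omega> j))"
      using mem by (subst emb_sum[OF x a]) (auto simp: emb_mult[OF x a qm] emb_of_rat[OF x a] is_subringD[OF is_subring_Qadj] qm)
    finally show "vec_index (emb_mat x \<omega> *\<^sub>v v) i = vec_index (0\<^sub>v (deg x)) i"
      using i by (simp add: emb_mat_def v_def scalar_prod_def lessThan_atLeast0 mult.commute)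
  qed (simp add: emb_mat_def)
  moreover have "v \<in> carrier_vec (deg x)" by (simp add: v_def)
  ultimately have "v = 0\<^sub>v (deg x)"
    using det det_0_iff_vec_prod_zero[OF emb_mat_carrier, of x \<omega>] by auto
  hence "vec_index v j = 0" using j by simp
  thus "q j = 0" using j by (simp add: v_def)
qed

section \<open>Number fields as sets of complex numbers\<close>

lemma CC_simps [simp]:
  "carrier CC = UNIV" "\<one>\<^bsub>CC\<^esub> = 1" "\<zero>\<^bsub>CC\<^esub> = 0" "x \<oplus>\<^bsub>CC\<^esub> y = x + y" "x \<otimes>\<^bsub>CC\<^esub> y = x * y"
  by (simp_all add: ring_of_type_algebra_def)

lemma field_CC: "field CC" by (rule field_from_type_algebra)

lemma CC_uminus [simp]: "\<ominus>\<^bsub>CC\<^esub> x = - x"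
proof -
  interpret field CC by (rule field_CC)
  have "x \<oplus>\<^bsub>CC\<^esub> \<ominus>\<^bsub>CC\<^esub> x = \<zero>\<^bsub>CC\<^esub>" by (rule r_neg) simp
  hence "x + \<ominus>\<^bsub>CC\<^esub> x = 0" by simp
  thus ?thesis by (metis add_eq_0_iff)
qed

lemma CC_inv [simp]: "x \<noteq> 0 \<Longrightarrow> inv\<^bsub>CC\<^esub> x = inverse x"
proof -
  assume x: "x \<noteq> 0"
  interpret field CC by (rule field_CC)
  have "x \<in> Units CC" using x field_Units by simp
  hence "x \<otimes>\<^bsub>CC\<^esub> inv\<^bsub>CC\<^esub> x = \<one>\<^bsub>CC\<^esub>" by (rule Units_r_inv)
  hence "x * inv\<^bsub>CC\<^esub> x = 1" by simp
  thus ?thesis by (metis inverse_unique)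
qed

lemma subring_CC_iff: "subring S CC \<longleftrightarrow> is_subring S"
proof
  assume "subring S CC"
  from subringE[OF this] show "is_subring S" by (simp add: is_subring_def)
next
  assume S: "is_subring S"
  interpret field CC by (rule field_CC)
  show "subring S CC" by (rule subringI) (auto intro: is_subringD[OF S])
qed

lemma subfield_CC_iff: "subfield S CC \<longleftrightarrow> is_subfield S"
proof
  interpret field CC by (rule field_CC)
  assume S: "subfield S CC"
  hence 1: "is_subring S" using subfieldE(1) subring_CC_iff by blast
  have "inverse x \<in> S" if "x \<in> S" for x
  proof (cases "x = 0")
    case False
    thus ?thesis using subfield_m_inv(1)[OF S, of x] that by simp
  qed (use is_subringD(1)[OF 1] in simp)
  thus "is_subfield S" using 1 by (simp add: is_subfield_def)
next
  interpret field CC by (rule field_CC)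
  assume S: "is_subfield S"
  show "subfield S CC"
  proof (rule subfieldI')
    show "subring S CC" using is_subfieldD(1)[OF S] subring_CC_iff by blast
    show "inv\<^bsub>CC\<^esub> k \<in> S" if "k \<in> S - {\<zero>\<^bsub>CC\<^esub>}" for k using that is_subfieldD(2)[OF S] by simp
  qed
qed

lemma is_subring_generate_ring: "is_subring (generate_ring CC H)"
proof -
  interpret field CC by (rule field_CC)
  show ?thesis using generate_ring_is_subring[of H] subring_CC_iff by simp
qed

lemma generate_ring_least: "is_subring S \<Longrightarrow> H \<subseteq> S \<Longrightarrow> generate_ring CC H \<subseteq> S"
proof -
  interpret field CC by (rule field_CC)
  assume "is_subring S" "H \<subseteq> S"
  thus ?thesis using generate_ring_min_subring1[of H S] subring_CC_iff by simp
qed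

lemma is_subring_composite_ring: "is_subring (composite_ring \<S>)"
  by (simp add: composite_ring_def is_subring_generate_ring)

lemma composite_ring_upper: "A \<in> \<S> \<Longrightarrow> A \<subseteq> composite_ring \<S>"
  unfolding composite_ring_def by (auto intro: generate_ring.incl)

lemma composite_ring_least: "is_subring S \<Longrightarrow> (\<And>A. A \<in> \<S> \<Longrightarrow> A \<subseteq> S) \<Longrightarrow> composite_ring \<S> \<subseteq> S"
  unfolding composite_ring_def by (intro generate_ring_least) auto

lemma generate_field_eq_Qadj:
  assumes x: "algebraic x" shows "generate_field CC {x} = Qadj x"
proof
  interpret field CC by (rule field_CC)
  show "generate_field CC {x} \<subseteq> Qadj x"
    using generate_field_min_subfield1[of "{x}" "Qadj x"] is_subfield_Qadj[OF x] by (simp add: subfield_CC_iff)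
  have "is_subfield (generate_field CC {x})"
    using generate_field_is_subfield[of "{x}"] by (simp add: subfield_CC_iff)
  thus "Qadj x \<subseteq> generate_field CC {x}" by (rule Qadj_subset) (rule generate_field.incl, simp)
qed

lemma combine_CC: "ring.combine CC Ks Us = (\<Sum>j<min (length Ks) (length Us). Ks ! j * Us ! j)"
proof -
  interpret field CC by (rule field_CC)
  show ?thesis
  proof (induction Ks Us rule: combine.induct)
    case (1 k Ks u Us)
    thus ?case by (simp add: sum.lessThan_Suc_shift del: sum.lessThan_Suc)
  qed auto
qed

lemma is_subfield_Rats: "is_subfield \<rat>"
  by (auto simp: is_subfield_def is_subring_Rats)

lemma dimension_Qadj:
  assumes x: "algebraic x" shows "ring.dimension CC (deg x) \<rat> (Qadj x)"
proof -
  interpret field CC by (rule field_CC)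
  have Q: "subfield \<rat> CC" using is_subfield_Rats by (simp add: subfield_CC_iff)
  define Us where "Us = map (\<lambda>j. x ^ j) [0..<deg x]"
  have len: "length Us = deg x" by (simp add: Us_def)
  have comb: "combine Ks Us = (\<Sum>j<deg x. Ks ! j * x ^ j)" if "length Ks = deg x" for Ks
    using that by (simp add: combine_CC Us_def)
  have "Span \<rat> Us = {combine Ks Us | Ks. length Ks = length Us \<and> set Ks \<subseteq> \<rat>}"
    by (rule Span_eq_combine_set_length_version[OF Q]) simp
  also have "\<dots> = qspan (deg x) (\<lambda>j. x ^ j)"
  proof (intro equalityI subsetI)
    fix y assume "y \<in> {combine Ks Us | Ks. length Ks = length Us \<and> set Ks \<subseteq> \<rat>}"
    then obtain Ks where Ks: "y = combine Ks Us" "length Ks = deg x" "set Ks \<subseteq> \<rat>" by (auto simp: len)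
    have "\<forall>j<deg x. \<exists>r. Ks ! j = of_rat r" using Ks by (force simp: Rats_def dest: nth_mem)
    then obtain r where r: "\<And>j. j < deg x \<Longrightarrow> Ks ! j = of_rat (r j)" by metis
    have "y = (\<Sum>j<deg x. of_rat (r j) * x ^ j)" using Ks r by (simp add: comb)
    thus "y \<in> qspan (deg x) (\<lambda>j. x ^ j)" using qspan_memI[of r "\<lambda>j. x ^ j"] by simp
  next
    fix y assume "y \<in> qspan (deg x) (\<lambda>j. x ^ j)"
    then obtain q where q: "y = (\<Sum>j<deg x. of_rat (q j) * x ^ j)" by (auto simp: qspan_def)
    define Ks :: "complex list" where "Ks = map (\<lambda>j. of_rat (q j)) [0..<deg x]"
    have "y = combine Ks Us" by (subst comb) (auto simp: Ks_def q)
    moreover have "length Ks = length Us" "set Ks \<subseteq> \<rat>" by (auto simp: Ks_def len)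
    ultimately show "y \<in> {combine Ks Us | Ks. length Ks = length Us \<and> set Ks \<subseteq> \<rat>}" by blast
  qed
  finally have span: "Span \<rat> Us = Qadj x" by (simp add: Qadj_eq_qspan_powers[OF x])
  have "independent \<rat> Us"
  proof (rule trivial_combine_imp_independent[OF Q])
    fix Ks assume Ks: "set Ks \<subseteq> \<rat>" "combine Ks Us = \<zero>\<^bsub>CC\<^esub>"
    have "\<forall>j<length Ks. \<exists>r. Ks ! j = of_rat r" using Ks by (force simp: Rats_def dest: nth_mem)
    then obtain r where r: "\<And>j. j < length Ks \<Longrightarrow> Ks ! j = of_rat (r j)" by metis
    define q where "q j = (if j < length Ks then r j else 0)" for j
    have "(\<Sum>j<deg x. of_rat (q j) * x ^ j) = (\<Sum>j<min (length Ks) (deg x). Ks ! j * x ^ j)"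
      by (rule sum.mono_neutral_cong_right) (auto simp: q_def r)
    also have "\<dots> = combine Ks Us" unfolding combine_CC len by (intro sum.cong) (auto simp: Us_def)
    finally have q0: "q j = 0" if "j < deg x" for j
      using qindepD[OF qindep_powers[OF x], of q j] that Ks by simp
    have "Ks ! j = 0" if "j < deg x" "j < length Ks" for j
      using that r[of j] q0[of j] by (simp add: q_def del: of_rat_eq_0_iff)
    thus "set (take (length Us) Ks) \<subseteq> {\<zero>\<^bsub>CC\<^esub>}"
      by (auto simp: in_set_conv_nth len)
  qed simp
  from dimension_independent[OF this] show ?thesis by (simp only: span len)
qed

lemma field_degree_Qadj:
  assumes x: "algebraic x" shows "field_degree (Qadj x) = deg x"
proof -
  interpret field CC by (rule field_CC)
  have "subfield \<rat> CC" using is_subfield_Rats by (simp add: subfield_CC_iff)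
  from dimI[OF this dimension_Qadj[OF x]] show ?thesis by (simp add: field_degree_def over_def)
qed

lemma number_field_finite_spanning:
  assumes "number_field K"
  shows "is_subfield K" "\<exists>U. finite U \<and> U \<subseteq> K \<and> K \<subseteq> span_over \<rat> U"
proof -
  interpret field CC by (rule field_CC)
  have Q: "subfield \<rat> CC" using is_subfield_Rats by (simp add: subfield_CC_iff)
  from assms show K: "is_subfield K" by (simp add: number_field_def subfield_CC_iff)
  from assms obtain n where "dimension n \<rat> K" by (auto simp: number_field_def finite_dimension_def)
  from exists_base[OF Q this] obtain Us where Us: "Span \<rat> Us = K" by blast
  have KUs: "K = {combine Ks Us | Ks. length Ks = length Us \<and> set Ks \<subseteq> \<rat>}"
    unfolding Us[symmetric] by (rule Span_eq_combine_set_length_version[OF Q]) simp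
  have UsK: "set Us \<subseteq> K" using Span_base_incl[OF Q, of Us] Us by simp
  have "y \<in> span_over \<rat> (set Us)" if "y \<in> K" for y
  proof -
    from that obtain Ks where Ks: "y = combine Ks Us" "length Ks = length Us" "set Ks \<subseteq> \<rat>"
      using KUs by blast
    have "y = (\<Sum>j<length Us. Ks ! j * Us ! j)" using Ks by (simp add: combine_CC)
    also have "\<dots> \<in> span_over \<rat> (set Us)"
    proof (rule span_over_sum[OF is_subring_Rats])
      fix j assume "j \<in> {..<length Us}"
      hence "Us ! j \<in> set Us" "Ks ! j \<in> \<rat>" using Ks by (auto intro: nth_mem)
      thus "Ks ! j * Us ! j \<in> span_over \<rat> (set Us)"
        by (intro span_over_smult[OF is_subring_Rats] span_over_base[OF is_subring_Rats]) auto
    qed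
    finally show ?thesis .
  qed
  thus "\<exists>U. finite U \<and> U \<subseteq> K \<and> K \<subseteq> span_over \<rat> U" using UsK by (intro exI[of _ "set Us"]) auto
qed

text \<open>
  Multiplication by a member of a finite spanning set over the rationals maps the set into its span.  So the members are
  algebraic, and a primitive element for them generates the field.
\<close>

lemma number_field_imp_Qadj:
  assumes "number_field K"
  obtains x where "algebraic x" "K = Qadj x"
proof -
  note K = number_field_finite_spanning(1)[OF assms]
  from number_field_finite_spanning(2)[OF assms] obtain U where
    U: "finite U" "U \<subseteq> K" "K \<subseteq> span_over \<rat> U" by blast
  have "\<exists>v. v \<in> U \<and> v \<noteq> 0"
  proof (rule ccontr)
    assume "\<not> ?thesis"
    hence "(\<Sum>v\<in>U. c v * v) = 0" for c by (intro sum.neutral) auto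
    moreover have "1 \<in> span_over \<rat> (U)" by (rule subsetD[OF U(3)]) (rule is_subringD(2)[OF is_subfieldD(1)[OF K]])
    ultimately show False by (auto simp: span_over_def)
  qed
  then obtain v0 where v0: "v0 \<in> U" "v0 \<noteq> 0" by blast
  have alg: "algebraic u" if "u \<in> U" for u
    unfolding algebraic_iff_monic
  proof (rule monic_poly_of_stable_span[OF is_subring_Rats _ v0])
    fix v assume "v \<in> U"
    hence "u * v \<in> K" using that U(2) is_subringD(5)[OF is_subfieldD(1)[OF K]] by auto
    thus "u * v \<in> span_over \<rat> (U)" by (rule subsetD[OF U(3)])
  qed (rule U(1))
  from primitive_element[OF U(1) alg] obtain z where
    z: "algebraic z" "U \<subseteq> Qadj z" "\<forall>S. is_subfield S \<longrightarrow> U \<subseteq> S \<longrightarrow> z \<in> S" by auto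
  have "K \<subseteq> Qadj z"
  proof
    fix y assume "y \<in> K"
    then obtain c where c: "y = (\<Sum>v\<in>U. c v * v)" "\<forall>v\<in>U. c v \<in> \<rat>"
      using subsetD[OF U(3)] unfolding span_over_def by blast
    have "c v \<in> Qadj z" if v: "v \<in> U" for v
    proof -
      from c(2) v obtain r where "c v = of_rat r" by (auto elim: Rats_cases)
      thus ?thesis using is_subfieldD(4)[OF is_subfield_Qadj[OF z(1)]] by simp
    qed
    thus "y \<in> Qadj z" unfolding c(1) using z(2) by (intro is_subring_sum is_subringD(5) is_subring_Qadj) auto
  qed
  moreover have "Qadj z \<subseteq> K" using z(3) K U(2) by (intro Qadj_subset) auto
  ultimately show thesis using that z(1) by blast
qed

section \<open>Integral bases\<close>

text \<open>
  The modulus of the discriminant of \<open>\<omega>\<close>, as a real number.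
\<close>

definition discr :: "complex \<Rightarrow> (nat \<Rightarrow> complex) \<Rightarrow> real" where
  "discr x \<omega> = (cmod (det (emb_mat x \<omega>)))\<^sup>2"

text \<open>
  The determinant expresses independence.  The condition that the basis starts with \<open>1\<close> makes the scalars of a ring the
  multiples of its first member, so that the coordinates of a scalar can be read off.
\<close>

definition int_basis :: "complex \<Rightarrow> (nat \<Rightarrow> complex) \<Rightarrow> bool" where
  "int_basis x \<omega> \<longleftrightarrow> \<omega> 0 = 1 \<and> (\<forall>j<deg x. \<omega> j \<in> Qadj x \<and> algebraic_int (\<omega> j)) \<and> det (emb_mat x \<omega>) \<noteq> 0 \<and>
     (\<forall>y\<in>Qadj x. algebraic_int y \<longrightarrow> (\<exists>c::nat \<Rightarrow> int. y = (\<Sum>j<deg x. of_int (c j) * \<omega> j)))"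

text \<open>The square of the determinant is the determinant of the trace form, which has integral entries.\<close>

lemma discr_nat:
  assumes x: "algebraic x" and \<omega>: "\<And>j. j < deg x \<Longrightarrow> \<omega> j \<in> Qadj x \<and> algebraic_int (\<omega> j)"
  shows "\<exists>m::nat. discr x \<omega> = of_nat m"
proof -
  let ?n = "deg x" and ?W = "emb_mat x \<omega>"
  have WT: "transpose_mat ?W \<in> carrier_mat ?n ?n" by simp
  have P: "transpose_mat ?W * ?W \<in> carrier_mat ?n ?n" by (rule mult_carrier_mat[OF WT emb_mat_carrier])
  have "det (transpose_mat ?W * ?W) \<in> \<int>"
  proof (rule det_in_subring[OF is_subring_Ints P])
    fix j k assume jk: "j < ?n" "k < ?n"
    have "(transpose_mat ?W * ?W) $$ (j, k) = (\<Sum>i<?n. emb x (cj x i) (\<omega> j) * emb x (cj x i) (\<omega> k))"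
      using jk by (simp add: emb_mat_def scalar_prod_def lessThan_atLeast0)
    also have "\<dots> = (\<Sum>i<?n. emb x (cj x i) (\<omega> j * \<omega> k))"
      using \<omega> jk cj_in_conjs[OF x] by (intro sum.cong) (auto simp: emb_mult[OF x])
    also have "\<dots> = (\<Sum>a\<in>conjs x. emb x a (\<omega> j * \<omega> k))"
      by (rule sum.reindex_bij_betw[OF bij_betw_cj[OF x]])
    finally have eq: "(transpose_mat ?W * ?W) $$ (j, k) = (\<Sum>a\<in>conjs x. emb x a (\<omega> j * \<omega> k))" .
    have mem: "\<omega> j * \<omega> k \<in> Qadj x" "algebraic_int (\<omega> j * \<omega> k)"
      using \<omega> jk by (auto intro: is_subringD[OF is_subring_Qadj] algebraic_int_mult)
    have "(\<Sum>a\<in>conjs x. emb x a (\<omega> j * \<omega> k)) \<in> {z. algebraic_int z}"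
      using emb_algebraic_int[OF x _ mem] by (intro is_subring_sum[OF is_subring_algebraic_int]) auto
    thus "(transpose_mat ?W * ?W) $$ (j, k) \<in> \<int>"
      unfolding eq using trace_rational[OF x mem(1)] rational_algebraic_int_is_int by blast
  qed
  moreover have "det (transpose_mat ?W * ?W) = (det ?W)\<^sup>2"
    by (simp add: det_mult[OF WT emb_mat_carrier] det_transpose[OF emb_mat_carrier] power2_eq_square)
  ultimately obtain z where "(det ?W)\<^sup>2 = of_int z" by (auto elim: Ints_cases)
  hence "discr x \<omega> = \<bar>of_int z\<bar>" unfolding discr_def by (simp flip: norm_power)
  hence "discr x \<omega> = of_nat (nat \<bar>z\<bar>)" by simp
  thus ?thesis by blast
qed

text \<open>
  If \<open>c\<close> is the leading coefficient of an integral equation of degree \<open>n\<close> for \<open>x\<close>, the equation multiplied by \<open>c\<^sup>n\<^sup>-\<^sup>1\<close> is a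
  monic integral equation for \<open>c x\<close>.
\<close>

lemma algebraic_int_multiple:
  assumes "algebraic (x::complex)"
  obtains c :: int where "c \<noteq> 0" "algebraic_int (of_int c * x)"
proof -
  from assms obtain p where p: "\<And>i. coeff p i \<in> \<int>" "p \<noteq> 0" "poly p x = 0"
    unfolding algebraic_def by blast
  define n where "n = degree p"
  from p(1) have "lead_coeff p \<in> \<int>" by simp
  then obtain c where c: "lead_coeff p = of_int c" by (auto elim: Ints_cases)
  have cnz: "c \<noteq> 0" using c p(2) by (metis leading_coeff_0_iff of_int_0)
  have npos: "n > 0"
  proof (rule ccontr)
    assume "\<not> n > 0"
    then obtain a where "p = [:a:]" unfolding n_def by (auto elim: degree_eq_zeroE)
    thus False using p by simp
  qed
  define C where "C = (of_int c :: complex)"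
  define q where "q = Polynomial.monom 1 n + (\<Sum>i<n. Polynomial.monom (coeff p i * C ^ (n - 1 - i)) i)"
  have cq: "coeff q i = (if i = n then 1 else if i < n then coeff p i * C ^ (n - 1 - i) else 0)" for i
    unfolding q_def by (auto simp: coeff_sum coeff_monom sum.delta)
  have "degree q = n" by (rule order_antisym) (auto intro!: degree_le le_degree simp: cq)
  hence "lead_coeff q = 1" by (simp add: cq)
  moreover have "coeff q i \<in> \<int>" for i using p(1) by (auto simp: cq C_def)
  moreover have "poly q (C * x) = 0"
  proof -
    have "poly q (C * x) = C ^ n * x ^ n + (\<Sum>i<n. coeff p i * C ^ (n - 1 - i) * (C * x) ^ i)"
      by (simp add: q_def poly_sum poly_monom power_mult_distrib)
    also have "(\<Sum>i<n. coeff p i * C ^ (n - 1 - i) * (C * x) ^ i) = (\<Sum>i<n. C ^ (n - 1) * (coeff p i * x ^ i))"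
    proof (rule sum.cong)
      fix i assume "i \<in> {..<n}"
      hence "C ^ (n - 1) = C ^ (n - 1 - i) * C ^ i" by (simp flip: power_add)
      thus "coeff p i * C ^ (n - 1 - i) * (C * x) ^ i = C ^ (n - 1) * (coeff p i * x ^ i)"
        by (simp add: power_mult_distrib)
    qed simp
    also have "C ^ n * x ^ n = C ^ (n - 1) * (coeff p n * x ^ n)"
      using npos c by (cases n) (auto simp: C_def n_def)
    also have "C ^ (n - 1) * (coeff p n * x ^ n) + (\<Sum>i<n. C ^ (n - 1) * (coeff p i * x ^ i)) =
        C ^ (n - 1) * (\<Sum>i\<le>n. coeff p i * x ^ i)"
      by (simp add: sum_distrib_left algebra_simps flip: lessThan_Suc_atMost)
    also have "(\<Sum>i\<le>n. coeff p i * x ^ i) = poly p x" by (simp add: poly_altdef n_def)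
    finally show ?thesis by (simp add: p(3))
  qed
  ultimately have "algebraic_int (of_int c * x)" unfolding algebraic_int_iff C_def by blast
  thus thesis using that cnz by blast
qed

text \<open>
  Take a rational basis of algebraic integers with first member \<open>1\<close> and least discriminant.  A
  coordinate \<open>q\<^sub>j\<close> with \<open>j \<ge> 1\<close> of an integer \<open>y\<close> is integral, as otherwise replacing the \<open>j\<close>-th member by
  \<open>y - \<lfloor>q\<^sub>j\<rfloor> \<omega>\<^sub>j\<close> scales the discriminant by the square of the fractional part.  The remaining coordinate
  is then a rational algebraic integer.
\<close>

lemma int_basis_exists:
  assumes x: "algebraic x" shows "\<exists>\<omega>. int_basis x \<omega>"
proof -
  let ?n = "deg x"
  let ?P = "\<lambda>\<omega>. \<omega> 0 = 1 \<and> (\<forall>j<?n. \<omega> j \<in> Qadj x \<and> algebraic_int (\<omega> j)) \<and> det (emb_mat x \<omega>) \<noteq> 0"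
  note S = is_subring_Qadj[of x]
  have qm: "of_rat r \<in> Qadj x" for r by (rule is_subfieldD(4)[OF is_subfield_Qadj[OF x]])
  from algebraic_int_multiple[OF x] obtain c where c: "c \<noteq> 0" "algebraic_int (of_int c * x)" by blast
  define \<omega>0 where "\<omega>0 j = (of_int c * x) ^ j" for j :: nat
  have mem0: "\<omega>0 j \<in> Qadj x" for j
    unfolding \<omega>0_def by (intro is_subring_power[OF S] is_subringD(5)[OF S] is_subring_of_int[OF S] Qadj_self)
  have "?P \<omega>0"
  proof (intro conjI allI impI)
    show "\<omega>0 0 = 1" by (simp add: \<omega>0_def)
    show "\<omega>0 j \<in> Qadj x" for j by (rule mem0)
    show "algebraic_int (\<omega>0 j)" for j
      using is_subring_power[OF is_subring_algebraic_int, of _ j] c(2) by (simp add: \<omega>0_def)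
    show "det (emb_mat x \<omega>0) \<noteq> 0"
    proof (rule emb_mat_det_nonzero[OF x _ mem0], rule subsetI)
      fix y assume "y \<in> Qadj x"
      then obtain q where q: "y = (\<Sum>j<?n. of_rat (q j) * x ^ j)"
        using Qadj_eq_qspan_powers[OF x] by (auto simp: qspan_def)
      have "y = (\<Sum>j<?n. of_rat (q j / of_int c ^ j) * \<omega>0 j)"
        unfolding q using c(1) by (intro sum.cong) (auto simp: \<omega>0_def of_rat_divide of_rat_power power_mult_distrib)
      thus "y \<in> qspan ?n \<omega>0" using qspan_memI[of "\<lambda>j. q j / of_int c ^ j" \<omega>0 ?n] by simp
    qed
  qed
  then obtain \<omega> where \<omega>: "?P \<omega>" and least: "\<And>\<omega>'. ?P \<omega>' \<Longrightarrow> nat \<lfloor>discr x \<omega>\<rfloor> \<le> nat \<lfloor>discr x \<omega>'\<rfloor>"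
    using ex_has_least_nat[of ?P \<omega>0 "\<lambda>\<omega>. nat \<lfloor>discr x \<omega>\<rfloor>"] by blast
  have le: "discr x \<omega> \<le> discr x \<omega>'" if "?P \<omega>'" for \<omega>'
  proof -
    have "\<exists>m::nat. discr x \<omega> = m" using \<omega> by (intro discr_nat[OF x]) auto
    moreover have "\<exists>m::nat. discr x \<omega>' = m" using that by (intro discr_nat[OF x]) auto
    ultimately obtain m m' :: nat where "discr x \<omega> = m" "discr x \<omega>' = m'" by blast
    thus ?thesis using least[OF that] by simp
  qed
  have mem: "\<And>j. j < ?n \<Longrightarrow> \<omega> j \<in> Qadj x" and int: "\<And>j. j < ?n \<Longrightarrow> algebraic_int (\<omega> j)" using \<omega> by auto
  have span: "Qadj x = qspan ?n \<omega>"
    by (rule spanning_of_qindep[OF x qindep_of_emb_mat[OF x]]) (use \<omega> in auto)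
  have "\<exists>c::nat \<Rightarrow> int. y = (\<Sum>j<?n. of_int (c j) * \<omega> j)" if y: "y \<in> Qadj x" "algebraic_int y" for y
  proof -
    from y(1) obtain q where q: "y = (\<Sum>j<?n. of_rat (q j) * \<omega> j)" unfolding span by (auto simp: qspan_def)
    have int_coord: "of_int \<lfloor>q j\<rfloor> = q j" if j: "j < ?n" "j \<noteq> 0" for j
    proof (rule ccontr)
      assume neq: "of_int \<lfloor>q j\<rfloor> \<noteq> q j"
      define f where "f = q j - of_int \<lfloor>q j\<rfloor>"
      have f: "0 < f" "f < 1" using neq unfolding f_def by linarith+
      define y' where "y' = y - of_int \<lfloor>q j\<rfloor> * \<omega> j"
      define \<omega>' where "\<omega>' k = (if k = j then y' else \<omega> k)" for k
      define q' where "q' k = (if k = j then f else q k)" for k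
      have y'q: "y' = (\<Sum>k<?n. of_rat (q' k) * \<omega> k)"
      proof -
        have "(\<Sum>k<?n. of_rat (q' k) * \<omega> k) = (\<Sum>k<?n. of_rat (q k) * \<omega> k - (if k = j then of_int \<lfloor>q j\<rfloor> * \<omega> j else 0))"
          by (intro sum.cong) (auto simp: q'_def f_def of_rat_diff algebra_simps)
        thus ?thesis using j by (simp add: sum_subtractf y'_def q)
      qed
      define v :: "complex Matrix.vec" where "v = vec ?n (\<lambda>k. of_rat (q' k))"
      \<comment> \<open>the change of basis affects one column only, and Cramer's rule gives the determinant\<close>
      have "emb_mat x \<omega>' = replace_col (emb_mat x \<omega>) (emb_mat x \<omega> *\<^sub>v v) j"
      proof (rule eq_matI)
        fix i k assume "i < dim_row (replace_col (emb_mat x \<omega>) (emb_mat x \<omega> *\<^sub>v v) j)"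
          "k < dim_col (replace_col (emb_mat x \<omega>) (emb_mat x \<omega> *\<^sub>v v) j)"
        hence ik: "i < ?n" "k < ?n" by (auto simp: replace_col_def emb_mat_def)
        note a = cj_in_conjs[OF x ik(1)]
        have "emb x (cj x i) y' = (\<Sum>k<?n. of_rat (q' k) * emb x (cj x i) (\<omega> k))"
          unfolding y'q using mem
          by (subst emb_sum[OF x a]) (auto simp: emb_mult[OF x a qm] emb_of_rat[OF x a] is_subringD[OF S] qm)
        also have "\<dots> = vec_index (emb_mat x \<omega> *\<^sub>v v) i"
          using ik by (simp add: emb_mat_def v_def scalar_prod_def lessThan_atLeast0 mult.commute)
        finally show "emb_mat x \<omega>' $$ (i, k) = replace_col (emb_mat x \<omega>) (emb_mat x \<omega> *\<^sub>v v) j $$ (i, k)"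
          using ik j by (simp add: replace_col_def emb_mat_def \<omega>'_def)
      qed (simp_all add: replace_col_def emb_mat_def)
      hence "det (emb_mat x \<omega>') = vec_index v j * det (emb_mat x \<omega>)"
        using cramer_lemma_mat[OF emb_mat_carrier _ j(1), of v] by (simp add: v_def)
      also have "vec_index v j = of_rat f" using j by (simp add: v_def q'_def)
      finally have det: "det (emb_mat x \<omega>') = of_rat f * det (emb_mat x \<omega>)" .
      have "y' \<in> Qadj x" unfolding y'_def using y mem j by (intro is_subringD(5,6)[OF S] is_subring_of_int[OF S]) auto
      moreover have "y' \<in> {z. algebraic_int z}"
        unfolding y'_def using y int j
        by (intro is_subringD(5,6)[OF is_subring_algebraic_int] is_subring_of_int[OF is_subring_algebraic_int]) auto
      moreover have "det (emb_mat x \<omega>') \<noteq> 0" using \<omega> f by (simp add: det)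
      ultimately have "?P \<omega>'" using \<omega> j(2) by (auto simp: \<omega>'_def)
      from le[OF this] have "discr x \<omega> \<le> (cmod (of_rat f))\<^sup>2 * discr x \<omega>"
        by (simp add: discr_def det norm_mult power_mult_distrib)
      moreover have "cmod (of_rat f) = \<bar>real_of_rat f\<bar>"
        by (rule cmod_of_rat)
      moreover have "\<bar>real_of_rat f\<bar> < 1" using f by simp
      hence "\<bar>real_of_rat f\<bar>\<^sup>2 < 1" by (simp add: abs_square_less_1)
      moreover have "discr x \<omega> > 0" using \<omega> by (simp add: discr_def)
      ultimately show False using mult_strict_right_mono[of "\<bar>real_of_rat f\<bar>\<^sup>2" 1 "discr x \<omega>"] by simp
    qed
    have int_coord': "of_rat (q j) = (of_int \<lfloor>q j\<rfloor> :: complex)" if j: "j < ?n" "j \<noteq> 0" for j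
    proof -
      have "of_rat (q j) = (of_rat (of_int \<lfloor>q j\<rfloor>) :: complex)" by (simp only: int_coord[OF j])
      thus ?thesis by (simp only: of_rat_of_int_eq)
    qed
    have n: "?n > 0" by (rule deg_pos[OF x])
    have "y = of_rat (q 0) * \<omega> 0 + (\<Sum>j\<in>{..<?n} - {0}. of_rat (q j) * \<omega> j)"
      unfolding q using n by (subst sum.remove[of _ 0]) auto
    hence "of_rat (q 0) = y - (\<Sum>j\<in>{..<?n} - {0}. of_rat (q j) * \<omega> j)" using \<omega> by simp
    also have "(\<Sum>j\<in>{..<?n} - {0}. of_rat (q j) * \<omega> j) = (\<Sum>j\<in>{..<?n} - {0}. of_int \<lfloor>q j\<rfloor> * \<omega> j)"
      by (intro sum.cong) (auto simp: int_coord')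
    also have "y - (\<Sum>j\<in>{..<?n} - {0}. of_int \<lfloor>q j\<rfloor> * \<omega> j) \<in> {z. algebraic_int z}"
      using y int by (intro is_subringD(5,6)[OF is_subring_algebraic_int] is_subring_sum[OF is_subring_algebraic_int]
          is_subring_of_int[OF is_subring_algebraic_int]) auto
    finally have "(of_rat (q 0) :: complex) \<in> \<int>" using rational_algebraic_int_is_int[of "of_rat (q 0) :: complex"] by simp
    then obtain z where "(of_rat (q 0) :: complex) = of_int z" by (auto elim: Ints_cases)
    hence "(of_rat (q 0) :: complex) = of_rat (of_int z)" by (simp add: of_rat_of_int_eq)
    hence "q 0 = of_int z" by (simp only: of_rat_eq_iff)
    hence "of_rat (q 0) = (of_int \<lfloor>q 0\<rfloor> :: complex)" using \<open>of_rat (q 0) = of_int z\<close> by simp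
    hence "of_rat (q j) = (of_int \<lfloor>q j\<rfloor> :: complex)" if "j < ?n" for j
      using int_coord'[of j] that by (cases "j = 0") auto
    hence "y = (\<Sum>j<?n. of_int \<lfloor>q j\<rfloor> * \<omega> j)" unfolding q by (intro sum.cong) auto
    thus ?thesis by (intro exI[of _ "\<lambda>j. \<lfloor>q j\<rfloor>"])
  qed
  thus ?thesis using \<omega> unfolding int_basis_def by blast
qed

section \<open>A weak form of Minkowski's theorem on linear forms\<close>

text \<open>
  Elimination with a pivot of maximal modulus: the multipliers are at most \<open>1\<close>, so each step makes
  the forms larger by at most one further summand.
\<close>

lemma triangularize_bounded:
  fixes M :: "real mat"
  assumes "M \<in> carrier_mat n n" "det M \<noteq> 0"
  shows "\<exists>u. (\<Prod>i<n. \<bar>u i i\<bar>) = \<bar>det M\<bar> \<and>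
    (\<forall>x B. (\<forall>i<n. \<bar>\<Sum>j\<le>i. u i j * x j\<bar> \<le> B) \<longrightarrow> (\<forall>i<n. \<bar>\<Sum>j<n. M $$ (i, j) * x j\<bar> \<le> real n * B))"
  using assms
proof (induction n arbitrary: M)
  case 0
  thus ?case by simp
next
  case (Suc n)
  note M = Suc.prems(1)
  have "\<exists>p\<le>n. \<forall>i\<le>n. \<bar>M $$ (i, n)\<bar> \<le> \<bar>M $$ (p, n)\<bar>"
  proof -
    let ?A = "(\<lambda>i. \<bar>M $$ (i, n)\<bar>) ` {..n}"
    have "Max ?A \<in> ?A" by (rule Max_in) auto
    then obtain p where p: "p \<in> {..n}" "Max ?A = \<bar>M $$ (p, n)\<bar>" by (rule imageE)
    have "\<bar>M $$ (i, n)\<bar> \<le> Max ?A" if "i \<le> n" for i using that by (intro Max_ge) auto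
    thus ?thesis using p by (intro exI[of _ p]) auto
  qed
  then obtain p where p: "p \<le> n" "\<And>i. i \<le> n \<Longrightarrow> \<bar>M $$ (i, n)\<bar> \<le> \<bar>M $$ (p, n)\<bar>" by blast
  \<comment> \<open>move the pivot row to the end\<close>
  define N where "N = (if p = n then M else mat_swaprows p n M)"
  have N: "N \<in> carrier_mat (Suc n) (Suc n)" using M by (auto simp: N_def mat_swaprows_def)
  have detN: "\<bar>det N\<bar> = \<bar>det M\<bar>"
    using det_swaprows[of p "Suc n" n M] M p(1) by (auto simp: N_def)
  have Nn: "N $$ (n, j) = M $$ (p, j)" if "j \<le> n" for j
    using M that p(1) by (auto simp: N_def)
  have Np: "N $$ (p, j) = M $$ (n, j)" if "j \<le> n" for j
    using M that p(1) by (auto simp: N_def)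
  have Ni: "N $$ (i, j) = M $$ (i, j)" if "i \<le> n" "j \<le> n" "i \<noteq> p" "i \<noteq> n" for i j
    using M that p(1) by (auto simp: N_def)
  define c where "c = N $$ (n, n)"
  have cmax: "\<bar>N $$ (i, n)\<bar> \<le> \<bar>c\<bar>" if "i \<le> n" for i
    using p Nn Np Ni that unfolding c_def by (cases "i = n"; cases "i = p") auto
  have cnz: "c \<noteq> 0"
  proof
    assume "c = 0"
    hence "N $$ (i, n) = 0" if "i < Suc n" for i using cmax[of i] that by simp
    hence "det N = 0" by (subst laplace_expansion_column[OF N, of n]) simp_all
    thus False using detN Suc.prems(2) by simp
  qed
  define r where "r i = N $$ (i, n) / c" for i
  have r: "\<bar>r i\<bar> \<le> 1" if "i \<le> n" for i using cmax[OF that] cnz by (simp add: r_def)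
  \<comment> \<open>eliminate the last variable from the other rows\<close>
  define M' where "M' = mat n n (\<lambda>(i, j). N $$ (i, j) - r i * N $$ (n, j))"
  have M': "M' \<in> carrier_mat n n" by (simp add: M'_def)
  define E where "E = mat (Suc n) (Suc n) (\<lambda>(i, k). if i = k then 1 else if k = n then - r i else 0)"
  have E: "E \<in> carrier_mat (Suc n) (Suc n)" by (simp add: E_def)
  have "det E = prod_list (diag_mat E)"
    by (rule det_upper_triangular[OF _ E]) (auto simp: E_def)
  also have "diag_mat E = map (\<lambda>_. 1) [0..<Suc n]" by (auto simp: diag_mat_def E_def intro!: nth_equalityI)
  also have "prod_list \<dots> = 1" by (induction n) auto
  finally have detE: "det E = 1" .
  have EN: "(E * N) $$ (i, j) = (if i = n then N $$ (n, j) else N $$ (i, j) - r i * N $$ (n, j))"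
    if "i \<le> n" "j \<le> n" for i j
  proof -
    have "(E * N) $$ (i, j) = (\<Sum>k<Suc n. E $$ (i, k) * N $$ (k, j))"
      using that N E by (simp add: scalar_prod_def lessThan_atLeast0)
    also have "\<dots> = (\<Sum>k<n. E $$ (i, k) * N $$ (k, j)) + E $$ (i, n) * N $$ (n, j)" by simp
    also have "(\<Sum>k<n. E $$ (i, k) * N $$ (k, j)) = (\<Sum>k<n. if k = i then N $$ (k, j) else 0)"
      using that by (intro sum.cong) (auto simp: E_def)
    finally show ?thesis using that by (auto simp: E_def)
  qed
  have ENc: "E * N \<in> carrier_mat (Suc n) (Suc n)" using E N by simp
  have "det (E * N) = (\<Sum>i<Suc n. (E * N) $$ (i, n) * cofactor (E * N) i n)"
    by (rule laplace_expansion_column[OF ENc]) simp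
  also have "\<dots> = (E * N) $$ (n, n) * cofactor (E * N) n n + (\<Sum>i<n. (E * N) $$ (i, n) * cofactor (E * N) i n)"
    by simp
  also have "(\<Sum>i<n. (E * N) $$ (i, n) * cofactor (E * N) i n) = 0"
    using cnz by (intro sum.neutral) (simp add: EN r_def flip: c_def)
  also have "(E * N) $$ (n, n) * cofactor (E * N) n n + 0 = c * det (mat_delete (E * N) n n)"
    by (simp add: EN c_def cofactor_def flip: mult_2)
  also have "mat_delete (E * N) n n = M'"
    using carrier_matD[OF ENc] EN
    by (intro eq_matI) (simp_all add: mat_delete_def M'_def del: index_mult_mat(1))
  finally have detEN: "det (E * N) = c * det M'" .
  have "det (E * N) = det E * det N" by (rule det_mult[OF E N])
  hence dM: "\<bar>det M\<bar> = \<bar>c\<bar> * \<bar>det M'\<bar>" using detEN detE detN by (simp add: abs_mult[symmetric])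
  hence "det M' \<noteq> 0" using Suc.prems(2) by auto
  from Suc.IH[OF M' this] obtain u where u: "(\<Prod>i<n. \<bar>u i i\<bar>) = \<bar>det M'\<bar>"
    "\<And>x B. (\<forall>i<n. \<bar>\<Sum>j\<le>i. u i j * x j\<bar> \<le> B) \<Longrightarrow> (\<forall>i<n. \<bar>\<Sum>j<n. M' $$ (i, j) * x j\<bar> \<le> real n * B)" by blast
  define v where "v i j = (if i = n then N $$ (n, j) else u i j)" for i j
  have "(\<Prod>i<Suc n. \<bar>v i i\<bar>) = \<bar>det M\<bar>" using u(1) dM by (simp add: v_def c_def mult.commute)
  moreover have "\<bar>\<Sum>j<Suc n. M $$ (i, j) * x j\<bar> \<le> real (Suc n) * B"
    if B: "\<forall>i<Suc n. \<bar>\<Sum>j\<le>i. v i j * x j\<bar> \<le> B" and i: "i < Suc n" for x B i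
  proof -
    have "B \<ge> 0" using B[rule_format, of 0] by simp
    have pv: "\<bar>\<Sum>j<Suc n. N $$ (n, j) * x j\<bar> \<le> B"
      using B[rule_format, of n] by (simp add: v_def lessThan_Suc_atMost)
    have rest: "\<bar>\<Sum>j<Suc n. N $$ (k, j) * x j\<bar> \<le> real n * B + B" if k: "k < n" for k
    proof -
      have "\<forall>i<n. \<bar>\<Sum>j\<le>i. u i j * x j\<bar> \<le> B"
      proof (intro allI impI)
        fix i assume "i < n"
        thus "\<bar>\<Sum>j\<le>i. u i j * x j\<bar> \<le> B" using B[rule_format, of i] by (simp add: v_def)
      qed
      from u(2)[OF this] k have 1: "\<bar>\<Sum>j<n. M' $$ (k, j) * x j\<bar> \<le> real n * B" by blast
      have "(\<Sum>j<n. M' $$ (k, j) * x j) = (\<Sum>j<n. (N $$ (k, j) - r k * N $$ (n, j)) * x j)"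
        using k by (intro sum.cong) (auto simp: M'_def)
      also have "\<dots> = (\<Sum>j<Suc n. (N $$ (k, j) - r k * N $$ (n, j)) * x j)"
        using cnz by (simp add: r_def flip: c_def)
      also have "\<dots> = (\<Sum>j<Suc n. N $$ (k, j) * x j) - r k * (\<Sum>j<Suc n. N $$ (n, j) * x j)"
        by (simp only: sum_subtractf left_diff_distrib sum_distrib_left mult.assoc)
      finally have 2: "(\<Sum>j<Suc n. N $$ (k, j) * x j) =
          (\<Sum>j<n. M' $$ (k, j) * x j) + r k * (\<Sum>j<Suc n. N $$ (n, j) * x j)" by linarith
      have "\<bar>r k * (\<Sum>j<Suc n. N $$ (n, j) * x j)\<bar> \<le> 1 * B"
        unfolding abs_mult using r[of k] k pv by (intro mult_mono) auto
      thus ?thesis unfolding 2 using 1 by linarith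
    qed
    have N_all: "\<bar>\<Sum>j<Suc n. N $$ (k, j) * x j\<bar> \<le> real (Suc n) * B" if "k < Suc n" for k
    proof (cases "k = n")
      case True
      have "0 \<le> real n * B" using \<open>B \<ge> 0\<close> by simp
      moreover have "real (Suc n) * B = real n * B + B" by (simp add: algebra_simps)
      ultimately show ?thesis unfolding True using pv by linarith
    next
      case False
      moreover have "real (Suc n) * B = real n * B + B" by (simp add: algebra_simps)
      ultimately show ?thesis using rest[of k] that by simp
    qed
    define i' where "i' = (if i = p then n else if i = n then p else i)"
    have i': "i' < Suc n" using i p(1) by (auto simp: i'_def)
    have "(\<Sum>j<Suc n. M $$ (i, j) * x j) = (\<Sum>j<Suc n. N $$ (i', j) * x j)"
      using i by (intro sum.cong refl) (auto simp: i'_def Nn Np Ni)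
    thus ?thesis using N_all[OF i'] by simp
  qed
  ultimately show ?case by blast
qed

text \<open>
  For triangular forms the coordinates can be chosen one after the other, which produces many integer
  points in a large box.
\<close>

lemma integer_points_in_interval:
  fixes a c N :: real
  assumes "a \<noteq> 0" "N \<ge> 0"
  shows "\<exists>T. finite T \<and> card T = nat \<lfloor>N / \<bar>a\<bar>\<rfloor> \<and> (\<forall>t\<in>T. 0 \<le> c + a * of_int t \<and> c + a * of_int t < N)"
proof -
  define m where "m = nat \<lfloor>N / \<bar>a\<bar>\<rfloor>"
  have mN: "real m * \<bar>a\<bar> \<le> N"
  proof -
    have "real m \<le> N / \<bar>a\<bar>" using assms unfolding m_def by (simp add: of_nat_nat)
    thus ?thesis using assms by (simp add: pos_le_divide_eq)
  qed
  define s :: int where "s = (if a > 0 then 1 else - 1)"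
  have s: "a * of_int s = \<bar>a\<bar>" using assms(1) by (auto simp: s_def)
  define k0 where "k0 = \<lceil>- c / \<bar>a\<bar>\<rceil>"
  define T where "T = (\<lambda>k. s * (k0 + int k)) ` {..<m}"
  have inj: "inj_on (\<lambda>k. s * (k0 + int k)) {..<m}" by (auto simp: inj_on_def s_def)
  have "0 \<le> c + a * of_int t \<and> c + a * of_int t < N" if "t \<in> T" for t
  proof -
    from that obtain k where k: "k < m" "t = s * (k0 + int k)" by (auto simp: T_def)
    have "a * of_int t = (a * of_int s) * (of_int k0 + real k)" unfolding k by simp
    hence at: "a * of_int t = \<bar>a\<bar> * of_int k0 + \<bar>a\<bar> * real k" by (simp add: s algebra_simps)
    have "- c / \<bar>a\<bar> \<le> of_int k0" "of_int k0 < - c / \<bar>a\<bar> + 1" unfolding k0_def by linarith+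
    hence 1: "- c \<le> \<bar>a\<bar> * of_int k0" "\<bar>a\<bar> * of_int k0 < - c + \<bar>a\<bar>"
      using assms(1) by (simp_all add: field_simps)
    have "\<bar>a\<bar> * (real k + 1) \<le> \<bar>a\<bar> * real m" using k(1) by (intro mult_left_mono) auto
    hence "\<bar>a\<bar> * real k + \<bar>a\<bar> \<le> N" using mN by (simp add: algebra_simps)
    moreover have "0 \<le> \<bar>a\<bar> * real k" by simp
    ultimately show ?thesis using 1 unfolding at by linarith
  qed
  moreover have "card T = m" unfolding T_def by (simp add: card_image[OF inj])
  ultimately show ?thesis unfolding m_def[symmetric] by (intro exI[of _ T]) (auto simp: T_def)
qed

lemma triangular_integer_points:
  fixes u :: "nat \<Rightarrow> nat \<Rightarrow> real" and N :: real
  assumes "\<And>i. i < n \<Longrightarrow> u i i \<noteq> 0" "N \<ge> 0"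
  shows "\<exists>A :: (nat \<Rightarrow> int) set. finite A \<and> card A = (\<Prod>i<n. nat \<lfloor>N / \<bar>u i i\<bar>\<rfloor>) \<and>
    (\<forall>x\<in>A. (\<forall>j\<ge>n. x j = 0) \<and> (\<forall>i<n. 0 \<le> (\<Sum>j\<le>i. u i j * of_int (x j)) \<and> (\<Sum>j\<le>i. u i j * of_int (x j)) < N))"
  using assms(1)
proof (induction n)
  case 0
  show ?case by (intro exI[of _ "{\<lambda>_. 0}"]) auto
next
  case (Suc n)
  have "\<exists>A :: (nat \<Rightarrow> int) set. finite A \<and> card A = (\<Prod>i<n. nat \<lfloor>N / \<bar>u i i\<bar>\<rfloor>) \<and>
    (\<forall>x\<in>A. (\<forall>j\<ge>n. x j = 0) \<and> (\<forall>i<n. 0 \<le> (\<Sum>j\<le>i. u i j * of_int (x j)) \<and> (\<Sum>j\<le>i. u i j * of_int (x j)) < N))"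
    by (rule Suc.IH) (simp add: Suc.prems)
  then obtain A :: "(nat \<Rightarrow> int) set" where A: "finite A" "card A = (\<Prod>i<n. nat \<lfloor>N / \<bar>u i i\<bar>\<rfloor>)"
    and A': "\<forall>x\<in>A. (\<forall>j\<ge>n. x j = 0) \<and> (\<forall>i<n. 0 \<le> (\<Sum>j\<le>i. u i j * of_int (x j)) \<and> (\<Sum>j\<le>i. u i j * of_int (x j)) < N)"
    by (elim exE conjE)
  let ?m = "nat \<lfloor>N / \<bar>u n n\<bar>\<rfloor>"
  have "\<forall>x. \<exists>T. finite T \<and> card T = ?m \<and> (\<forall>t\<in>T. 0 \<le> (\<Sum>j<n. u n j * of_int (x j)) + u n n * of_int t \<and>
      (\<Sum>j<n. u n j * of_int (x j)) + u n n * of_int t < N)" for x :: "nat \<Rightarrow> int"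
    using integer_points_in_interval[of "u n n" N] Suc.prems[of n] assms(2) by simp
  then obtain T where "\<forall>x :: nat \<Rightarrow> int. finite (T x) \<and> card (T x) = ?m \<and> (\<forall>t\<in>T x. 0 \<le> (\<Sum>j<n. u n j * of_int (x j)) + u n n * of_int t \<and>
      (\<Sum>j<n. u n j * of_int (x j)) + u n n * of_int t < N)"
    by (rule exE[OF choice])
  hence T: "\<And>x. finite (T x)" "\<And>x. card (T x) = ?m"
    "\<And>x t. t \<in> T x \<Longrightarrow> 0 \<le> (\<Sum>j<n. u n j * of_int ((x :: nat \<Rightarrow> int) j)) + u n n * of_int t \<and>
      (\<Sum>j<n. u n j * of_int (x j)) + u n n * of_int t < N"
    by simp_all
  define f where "f = (\<lambda>(x :: nat \<Rightarrow> int, t) j. if j = n then t else x j)"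
  define A' where "A' = f ` (SIGMA x:A. T x)"
  have inj: "inj_on f (SIGMA x:A. T x)"
  proof (rule inj_onI)
    fix a b assume ab: "a \<in> (SIGMA x:A. T x)" "b \<in> (SIGMA x:A. T x)" "f a = f b"
    obtain x t y s where [simp]: "a = (x, t)" "b = (y, s)" by (cases a, cases b)
    have eq: "(if j = n then t else x j) = (if j = n then s else y j)" for j
      using fun_cong[OF ab(3), of j] by (simp add: f_def)
    have mem: "x \<in> A" "y \<in> A" using ab by auto
    have "x j = y j" for j
    proof (cases "j = n")
      case True
      have "\<forall>j\<ge>n. x j = 0" "\<forall>j\<ge>n. y j = 0" using A' mem by blast+
      thus ?thesis using True by simp
    next
      case False
      thus ?thesis using eq[of j] by simp
    qed
    hence "x = y" by (rule ext)
    thus "a = b" using eq[of n] by simp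
  qed
  have "card A' = card (SIGMA x:A. T x)" unfolding A'_def by (rule card_image[OF inj])
  also have "\<dots> = (\<Sum>x\<in>A. card (T x))" using A(1) T(1) by (intro card_SigmaI) auto
  also have "\<dots> = (\<Prod>i<Suc n. nat \<lfloor>N / \<bar>u i i\<bar>\<rfloor>)" by (simp add: T(2) A(2))
  finally have "card A' = (\<Prod>i<Suc n. nat \<lfloor>N / \<bar>u i i\<bar>\<rfloor>)" .
  moreover have "finite A'" unfolding A'_def using A(1) T(1) by auto
  moreover have "(\<forall>j\<ge>Suc n. z j = 0) \<and> (\<forall>i<Suc n. 0 \<le> (\<Sum>j\<le>i. u i j * of_int (z j)) \<and> (\<Sum>j\<le>i. u i j * of_int (z j)) < N)"
    if "z \<in> A'" for z
  proof -
    from that obtain x t where x: "x \<in> A" "t \<in> T x" "z = f (x, t)" by (auto simp: A'_def)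
    have z: "z j = (if j = n then t else x j)" for j by (simp add: x f_def)
    have row: "(\<Sum>j\<le>i. u i j * of_int (z j)) = (\<Sum>j\<le>i. u i j * of_int (x j))" if "i < n" for i
      using that by (intro sum.cong) (auto simp: z)
    have "(\<Sum>j\<le>n. u n j * of_int (z j)) = (\<Sum>j<n. u n j * of_int (x j)) + u n n * of_int t"
      by (simp add: z flip: lessThan_Suc_atMost)
    moreover have "(\<forall>j\<ge>n. x j = 0) \<and> (\<forall>i<n. 0 \<le> (\<Sum>j\<le>i. u i j * of_int (x j)) \<and> (\<Sum>j\<le>i. u i j * of_int (x j)) < N)"
      using A' x(1) by blast
    ultimately show ?thesis using T(3)[OF x(2)] row by (simp add: z less_Suc_eq all_conj_distrib imp_conjR)
  qed
  ultimately show ?case by blast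
qed

text \<open>
  The triangular forms take the more than \<open>N\<^sup>n\<close> points of a suitable set into the cube \<open>[0, N)\<^sup>n\<close>, if \<open>N\<close> is large.  Two of
  the points have their values in the same unit cube, and their difference is the desired point.
\<close>

lemma small_triangular_forms:
  fixes u :: "nat \<Rightarrow> nat \<Rightarrow> real"
  assumes nz: "\<And>i. i < n \<Longrightarrow> u i i \<noteq> 0" and small: "(\<Prod>i<n. \<bar>u i i\<bar>) < 1"
  shows "\<exists>x :: nat \<Rightarrow> int. (\<exists>j<n. x j \<noteq> 0) \<and> (\<forall>i<n. \<bar>\<Sum>j\<le>i. u i j * of_int (x j)\<bar> \<le> 1)"
proof -
  have "((\<lambda>N. \<Prod>i<n. (1 / \<bar>u i i\<bar> - 1 / real N)) \<longlongrightarrow> (\<Prod>i<n. (1 / \<bar>u i i\<bar> - 0))) sequentially"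
    by (intro tendsto_intros lim_1_over_n)
  moreover have "(\<Prod>i<n. (1 / \<bar>u i i\<bar> - 0)) > 1"
    using small prod_pos[of "{..<n}" "\<lambda>i. \<bar>u i i\<bar>"] nz by (simp add: prod_dividef)
  ultimately have "eventually (\<lambda>N. (\<Prod>i<n. (1 / \<bar>u i i\<bar> - 1 / real N)) > 1) sequentially"
    by (rule order_tendstoD(1))
  moreover have "eventually (\<lambda>N. 1 / real N < 1 / \<bar>u i i\<bar>) sequentially" if "i < n" for i
    using order_tendstoD(2)[OF lim_1_over_n, of "1 / \<bar>u i i\<bar>"] nz[OF that] by simp
  hence "eventually (\<lambda>N. \<forall>i\<in>{..<n}. 1 / real N < 1 / \<bar>u i i\<bar>) sequentially"
    by (intro eventually_ball_finite) auto
  ultimately have "eventually (\<lambda>N. (\<Prod>i<n. (1 / \<bar>u i i\<bar> - 1 / real N)) > 1 \<and>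
      (\<forall>i\<in>{..<n}. 1 / real N < 1 / \<bar>u i i\<bar>)) sequentially"
    by (rule eventually_conj)
  from eventually_happens'[OF sequentially_bot eventually_conj[OF eventually_gt_at_top[of "0::nat"] this]]
  obtain N where N': "0 < N \<and> (\<Prod>i<n. (1 / \<bar>u i i\<bar> - 1 / real N)) > 1 \<and> (\<forall>i\<in>{..<n}. 1 / real N < 1 / \<bar>u i i\<bar>)"
    by (rule exE)
  have N: "0 < N" "(\<Prod>i<n. (1 / \<bar>u i i\<bar> - 1 / real N)) > 1" "\<And>i. i < n \<Longrightarrow> 1 / real N < 1 / \<bar>u i i\<bar>"
    using N' by blast+
  have "\<exists>A :: (nat \<Rightarrow> int) set. finite A \<and> card A = (\<Prod>i<n. nat \<lfloor>real N / \<bar>u i i\<bar>\<rfloor>) \<and>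
    (\<forall>x\<in>A. (\<forall>j\<ge>n. x j = 0) \<and> (\<forall>i<n. 0 \<le> (\<Sum>j\<le>i. u i j * of_int (x j)) \<and> (\<Sum>j\<le>i. u i j * of_int (x j)) < real N))"
    by (rule triangular_integer_points[OF nz]) simp_all
  then obtain A :: "(nat \<Rightarrow> int) set" where A: "finite A" "card A = (\<Prod>i<n. nat \<lfloor>real N / \<bar>u i i\<bar>\<rfloor>)"
    and A': "\<forall>x\<in>A. (\<forall>j\<ge>n. x j = 0) \<and> (\<forall>i<n. 0 \<le> (\<Sum>j\<le>i. u i j * of_int (x j)) \<and> (\<Sum>j\<le>i. u i j * of_int (x j)) < real N)"
    by (elim exE conjE)
  have "real N ^ n < real N ^ n * (\<Prod>i<n. (1 / \<bar>u i i\<bar> - 1 / real N))" using N by simp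
  also have "\<dots> = (\<Prod>i<n. real N * (1 / \<bar>u i i\<bar> - 1 / real N))" by (simp add: prod.distrib)
  also have "\<dots> \<le> (\<Prod>i<n. real (nat \<lfloor>real N / \<bar>u i i\<bar>\<rfloor>))"
  proof (rule prod_mono)
    fix i assume "i \<in> {..<n}"
    hence i: "i < n" by simp
    have "real N * (1 / \<bar>u i i\<bar> - 1 / real N) = real N / \<bar>u i i\<bar> - 1" using N by (simp add: right_diff_distrib)
    moreover have "0 \<le> real N * (1 / \<bar>u i i\<bar> - 1 / real N)" using N(1) N(3)[OF i] by (intro mult_nonneg_nonneg) auto
    ultimately show "0 \<le> real N * (1 / \<bar>u i i\<bar> - 1 / real N) \<and> real N * (1 / \<bar>u i i\<bar> - 1 / real N) \<le> real (nat \<lfloor>real N / \<bar>u i i\<bar>\<rfloor>)"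
      by linarith
  qed
  also have "\<dots> = real (card A)" by (simp add: A(2))
  finally have big: "N ^ n < card A" by (simp flip: of_nat_power)
  define g where "g x = (\<lambda>i\<in>{..<n}. \<lfloor>\<Sum>j\<le>i. u i j * of_int (x j)\<rfloor>)" for x :: "nat \<Rightarrow> int"
  have "g ` A \<subseteq> {..<n} \<rightarrow>\<^sub>E {0..<int N}" 
  proof (rule image_subsetI)
    fix x assume x: "x \<in> A"
    have "0 \<le> (\<Sum>j\<le>i. u i j * of_int (x j)) \<and> (\<Sum>j\<le>i. u i j * of_int (x j)) < real N" if "i < n" for i
      using A' x that by blast
    thus "g x \<in> {..<n} \<rightarrow>\<^sub>E {0..<int N}" by (auto simp: g_def floor_less_iff)
  qed
  hence "card (g ` A) \<le> card ({..<n} \<rightarrow>\<^sub>E {0..<int N})" by (intro card_mono finite_PiE) auto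
  also have "\<dots> = N ^ n" by (simp add: card_PiE)
  finally have "\<not> inj_on g A" using big card_image[of g A] by auto
  then obtain x y where xy: "x \<in> A" "y \<in> A" "x \<noteq> y" "g x = g y" unfolding inj_on_def by blast
  have "\<exists>j. x j \<noteq> y j" 
  proof (rule ccontr)
    assume "\<nexists>j. x j \<noteq> y j"
    hence "x = y" by (intro ext) simp
    with xy(3) show False by (rule notE)
  qed
  then obtain j where j: "x j \<noteq> y j" by (rule exE)
  have "j < n"
  proof (rule ccontr)
    assume "\<not> j < n"
    hence "n \<le> j" by simp
    hence "x j = 0" "y j = 0" using A' xy(1,2) by blast+
    thus False using j by simp
  qed
  moreover have "\<bar>\<Sum>j\<le>i. u i j * of_int (x j - y j)\<bar> \<le> 1" if "i < n" for i
  proof -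
    have "\<lfloor>\<Sum>j\<le>i. u i j * of_int (x j)\<rfloor> = \<lfloor>\<Sum>j\<le>i. u i j * of_int (y j)\<rfloor>"
      using fun_cong[OF xy(4), of i] that by (simp add: g_def)
    hence "\<bar>(\<Sum>j\<le>i. u i j * of_int (x j)) - (\<Sum>j\<le>i. u i j * of_int (y j))\<bar> \<le> 1" by linarith
    thus ?thesis by (simp add: sum_subtractf right_diff_distrib)
  qed
  moreover have "x j - y j \<noteq> 0" using j by simp
  ultimately show ?thesis
    by (intro exI[of _ "\<lambda>j. x j - y j"] conjI exI[of _ j] allI impI)
qed

text \<open>
  Minkowski's theorem gives the bound \<open>1\<close> in place of \<open>n\<close>.  The factor is the price for replacing the volume argument by
  elimination and counting, and it has no effect on finiteness.
\<close>

lemma small_linear_forms: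
  fixes M :: "real mat"
  assumes M: "M \<in> carrier_mat n n" "det M \<noteq> 0" "\<bar>det M\<bar> < 1"
  shows "\<exists>x :: nat \<Rightarrow> int. (\<exists>j<n. x j \<noteq> 0) \<and> (\<forall>i<n. \<bar>\<Sum>j<n. M $$ (i, j) * of_int (x j)\<bar> \<le> real n)"
proof -
  from triangularize_bounded[OF M(1,2)] obtain u where u: "(\<Prod>i<n. \<bar>u i i\<bar>) = \<bar>det M\<bar>"
    "\<forall>x B. (\<forall>i<n. \<bar>\<Sum>j\<le>i. u i j * x j\<bar> \<le> B) \<longrightarrow> (\<forall>i<n. \<bar>\<Sum>j<n. M $$ (i, j) * x j\<bar> \<le> real n * B)"
    by (elim exE conjE)
  have "u i i \<noteq> 0" if "i < n" for i
  proof
    assume "u i i = 0"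
    hence "(\<Prod>i<n. \<bar>u i i\<bar>) = 0" using that by (intro prod_zero) auto
    thus False using u(1) M(2) by simp
  qed
  moreover have "(\<Prod>i<n. \<bar>u i i\<bar>) < 1" using u(1) M(3) by simp
  ultimately have "\<exists>x :: nat \<Rightarrow> int. (\<exists>j<n. x j \<noteq> 0) \<and> (\<forall>i<n. \<bar>\<Sum>j\<le>i. u i j * of_int (x j)\<bar> \<le> 1)"
    by (rule small_triangular_forms)
  then obtain x :: "nat \<Rightarrow> int" where
    "(\<exists>j<n. x j \<noteq> 0) \<and> (\<forall>i<n. \<bar>\<Sum>j\<le>i. u i j * of_int (x j)\<bar> \<le> 1)" by (rule exE)
  note x = this[THEN conjunct1] this[THEN conjunct2]
  note u(2)[THEN spec, of "\<lambda>j. real_of_int (x j)", THEN spec, of 1]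
  from mp[OF this x(2)] have "\<forall>i<n. \<bar>\<Sum>j<n. M $$ (i, j) * of_int (x j)\<bar> \<le> real n" by (simp only: mult_1_right)
  from conjI[OF x(1) this] show ?thesis by (intro exI[of _ x])
qed

section \<open>Hermite's finiteness theorem\<close>

text \<open>
  A coefficient is an elementary symmetric function, a sum of at most \<open>2\<^sup>n\<close> products of distinct members of \<open>e\<close>.
\<close>

lemma coeff_prod_linear_bound:
  "finite I \<Longrightarrow> cmod (coeff (\<Prod>i\<in>I. [:- e i, 1:]) k) \<le> 2 ^ card I * (\<Prod>i\<in>I. max 1 (cmod (e i)))"
proof (induction I arbitrary: k rule: finite_induct)
  case empty
  show ?case by (simp add: coeff_1)
next
  case (insert i I)
  let ?p = "\<Prod>i\<in>I. [:- e i, 1:]" and ?B = "2 ^ card I * (\<Prod>i\<in>I. max 1 (cmod (e i)))"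
  have B: "?B \<ge> 0" by (intro mult_nonneg_nonneg prod_nonneg) auto
  have "coeff ([:- e i, 1:] * ?p) k = (case k of 0 \<Rightarrow> 0 | Suc l \<Rightarrow> coeff ?p l) - e i * coeff ?p k"
    by (simp add: coeff_pCons split: nat.split)
  also have "cmod \<dots> \<le> cmod (case k of 0 \<Rightarrow> 0 | Suc l \<Rightarrow> coeff ?p l) + cmod (e i) * cmod (coeff ?p k)"
    by (rule order_trans[OF norm_triangle_ineq4]) (simp add: norm_mult)
  also have "\<dots> \<le> ?B + cmod (e i) * ?B"
    using insert.IH B by (intro add_mono mult_left_mono) (auto split: nat.split)
  also have "\<dots> \<le> max 1 (cmod (e i)) * ?B + max 1 (cmod (e i)) * ?B"
    using B mult_right_mono[of 1 "max 1 (cmod (e i))" ?B] mult_right_mono[of "cmod (e i)" "max 1 (cmod (e i))" ?B]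
    by (intro add_mono) auto
  finally show ?case using insert.hyps by (simp add: mult_ac)
qed

lemma finite_polys_bounded:
  assumes "finite (S :: 'a::zero set)"
  shows "finite {p. degree p \<le> n \<and> (\<forall>i. coeff p i \<in> S)}"
proof -
  let ?P = "{p. degree p \<le> n \<and> (\<forall>i. coeff p i \<in> S)}" and ?f = "\<lambda>p. \<lambda>i\<in>{..n}. coeff p i"
  have "?f ` ?P \<subseteq> {..n} \<rightarrow>\<^sub>E S" by (intro image_subsetI PiE_I) auto
  moreover have "finite ({..n} \<rightarrow>\<^sub>E S)" using assms by (intro finite_PiE) auto
  ultimately have "finite (?f ` ?P)" by (rule finite_subset)
  moreover have "inj_on ?f ?P"
  proof (rule inj_onI)
    fix p q assume pq: "p \<in> ?P" "q \<in> ?P" "?f p = ?f q"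
    show "p = q"
    proof (rule poly_eqI)
      fix i show "coeff p i = coeff q i"
      proof (cases "i \<le> n")
        case True
        thus ?thesis using fun_cong[OF pq(3), of i] by simp
      next
        case False
        thus ?thesis using pq(1,2) by (simp add: coeff_eq_0)
      qed
    qed
  qed
  ultimately show ?thesis by (rule finite_imageD)
qed

lemma minpoly_coeff_int:
  assumes "algebraic_int y"
  shows "coeff (\<Prod>b\<in>conjs y. [:- b, 1:]) i \<in> \<int>"
proof -
  note alg = algebraic_int_imp_algebraic[OF assms]
  have "(\<Prod>b\<in>conjs y. [:- b, 1:]) \<in> {p. \<forall>i. coeff p i \<in> {z. algebraic_int z}}"
    using conjs_algebraic_int[OF assms]
    by (intro is_subring_prod[OF is_subring_poly_coeffs[OF is_subring_algebraic_int]])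
      (auto simp: coeff_pCons split: nat.split)
  moreover have "coeff (\<Prod>b\<in>conjs y. [:- b, 1:]) i \<in> \<rat>"
    by (simp flip: minpoly_factorization[OF alg])
  ultimately show ?thesis using rational_algebraic_int_is_int by blast
qed

text \<open>Bounded degree and bounded conjugates leave finitely many minimal polynomials.\<close>

lemma finite_algebraic_int_bounded_conjs:
  "finite {y. algebraic_int y \<and> deg y \<le> n \<and> (\<forall>b\<in>conjs y. cmod b \<le> C)}" (is "finite ?Y")
proof -
  define B where "B = 2 ^ n * max 1 C ^ n"
  define S where "S = {z :: complex. z \<in> \<int> \<and> cmod z \<le> B}"
  have "S \<subseteq> of_int ` {- \<lceil>B\<rceil>..\<lceil>B\<rceil>}"
  proof
    fix z assume "z \<in> S"
    then obtain k where k: "z = of_int k" "\<bar>of_int k\<bar> \<le> B" by (auto simp: S_def elim!: Ints_cases)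
    hence "k \<in> {- \<lceil>B\<rceil>..\<lceil>B\<rceil>}" by (simp add: abs_le_iff) linarith
    thus "z \<in> of_int ` {- \<lceil>B\<rceil>..\<lceil>B\<rceil>}" using k by simp
  qed
  hence "finite S" by (rule finite_subset) simp
  define P where "P = {p. degree p \<le> n \<and> (\<forall>i. coeff p i \<in> S)}"
  have fP: "finite P" unfolding P_def by (rule finite_polys_bounded[OF \<open>finite S\<close>])
  have "?Y \<subseteq> (\<Union>p\<in>P - {0}. {y. poly p y = 0})"
  proof
    fix y assume "y \<in> ?Y"
    hence y: "algebraic_int y" "deg y \<le> n" "\<And>b. b \<in> conjs y \<Longrightarrow> cmod b \<le> C" by auto
    note alg = algebraic_int_imp_algebraic[OF y(1)]
    let ?p = "\<Prod>b\<in>conjs y. [:- b, 1:]"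
    have deg: "degree ?p = deg y" by (simp add: degree_prod_linear finite_conjs[OF alg] card_conjs[OF alg])
    have "cmod (coeff ?p i) \<le> B" for i
    proof -
      have "cmod (coeff ?p i) \<le> 2 ^ deg y * (\<Prod>b\<in>conjs y. max 1 (cmod b))"
        using coeff_prod_linear_bound[OF finite_conjs[OF alg], of "\<lambda>b. b" i] by (simp add: card_conjs[OF alg])
      also have "\<dots> \<le> 2 ^ n * max 1 C ^ n"
      proof (rule mult_mono)
        have "(\<Prod>b\<in>conjs y. max 1 (cmod b)) \<le> (\<Prod>b\<in>conjs y. max 1 C)"
        proof (rule prod_mono)
          fix b assume "b \<in> conjs y"
          from y(3)[OF this] show "0 \<le> max 1 (cmod b) \<and> max 1 (cmod b) \<le> max 1 C" by auto
        qed
        also have "\<dots> = max 1 C ^ deg y" by (simp add: card_conjs[OF alg])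
        also have "\<dots> \<le> max 1 C ^ n" using y(2) by (intro power_increasing) auto
        finally show "(\<Prod>b\<in>conjs y. max 1 (cmod b)) \<le> max 1 C ^ n" .
      qed (use y(2) in \<open>auto intro: prod_nonneg power_increasing\<close>)
      finally show ?thesis by (simp add: B_def)
    qed
    hence "?p \<in> P" unfolding P_def S_def using minpoly_coeff_int[OF y(1)] deg y(2) by simp
    moreover have "?p \<noteq> 0" using finite_conjs[OF alg] by auto
    moreover have "poly ?p y = 0" using conjs_self[OF alg] finite_conjs[OF alg] by (auto simp: poly_prod)
    ultimately show "y \<in> (\<Union>p\<in>P - {0}. {y. poly p y = 0})" by blast
  qed
  moreover have "finite (\<Union>p\<in>P - {0}. {y. poly p y = 0})" using fP by (auto intro: poly_roots_finite)
  ultimately show ?thesis by (rule finite_subset)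
qed

lemma cnj_qeval: "cnj (qeval g x) = qeval g (cnj x)"
proof -
  have "cnj (of_rat q) = (of_rat q :: complex)" for q
  proof -
    obtain a b where "q = Rat.Fract a b" "b > 0" by (cases q) auto
    thus ?thesis by (simp add: of_rat_rat)
  qed
  thus ?thesis by (simp add: qeval_altdef)
qed

lemma cnj_conjs: "a \<in> conjs x \<Longrightarrow> cnj a \<in> conjs x"
  unfolding conjs_def by (simp flip: cnj_qeval)

lemma bij_betw_cnj_conjs: "bij_betw cnj (conjs x) (conjs x)"
  by (rule bij_betw_byWitness[of _ cnj]) (auto intro: cnj_conjs)

lemma emb_cnj:
  assumes "algebraic x" "a \<in> conjs x" "y \<in> Qadj x"
  shows "emb x (cnj a) y = cnj (emb x a y)"
  using assms(3) unfolding Qadj_def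
  by (auto simp: emb_qeval assms cnj_conjs cnj_qeval)

text \<open>
  For a conjugate \<open>a\<close>, the real number \<open>Re z + Im z\<close> with \<open>z = emb x a y\<close> determines, together with
  the corresponding number for the complex conjugate of \<open>a\<close>, the value \<open>z\<close>.  This gives as many real
  coordinates on the field as there are embeddings, without a choice among pairs of conjugate embeddings.
\<close>

definition re_im :: "complex \<Rightarrow> real" where
  "re_im z = Re z + Im z"

lemma cmod_le_re_im: "cmod z \<le> max \<bar>re_im z\<bar> \<bar>re_im (cnj z)\<bar>"
  using cmod_le[of z] by (auto simp: re_im_def)

lemma re_im_sum: "re_im (sum f I) = (\<Sum>i\<in>I. re_im (f i))"
  by (simp add: re_im_def sum.distrib)

lemma re_im_of_int: "re_im (of_int k * z) = of_int k * re_im z"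
  by (simp add: re_im_def algebra_simps)

text \<open>
  The product of the real coordinates of \<open>u\<close> and \<open>w\<close> is \<open>Re (cnj u * w) + Im (u * w)\<close>.  The second summand contributes
  the imaginary part of a trace, which is rational, and conjugating the embeddings shows that the sum on the right is real.
\<close>

lemma sum_re_im_products:
  assumes x: "algebraic x" and y: "y \<in> Qadj x" "z \<in> Qadj x"
  shows "of_real (\<Sum>a\<in>conjs x. re_im (emb x a y) * re_im (emb x a z)) =
    (\<Sum>a\<in>conjs x. cnj (emb x a y) * emb x a z)"
proof -
  let ?S = "\<Sum>a\<in>conjs x. cnj (emb x a y) * emb x a z"
  let ?T = "\<Sum>a\<in>conjs x. emb x a y * emb x a z"
  have "?T = (\<Sum>a\<in>conjs x. emb x a (y * z))" by (intro sum.cong) (auto simp: emb_mult[OF x] y)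
  hence "?T \<in> \<rat>" using trace_rational[OF x is_subringD(5)[OF is_subring_Qadj y]] by simp
  then obtain q where "?T = of_rat q" by (auto elim: Rats_cases)
  hence "cnj ?T = ?T" using cnj_qeval[of "[:q:]" 0] by simp
  hence T: "Im ?T = 0" by (simp only: complex_cnj_cancel_iff complex_eq_iff cnj.simps) linarith
  have "cnj ?S = (\<Sum>a\<in>conjs x. cnj (emb x (cnj a) y) * emb x (cnj a) z)"
    by (simp add: emb_cnj[OF x] y)
  also have "\<dots> = ?S" by (rule sum.reindex_bij_betw[OF bij_betw_cnj_conjs])
  finally have S: "Im ?S = 0" by (simp only: complex_eq_iff cnj.simps) linarith
  have "(\<Sum>a\<in>conjs x. re_im (emb x a y) * re_im (emb x a z)) = Re ?S + Im ?T"
    by (simp add: re_im_def algebra_simps flip: sum.distrib)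
  hence "of_real (\<Sum>a\<in>conjs x. re_im (emb x a y) * re_im (emb x a z)) = of_real (Re ?S)" using T by simp
  also have "\<dots> = ?S" using S by (simp add: complex_eq_iff)
  finally show ?thesis .
qed

definition re_im_mat :: "complex \<Rightarrow> (nat \<Rightarrow> complex) \<Rightarrow> real mat" where
  "re_im_mat x \<omega> = mat (deg x) (deg x) (\<lambda>(i, j). re_im (emb x (cj x i) (\<omega> j)))"

text \<open>
  The matrix \<open>T\<close> of real coordinates and the matrix \<open>W\<close> of the embeddings satisfy \<open>T\<^sup>T T = W\<^sup>* W\<close>, so their determinants have
  the same modulus.
\<close>

lemma det_re_im_mat:
  assumes x: "algebraic x" and \<omega>: "\<And>j. j < deg x \<Longrightarrow> \<omega> j \<in> Qadj x"
  shows "(det (re_im_mat x \<omega>))\<^sup>2 = discr x \<omega>"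
proof -
  let ?n = "deg x"
  define T where "T = map_mat complex_of_real (re_im_mat x \<omega>)"
  define W where "W = emb_mat x \<omega>"
  define V where "V = map_mat cnj W"
  have T: "T \<in> carrier_mat ?n ?n" and W: "W \<in> carrier_mat ?n ?n" and V: "V \<in> carrier_mat ?n ?n"
    by (simp_all add: T_def W_def V_def re_im_mat_def)
  have TT: "transpose_mat T \<in> carrier_mat ?n ?n" and VT: "transpose_mat V \<in> carrier_mat ?n ?n" using T V by simp_all
  have "transpose_mat T * T = transpose_mat V * W"
  proof (rule eq_matI)
    fix j k assume "j < dim_row (transpose_mat V * W)" "k < dim_col (transpose_mat V * W)"
    hence jk: "j < ?n" "k < ?n" using V W by auto
    have "(transpose_mat T * T) $$ (j, k) =
        of_real (\<Sum>i<?n. re_im (emb x (cj x i) (\<omega> j)) * re_im (emb x (cj x i) (\<omega> k)))"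
      using jk by (simp add: T_def re_im_mat_def scalar_prod_def lessThan_atLeast0)
    also have "(\<Sum>i<?n. re_im (emb x (cj x i) (\<omega> j)) * re_im (emb x (cj x i) (\<omega> k))) =
        (\<Sum>a\<in>conjs x. re_im (emb x a (\<omega> j)) * re_im (emb x a (\<omega> k)))"
      by (rule sum.reindex_bij_betw[OF bij_betw_cj[OF x]])
    also have "of_real \<dots> = (\<Sum>a\<in>conjs x. cnj (emb x a (\<omega> j)) * emb x a (\<omega> k))"
      by (rule sum_re_im_products[OF x \<omega>[OF jk(1)] \<omega>[OF jk(2)]])
    also have "\<dots> = (\<Sum>i<?n. cnj (emb x (cj x i) (\<omega> j)) * emb x (cj x i) (\<omega> k))"
      by (rule sum.reindex_bij_betw[OF bij_betw_cj[OF x], symmetric])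
    also have "\<dots> = (transpose_mat V * W) $$ (j, k)"
      using jk by (simp add: V_def W_def emb_mat_def scalar_prod_def lessThan_atLeast0)
    finally show "(transpose_mat T * T) $$ (j, k) = (transpose_mat V * W) $$ (j, k)" .
  qed (use T V W in auto)
  hence "det (transpose_mat T * T) = det (transpose_mat V * W)" by simp
  hence eq: "det T * det T = det V * det W"
    by (simp only: det_mult[OF TT T] det_mult[OF VT W] det_transpose[OF T] det_transpose[OF V])
  have dT: "det T = of_real (det (re_im_mat x \<omega>))" unfolding T_def by (rule of_real_hom.hom_det)
  interpret cnj: comm_ring_hom cnj by unfold_locales auto
  have "det V = cnj (det W)" unfolding V_def by (rule cnj.hom_det)
  hence "complex_of_real ((det (re_im_mat x \<omega>))\<^sup>2) = cnj (det W) * det W"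
    using eq unfolding dT by (simp only: power2_eq_square of_real_mult)
  also have "\<dots> = complex_of_real (discr x \<omega>)"
    unfolding discr_def W_def by (simp only: complex_norm_square mult.commute)
  finally have "complex_of_real ((det (re_im_mat x \<omega>))\<^sup>2) = of_real (discr x \<omega>)" .
  thus ?thesis by (simp only: of_real_eq_iff)
qed

text \<open>
  An embedding other than \<open>b\<close> and its complex conjugate has value of modulus below \<open>1 / 2\<close>, as both of its real coordinates are
  small.  The norm of \<open>\<beta>\<close> is at least \<open>1\<close>, so the value at \<open>b\<close> has modulus at least \<open>1\<close>.  No other embedding can take \<open>\<beta>\<close> to
  this value: for the complex conjugate of \<open>b\<close> the value would be real and again bounded by \<open>1 / 2\<close>.  Hence \<open>\<beta>\<close> has as many
  conjugates as there are embeddings.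
\<close>

lemma generator_of_small_coordinates:
  assumes x: "algebraic x" and \<beta>: "\<beta> \<in> Qadj x" "algebraic_int \<beta>" "\<beta> \<noteq> 0" and b: "b \<in> conjs x"
    and small: "\<And>a. a \<in> conjs x \<Longrightarrow> a \<noteq> b \<Longrightarrow> \<bar>re_im (emb x a \<beta>)\<bar> < 1 / 2"
  shows "Qadj x = Qadj \<beta>" "deg \<beta> = deg x"
proof -
  note emb_c = emb_cnj[OF x _ \<beta>(1)]
  have off: "cmod (emb x a \<beta>) < 1 / 2" if a: "a \<in> conjs x" "a \<noteq> b" "a \<noteq> cnj b" for a
  proof -
    have "cnj a \<noteq> b" using a(3) by auto
    hence "\<bar>re_im (emb x (cnj a) \<beta>)\<bar> < 1 / 2" using small[OF cnj_conjs[OF a(1)]] by simp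
    hence "\<bar>re_im (cnj (emb x a \<beta>))\<bar> < 1 / 2" by (simp only: emb_c[OF a(1)])
    thus ?thesis using small[OF a(1,2)] cmod_le_re_im[of "emb x a \<beta>"] by simp
  qed
  have cb: "cmod (emb x (cnj b) \<beta>) = cmod (emb x b \<beta>)" by (simp add: emb_c[OF b])
  have big: "1 \<le> cmod (emb x b \<beta>)"
  proof (rule ccontr)
    assume lt: "\<not> 1 \<le> cmod (emb x b \<beta>)"
    have "cmod (emb x a \<beta>) < 1" if "a \<in> conjs x" for a
      using lt off[OF that] cb by (cases "a = b"; cases "a = cnj b") auto
    hence "(\<Prod>a\<in>conjs x. cmod (emb x a \<beta>)) < (\<Prod>a\<in>conjs x. 1)"
      using b finite_conjs[OF x] emb_eq_0_iff[OF x _ \<beta>(1)] \<beta>(3)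
      by (intro prod_mono_strict) (auto intro: less_imp_le)
    thus False using norm_ge_1[OF x \<beta>] by simp
  qed
  have uniq: "a = b" if a: "a \<in> conjs x" "emb x a \<beta> = emb x b \<beta>" for a
  proof (rule ccontr)
    assume ab: "a \<noteq> b"
    have "a = cnj b" using off[OF a(1) ab] big a(2) by auto
    hence "cnj (emb x b \<beta>) = emb x b \<beta>" using a(2) emb_c[OF b] by simp
    hence "Im (emb x b \<beta>) = 0" by (simp add: complex_eq_iff)
    moreover from this have "cmod (emb x b \<beta>) = \<bar>re_im (emb x b \<beta>)\<bar>" by (simp add: re_im_def cmod_eq_Re)
    ultimately show False using small[OF a(1) ab] a(2) big by simp
  qed
  from emb_fibre_card[OF x \<beta>(1)] obtain k where k: "deg x = k * deg \<beta>"
    "\<And>c. c \<in> conjs \<beta> \<Longrightarrow> card {a\<in>conjs x. emb x a \<beta> = c} = k" by blast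
  have "{a\<in>conjs x. emb x a \<beta> = emb x b \<beta>} = {b}" using uniq b by auto
  hence "k = 1" using k(2)[OF emb_in_conjs[OF x b \<beta>(1)]] by simp
  thus d: "deg \<beta> = deg x" using k(1) by simp
  have alg: "algebraic \<beta>" by (rule algebraic_int_imp_algebraic[OF \<beta>(2)])
  have mem: "\<beta> ^ j \<in> Qadj x" for j by (rule is_subring_power[OF is_subring_Qadj \<beta>(1)])
  have "qindep (deg x) (\<lambda>j. \<beta> ^ j)" using qindep_powers[OF alg] by (simp add: d)
  from spanning_of_qindep[OF x this mem] show "Qadj x = Qadj \<beta>"
    using Qadj_eq_qspan_powers[OF alg] by (simp add: d)
qed

text \<open>
  The linear forms are the real coordinates of \<open>\<Sum> z\<^sub>j \<omega>\<^sub>j\<close>, weighted by a large factor \<open>c\<close> except for the first one, whose weight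
  \<open>\<epsilon>\<close> is so small that the determinant falls below \<open>1\<close>.  A small value of all forms makes all but the first coordinate
  smaller than \<open>1 / 2\<close> and leaves an explicit bound for the first.
\<close>

lemma small_generator:
  assumes x: "algebraic x" and ib: "int_basis x \<omega>" and D: "discr x \<omega> \<le> D"
  shows "\<exists>\<beta>. algebraic_int \<beta> \<and> Qadj x = Qadj \<beta> \<and>
    (\<forall>b\<in>conjs \<beta>. cmod b \<le> real (deg x) * ((2 * real (deg x) + 1) ^ deg x * (sqrt D + 1)))"
proof -
  let ?n = "deg x"
  note n = deg_pos[OF x]
  have \<omega>: "\<And>j. j < ?n \<Longrightarrow> \<omega> j \<in> Qadj x" "\<And>j. j < ?n \<Longrightarrow> algebraic_int (\<omega> j)" and det: "det (emb_mat x \<omega>) \<noteq> 0"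
    using ib by (auto simp: int_basis_def)
  define c where "c = 2 * real ?n + 1"
  have c: "c > 1" using n by (simp add: c_def)
  have dpos: "discr x \<omega> > 0" using det by (simp add: discr_def)
  hence Dpos: "D > 0" using D by simp
  \<comment> \<open>the weights are chosen with \<open>\<epsilon> c\<^sup>n\<^sup>-\<^sup>1 sqrt D < 1\<close>\<close>
  define \<epsilon> where "\<epsilon> = 1 / (c ^ ?n * (sqrt D + 1))"
  have \<epsilon>: "\<epsilon> > 0" using c Dpos by (simp add: \<epsilon>_def add_pos_pos)
  define w where "w i = (if i = 0 then \<epsilon> else c)" for i :: nat
  define R where "R = re_im_mat x \<omega>"
  have R: "R \<in> carrier_mat ?n ?n" by (simp add: R_def re_im_mat_def)
  define E where "E = mat ?n ?n (\<lambda>(i, j). if i = j then w i else 0)"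
  have E: "E \<in> carrier_mat ?n ?n" by (simp add: E_def)
  have ER: "(E * R) $$ (i, j) = w i * R $$ (i, j)" if "i < ?n" "j < ?n" for i j
  proof -
    have "(E * R) $$ (i, j) = (\<Sum>k<?n. E $$ (i, k) * R $$ (k, j))"
      using that E R by (simp add: scalar_prod_def lessThan_atLeast0)
    also have "\<dots> = (\<Sum>k<?n. if k = i then w i * R $$ (i, j) else 0)"
      using that by (intro sum.cong) (auto simp: E_def)
    finally show ?thesis using that by simp
  qed
  have "det E = prod_list (diag_mat E)" by (rule det_upper_triangular[OF _ E]) (auto simp: E_def)
  also have "diag_mat E = map w [0..<?n]" by (auto simp: diag_mat_def E_def intro!: nth_equalityI)
  also have "prod_list \<dots> = (\<Prod>i<?n. w i)"
    using prod.distinct_set_conv_list[of "[0..<?n]" w] by (simp add: lessThan_atLeast0)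
  also have "\<dots> = w 0 * (\<Prod>i\<in>{..<?n} - {0}. w i)" using n by (intro prod.remove) auto
  also have "(\<Prod>i\<in>{..<?n} - {0}. w i) = c ^ (?n - 1)" using n by (simp add: w_def)
  finally have detE: "det E = \<epsilon> * c ^ (?n - 1)" by (simp add: w_def)
  have detR2: "(det R)\<^sup>2 = discr x \<omega>" unfolding R_def by (rule det_re_im_mat[OF x \<omega>(1)])
  have "\<bar>det R\<bar> = sqrt (discr x \<omega>)" by (simp flip: detR2)
  hence detR: "\<bar>det R\<bar> \<le> sqrt D" "det R \<noteq> 0" using D dpos by auto
  have detER: "det (E * R) = det E * det R" by (rule det_mult[OF E R])
  have "\<bar>det (E * R)\<bar> = \<epsilon> * c ^ (?n - 1) * \<bar>det R\<bar>"
    using \<epsilon> c by (simp add: detER detE abs_mult)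
  also have "\<dots> \<le> \<epsilon> * c ^ (?n - 1) * sqrt D" using \<epsilon> c detR by (intro mult_left_mono) auto
  also have "\<dots> < \<epsilon> * (c ^ ?n * (sqrt D + 1))"
  proof -
    have "c ^ (?n - 1) * sqrt D \<le> c ^ ?n * sqrt D"
      using c Dpos by (intro mult_right_mono power_increasing) auto
    also have "\<dots> < c ^ ?n * (sqrt D + 1)" using c by simp
    finally show ?thesis using \<epsilon> by (simp only: mult.assoc mult_strict_left_mono)
  qed
  also have "\<dots> = 1"
  proof -
    have "c ^ ?n * (sqrt D + 1) \<noteq> 0" using c Dpos by (smt (verit) mult_pos_pos real_sqrt_gt_zero zero_less_power)
    thus ?thesis by (simp add: \<epsilon>_def)
  qed
  finally have lt1: "\<bar>det (E * R)\<bar> < 1" .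
  have nz: "det (E * R) \<noteq> 0" using detR \<epsilon> c by (simp add: detER detE)
  have ERc: "E * R \<in> carrier_mat ?n ?n" using E R by simp
  from small_linear_forms[OF ERc nz lt1] obtain z :: "nat \<Rightarrow> int" where
    z: "\<exists>j<?n. z j \<noteq> 0" "\<forall>i<?n. \<bar>\<Sum>j<?n. (E * R) $$ (i, j) * of_int (z j)\<bar> \<le> real ?n" by (elim exE conjE) (rule that, auto)
  define \<beta> where "\<beta> = (\<Sum>j<?n. of_int (z j) * \<omega> j)"
  have \<beta>mem: "\<beta> \<in> Qadj x" unfolding \<beta>_def using \<omega>
    by (intro is_subring_sum[OF is_subring_Qadj] is_subringD(5)[OF is_subring_Qadj] is_subring_of_int[OF is_subring_Qadj]) auto
  have "\<beta> \<in> {y. algebraic_int y}" unfolding \<beta>_def using \<omega>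
    by (intro is_subring_sum[OF is_subring_algebraic_int] is_subringD(5)[OF is_subring_algebraic_int]
        is_subring_of_int[OF is_subring_algebraic_int]) auto
  hence \<beta>int: "algebraic_int \<beta>" by simp
  have \<beta>nz: "\<beta> \<noteq> 0"
  proof
    assume "\<beta> = 0"
    hence "(\<Sum>j<?n. of_rat (of_int (z j)) * \<omega> j) = 0" by (simp add: \<beta>_def)
    from qindepD[OF qindep_of_emb_mat[OF x \<omega>(1) det] this] z(1) show False by auto
  qed
  have coord: "w i * \<bar>re_im (emb x (cj x i) \<beta>)\<bar> \<le> real ?n" if i: "i < ?n" for i
  proof -
    note a = cj_in_conjs[OF x i]
    have im: "of_int k \<in> Qadj x" for k by (rule is_subring_of_int[OF is_subring_Qadj])
    have ei: "emb x (cj x i) (of_int k) = of_int k" for k using emb_of_rat[OF x a, of "of_int k"] by simp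
    have "emb x (cj x i) \<beta> = (\<Sum>j<?n. of_int (z j) * emb x (cj x i) (\<omega> j))"
      unfolding \<beta>_def using \<omega>(1)
      by (subst emb_sum[OF x a]) (auto simp: emb_mult[OF x a im] ei is_subringD[OF is_subring_Qadj] im)
    hence "re_im (emb x (cj x i) \<beta>) = (\<Sum>j<?n. of_int (z j) * R $$ (i, j))"
      using i by (simp add: re_im_sum re_im_of_int R_def re_im_mat_def)
    hence "w i * re_im (emb x (cj x i) \<beta>) = (\<Sum>j<?n. (E * R) $$ (i, j) * of_int (z j))"
      using i by (simp add: sum_distrib_left ER mult_ac)
    hence "\<bar>w i * re_im (emb x (cj x i) \<beta>)\<bar> \<le> real ?n" using z(2) i by simp
    moreover have "w i > 0" using \<epsilon> c by (simp add: w_def)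
    ultimately show ?thesis by (simp add: abs_mult)
  qed
  define b where "b = cj x 0"
  have b: "b \<in> conjs x" unfolding b_def by (rule cj_in_conjs[OF x n])
  have idx: "\<exists>i<?n. a = cj x i" if "a \<in> conjs x" for a
    using bij_betw_cj[OF x] that by (auto simp: bij_betw_def)
  have small: "\<bar>re_im (emb x a \<beta>)\<bar> < 1 / 2" if a: "a \<in> conjs x" "a \<noteq> b" for a
  proof -
    from idx[OF a(1)] obtain i where i: "i < ?n" "a = cj x i" by blast
    have "i \<noteq> 0"
    proof
      assume "i = 0"
      thus False using a(2) i(2) by (simp add: b_def)
    qed
    hence "c * \<bar>re_im (emb x a \<beta>)\<bar> \<le> real ?n" using coord[OF i(1)] i(2) by (simp add: w_def)
    also have "real ?n < c * (1 / 2)" by (simp add: c_def)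
    finally show ?thesis using c by (simp only: mult_less_cancel_left_pos)
  qed
  note gen = generator_of_small_coordinates[OF x \<beta>mem \<beta>int \<beta>nz b small]
  have bound: "\<bar>re_im (emb x a \<beta>)\<bar> \<le> real ?n * (c ^ ?n * (sqrt D + 1))" if a: "a \<in> conjs x" for a
  proof -
    from idx[OF a] obtain i where i: "i < ?n" "a = cj x i" by blast
    have "c ^ ?n * (sqrt D + 1) \<ge> 1"
      using mult_mono[of 1 "c ^ ?n" 1 "sqrt D + 1"] c Dpos by simp
    hence "\<epsilon> \<le> 1" by (simp add: \<epsilon>_def)
    hence "\<epsilon> \<le> w i" using c by (simp add: w_def)
    hence "\<epsilon> * \<bar>re_im (emb x a \<beta>)\<bar> \<le> w i * \<bar>re_im (emb x a \<beta>)\<bar>" by (intro mult_right_mono) auto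
    also have "\<dots> \<le> real ?n" using coord[OF i(1)] i(2) by simp
    finally have "\<bar>re_im (emb x a \<beta>)\<bar> \<le> real ?n / \<epsilon>" using \<epsilon> by (simp add: pos_le_divide_eq mult.commute)
    thus ?thesis by (simp add: \<epsilon>_def)
  qed
  have "cmod d \<le> real ?n * (c ^ ?n * (sqrt D + 1))" if "d \<in> conjs \<beta>" for d
  proof -
    from that obtain a where a: "a \<in> conjs x" "d = emb x a \<beta>"
      unfolding conjs_covered[OF x \<beta>mem] by auto
    have "\<bar>re_im (cnj d)\<bar> \<le> real ?n * (c ^ ?n * (sqrt D + 1))"
      using bound[OF cnj_conjs[OF a(1)]] emb_cnj[OF x a(1) \<beta>mem] a(2) by simp
    thus ?thesis using bound[OF a(1)] a(2) cmod_le_re_im[of d] by simp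
  qed
  thus ?thesis using \<beta>int gen(1) unfolding c_def by (intro exI[of _ \<beta>]) auto
qed

text \<open>
  Each of these fields is generated by an algebraic integer of bounded degree with bounded conjugates.
\<close>

lemma hermite_finiteness:
  "finite {K. \<exists>x \<omega>. algebraic x \<and> K = Qadj x \<and> deg x \<le> N \<and> int_basis x \<omega> \<and> discr x \<omega> \<le> D}" (is "finite ?F")
proof -
  define C where "C = real N * ((2 * real N + 1) ^ N * (sqrt D + 1))"
  let ?Y = "{y. algebraic_int y \<and> deg y \<le> N \<and> (\<forall>b\<in>conjs y. cmod b \<le> C)}"
  have "?F \<subseteq> Qadj ` ?Y"
  proof
    fix K assume "K \<in> ?F"
    then obtain x \<omega> where x: "algebraic x" "K = Qadj x" "deg x \<le> N" "int_basis x \<omega>" "discr x \<omega> \<le> D" by blast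
    from small_generator[OF x(1,4,5)] obtain \<beta> where \<beta>: "algebraic_int \<beta>" "Qadj x = Qadj \<beta>"
      "\<forall>b\<in>conjs \<beta>. cmod b \<le> real (deg x) * ((2 * real (deg x) + 1) ^ deg x * (sqrt D + 1))" by blast
    have alg: "algebraic \<beta>" by (rule algebraic_int_imp_algebraic[OF \<beta>(1)])
    have "\<beta> \<in> Qadj x" using \<beta>(2) by simp
    from prod_over_embeddings(2)[OF x(1) this] have dle: "deg \<beta> \<le> deg x" using deg_pos[OF x(1)] by (rule dvd_imp_le)
    have "0 \<le> D" using x(5) by (simp add: discr_def order_trans[OF zero_le_power2])
    have "(2 * real (deg x) + 1) ^ deg x \<le> (2 * real N + 1) ^ N"
    proof -
      have "(2 * real (deg x) + 1) ^ deg x \<le> (2 * real N + 1) ^ deg x" using x(3) by (intro power_mono) auto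
      also have "\<dots> \<le> (2 * real N + 1) ^ N" using x(3) by (intro power_increasing) auto
      finally show ?thesis .
    qed
    hence "real (deg x) * ((2 * real (deg x) + 1) ^ deg x * (sqrt D + 1)) \<le> C"
      unfolding C_def using x(3) \<open>0 \<le> D\<close> by (intro mult_mono mult_right_mono mult_nonneg_nonneg) auto
    hence "\<beta> \<in> ?Y" using \<beta> dle x(3) by force
    thus "K \<in> Qadj ` ?Y" using x(2) \<beta>(2) by blast
  qed
  thus ?thesis using finite_algebraic_int_bounded_conjs by (rule finite_surj[rotated])
qed

section \<open>Archimedean places and their local degrees\<close>

text \<open>
  Restricted to the field, since places are extensional functions.
\<close>

definition emb_place :: "complex \<Rightarrow> complex \<Rightarrow> complex \<Rightarrow> real" where
  "emb_place x a = (\<lambda>y\<in>Qadj x. cmod (emb x a y))"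

lemma emb_place_in_places:
  assumes x: "algebraic x" and a: "a \<in> conjs x"
  shows "emb_place x a \<in> places (Qadj x)"
proof -
  have "of_rat q \<in> Qadj x" for q by (rule is_subfieldD(4)[OF is_subfield_Qadj[OF x]])
  hence "emb_place x a (of_rat q) = \<bar>real_of_rat q\<bar>" for q
    by (simp add: emb_place_def emb_of_rat[OF x a] cmod_of_rat)
  moreover have "absolute_value (Qadj x) (emb_place x a)"
    unfolding absolute_value_def emb_place_def
    by (auto simp: emb_eq_0_iff[OF x a] emb_mult[OF x a] emb_add[OF x a] norm_mult norm_triangle_ineq
        intro: is_subringD[OF is_subring_Qadj])
  ultimately show ?thesis unfolding places_def by blast
qed

context
  fixes x a assumes x: "algebraic x" and a: "a \<in> conjs x"
begin

private abbreviation (input) "C \<equiv> cauchy_ring (Qadj x) (emb_place x a)"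

lemma cauchy_ring_simps:
  "monoid.mult C s t = (\<lambda>n. s n * t n)" "\<one>\<^bsub>C\<^esub> = (\<lambda>n. 1)" "\<zero>\<^bsub>C\<^esub> = (\<lambda>n. 0)"
  "add C s t = (\<lambda>n. s n + t n)"
  by (simp_all add: cauchy_ring_def)

lemma cauchy_ring_carrier:
  "s \<in> carrier C \<longleftrightarrow> range s \<subseteq> Qadj x \<and> convergent (\<lambda>n. emb x a (s n))"
proof -
  have "(\<forall>e>0. \<exists>N. \<forall>m\<ge>N. \<forall>n\<ge>N. emb_place x a (s m - s n) < e) \<longleftrightarrow> Cauchy (\<lambda>n. emb x a (s n))"
    if s: "range s \<subseteq> Qadj x"
  proof -
    have mem: "s n \<in> Qadj x" for n using s by auto
    have "emb_place x a (s m - s n) = dist (emb x a (s m)) (emb x a (s n))" for m n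
      using is_subringD(6)[OF is_subring_Qadj mem mem]
      by (simp add: emb_place_def dist_norm emb_diff[OF x a mem mem])
    thus ?thesis by (simp add: Cauchy_def)
  qed
  thus ?thesis by (auto simp: cauchy_ring_def Cauchy_convergent_iff)
qed

lemma cauchy_ring_closed:
  assumes s: "s \<in> carrier C" and t: "t \<in> carrier C"
  shows "(\<lambda>n. s n + t n) \<in> carrier C" "(\<lambda>n. s n * t n) \<in> carrier C" "(\<lambda>n. - s n) \<in> carrier C"
proof -
  have mem: "s n \<in> Qadj x" "t n \<in> Qadj x" for n using s t by (auto simp: cauchy_ring_carrier)
  have c: "convergent (\<lambda>n. emb x a (s n))" "convergent (\<lambda>n. emb x a (t n))"
    using s t by (auto simp: cauchy_ring_carrier)
  show "(\<lambda>n. s n + t n) \<in> carrier C"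
    unfolding cauchy_ring_carrier using convergent_add[OF c] mem
    by (auto simp: emb_add[OF x a] intro: is_subringD[OF is_subring_Qadj])
  show "(\<lambda>n. s n * t n) \<in> carrier C"
    unfolding cauchy_ring_carrier using convergent_mult[OF c] mem
    by (auto simp: emb_mult[OF x a] intro: is_subringD[OF is_subring_Qadj])
  have "emb x a (- s n) = - emb x a (s n)" for n
    using emb_diff[OF x a is_subringD(1)[OF is_subring_Qadj] mem(1)] by (simp add: emb_0[OF x a])
  thus "(\<lambda>n. - s n) \<in> carrier C"
    unfolding cauchy_ring_carrier using convergent_minus_iff[of "\<lambda>n. emb x a (s n)"] c(1) mem
    by (auto intro: is_subringD[OF is_subring_Qadj])
qed

lemma cauchy_ring_const: "y \<in> Qadj x \<Longrightarrow> (\<lambda>n. y) \<in> carrier C"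
  by (auto simp: cauchy_ring_carrier convergent_const)

lemma ring_cauchy_ring: "ring C"
proof (rule ringI)
  show "abelian_group C"
  proof (rule abelian_groupI)
    fix s assume s: "s \<in> carrier C"
    show "\<exists>t\<in>carrier C. t \<oplus>\<^bsub>C\<^esub> s = \<zero>\<^bsub>C\<^esub>"
      using cauchy_ring_closed(3)[OF s s] by (intro bexI[of _ "\<lambda>n. - s n"]) (simp_all add: cauchy_ring_simps)
  qed (auto simp: cauchy_ring_simps algebra_simps intro: cauchy_ring_closed(1)
      cauchy_ring_const is_subringD(1)[OF is_subring_Qadj])
  show "monoid C"
    by (rule monoidI) (auto simp: cauchy_ring_simps algebra_simps intro: cauchy_ring_closed(2)
      cauchy_ring_const is_subringD(2)[OF is_subring_Qadj])
qed (auto simp: cauchy_ring_simps algebra_simps)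

definition cauchy_lim :: "(nat \<Rightarrow> complex) \<Rightarrow> complex" where
  "cauchy_lim s = lim (\<lambda>n. emb x a (s n))"

lemma cauchy_lim_tendsto: "s \<in> carrier C \<Longrightarrow> (\<lambda>n. emb x a (s n)) \<longlonglongrightarrow> cauchy_lim s"
  unfolding cauchy_lim_def cauchy_ring_carrier by (simp add: convergent_LIMSEQ_iff)

lemma cauchy_limI: "(\<lambda>n. emb x a (s n)) \<longlonglongrightarrow> z \<Longrightarrow> cauchy_lim s = z"
  unfolding cauchy_lim_def by (rule limI)

lemma ring_hom_cauchy_lim: "ring_hom_ring C CC cauchy_lim"
proof (rule ring_hom_ringI)
  show "ring C" by (rule ring_cauchy_ring)
  interpret field CC by (rule field_CC)
  show "ring CC" by (rule ring_axioms)
  fix s t assume st: "s \<in> carrier C" "t \<in> carrier C"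
  have mem: "s n \<in> Qadj x" "t n \<in> Qadj x" for n using st by (auto simp: cauchy_ring_carrier)
  note lims = cauchy_lim_tendsto[OF st(1)] cauchy_lim_tendsto[OF st(2)]
  show "cauchy_lim (s \<otimes>\<^bsub>C\<^esub> t) = cauchy_lim s \<otimes>\<^bsub>CC\<^esub> cauchy_lim t"
    using tendsto_mult[OF lims] by (auto simp: cauchy_ring_simps emb_mult[OF x a mem] intro: cauchy_limI)
  show "cauchy_lim (s \<oplus>\<^bsub>C\<^esub> t) = cauchy_lim s \<oplus>\<^bsub>CC\<^esub> cauchy_lim t"
    using tendsto_add[OF lims] by (auto simp: cauchy_ring_simps emb_add[OF x a mem] intro: cauchy_limI)
next
  show "cauchy_lim \<one>\<^bsub>C\<^esub> = \<one>\<^bsub>CC\<^esub>" by (auto simp: cauchy_ring_simps emb_1[OF x a] intro: cauchy_limI)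
qed simp

lemma kernel_cauchy_lim: "a_kernel C CC cauchy_lim = null_sequences (Qadj x) (emb_place x a)"
proof -
  have "cauchy_lim s = 0 \<longleftrightarrow> (\<lambda>n. emb_place x a (s n)) \<longlonglongrightarrow> 0" if s: "s \<in> carrier C" for s
  proof -
    have "s n \<in> Qadj x" for n using s by (auto simp: cauchy_ring_carrier)
    hence "(\<lambda>n. emb_place x a (s n)) = (\<lambda>n. cmod (emb x a (s n)))" by (simp add: emb_place_def)
    hence "(\<lambda>n. emb_place x a (s n)) \<longlonglongrightarrow> 0 \<longleftrightarrow> (\<lambda>n. emb x a (s n)) \<longlonglongrightarrow> 0"
      by (simp add: tendsto_norm_zero_iff)
    also have "\<dots> \<longleftrightarrow> cauchy_lim s = 0"
      using cauchy_lim_tendsto[OF s] by (auto intro: cauchy_limI)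
    finally show ?thesis ..
  qed
  thus ?thesis unfolding a_kernel_def' null_sequences_def by auto
qed

lemma rational_cauchy_sequence:
  obtains s where "s \<in> carrier C" "range s \<subseteq> \<rat>" "cauchy_lim s = of_real r"
proof -
  have "\<exists>q. \<bar>real_of_rat q - r\<bar> < 1 / real (Suc n)" for n
  proof -
    obtain q where "r - 1 / real (Suc n) < real_of_rat q" "real_of_rat q < r + 1 / real (Suc n)"
      using of_rat_dense[of "r - 1 / real (Suc n)" "r + 1 / real (Suc n)"] by auto
    thus ?thesis by (intro exI[of _ q]) linarith
  qed
  hence "\<forall>n. \<exists>q. \<bar>real_of_rat q - r\<bar> < 1 / real (Suc n)" by (rule allI)
  from choice[OF this] obtain q where "\<forall>n. \<bar>real_of_rat (q n) - r\<bar> < 1 / real (Suc n)" by (rule exE)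
  hence q: "\<And>n. \<bar>real_of_rat (q n) - r\<bar> < 1 / real (Suc n)" by (rule spec)
  have "(\<lambda>n. real_of_rat (q n) - r) \<longlonglongrightarrow> 0"
    by (rule Lim_null_comparison[OF _ lim_inverse_n'[THEN LIMSEQ_Suc]])
      (use q in \<open>auto intro!: always_eventually less_imp_le\<close>)
  hence "(\<lambda>n. real_of_rat (q n)) \<longlonglongrightarrow> r" by (simp add: LIM_zero_iff)
  hence "(\<lambda>n. complex_of_real (real_of_rat (q n))) \<longlonglongrightarrow> of_real r" by (rule tendsto_of_real)
  hence lim: "(\<lambda>n. emb x a (of_rat (q n))) \<longlonglongrightarrow> of_real r"
    by (simp add: emb_of_rat[OF x a] complex_of_real_of_rat)
  have "of_rat p \<in> Qadj x" for p by (rule is_subfieldD(4)[OF is_subfield_Qadj[OF x]])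
  hence "(\<lambda>n. of_rat (q n)) \<in> carrier C" using lim by (auto simp: cauchy_ring_carrier convergent_def)
  moreover have "range (\<lambda>n. of_rat (q n) :: complex) \<subseteq> \<rat>" by (intro image_subsetI) simp
  ultimately show thesis using cauchy_limI[OF lim] by (rule that)
qed

lemma cauchy_lim_rational:
  assumes "s \<in> carrier C" "range s \<subseteq> \<rat>" shows "cauchy_lim s \<in> \<real>"
proof -
  have "emb x a (s n) \<in> \<real>" for n
  proof -
    have "s n \<in> \<rat>" using assms(2) by auto
    then obtain q where q: "s n = of_rat q" by (auto elim: Rats_cases)
    have "(of_rat q :: complex) \<in> \<real>" by (simp flip: complex_of_real_of_rat)
    thus ?thesis by (simp add: q emb_of_rat[OF x a])
  qed
  thus ?thesis by (rule closed_sequentially[OF closed_complex_Reals _ cauchy_lim_tendsto[OF assms(1)]])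
qed

text \<open>
  Rational sequences have all real numbers as limits.  If \<open>a\<close> is not real, every complex number is a real combination of \<open>1\<close>
  and \<open>a\<close>, and the coefficients can be approximated by rational numbers.
\<close>

lemma cauchy_lim_image: "cauchy_lim ` carrier C = (if a \<in> \<real> then \<real> else UNIV)"
proof (cases "a \<in> \<real>")
  case True
  have "emb x a y \<in> \<real>" if "y \<in> Qadj x" for y
  proof -
    from that obtain g where "y = qeval g x" by (auto simp: Qadj_def)
    hence "emb x a y = qeval g a" by (simp add: emb_qeval[OF x a])
    moreover have "cnj (qeval g a) = qeval g a" using True by (simp add: cnj_qeval Reals_cnj_iff)
    ultimately show ?thesis by (simp add: Reals_cnj_iff)
  qed
  hence "cauchy_lim s \<in> \<real>" if "s \<in> carrier C" for s
    using that
    by (intro closed_sequentially[OF closed_complex_Reals _ cauchy_lim_tendsto[OF that]]) (auto simp: cauchy_ring_carrier)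
  moreover have "z \<in> cauchy_lim ` carrier C" if "z \<in> \<real>" for z
  proof -
    obtain s where "s \<in> carrier C" "range s \<subseteq> \<rat>" "cauchy_lim s = of_real (Re z)"
      by (rule rational_cauchy_sequence)
    moreover have "of_real (Re z) = z" using that by (rule of_real_Re)
    ultimately show ?thesis by (intro image_eqI[of _ _ s]) simp_all
  qed
  ultimately show ?thesis using True by auto
next
  case False
  hence im: "Im a \<noteq> 0" by (simp add: complex_is_Real_iff)
  have "z \<in> cauchy_lim ` carrier C" for z
  proof -
    define c where "c = Im z / Im a"
    define b where "b = Re z - c * Re a"
    have z: "z = of_real b + of_real c * a" using im by (simp add: complex_eq_iff b_def c_def)
    obtain s where s: "s \<in> carrier C" "range s \<subseteq> \<rat>" "cauchy_lim s = of_real b"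
      by (rule rational_cauchy_sequence)
    obtain t where t: "t \<in> carrier C" "range t \<subseteq> \<rat>" "cauchy_lim t = of_real c"
      by (rule rational_cauchy_sequence)
    have xc: "(\<lambda>n. x) \<in> carrier C" by (rule cauchy_ring_const) simp
    have tx: "(\<lambda>n. t n * x) \<in> carrier C" by (rule cauchy_ring_closed(2)[OF t(1) xc])
    have mem12: "s n \<in> Qadj x" "t n \<in> Qadj x" for n
      using s(1) t(1) by (auto simp: cauchy_ring_carrier)
    note mem = mem12 is_subringD(5)[OF is_subring_Qadj mem12(2) Qadj_self]
    have "(\<lambda>n. emb x a (s n) + emb x a (t n) * a) \<longlonglongrightarrow> cauchy_lim s + cauchy_lim t * a"
      by (intro tendsto_add tendsto_mult tendsto_const cauchy_lim_tendsto s(1) t(1))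
    hence "(\<lambda>n. emb x a (s n + t n * x)) \<longlonglongrightarrow> z"
      by (simp add: s(3) t(3) z emb_add[OF x a mem(1,3)] emb_mult[OF x a mem(2) Qadj_self] emb_self[OF x a])
    hence "cauchy_lim (\<lambda>n. s n + t n * x) = z" by (rule cauchy_limI)
    thus ?thesis using cauchy_ring_closed(1)[OF s(1) tx] by blast
  qed
  thus ?thesis using False by auto
qed

lemma subfield_Reals_CC: "subfield \<real> CC"
  unfolding subfield_CC_iff is_subfield_def is_subring_def by auto

lemma dimension_over_Reals:
  "ring.dimension (CC\<lparr>carrier := cauchy_lim ` carrier C\<rparr>) (if a \<in> \<real> then 1 else 2) \<real> (cauchy_lim ` carrier C)"
  "subfield \<real> (CC\<lparr>carrier := cauchy_lim ` carrier C\<rparr>)"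
proof -
  interpret field CC by (rule field_CC)
  have "ring.dimension (CC\<lparr>carrier := cauchy_lim ` carrier C\<rparr>) (if a \<in> \<real> then 1 else 2) \<real> (cauchy_lim ` carrier C)
    \<and> subfield \<real> (CC\<lparr>carrier := cauchy_lim ` carrier C\<rparr>)"
  proof (cases "a \<in> \<real>")
    case True
    have "field (CC\<lparr>carrier := \<real>\<rparr>)" by (rule subfield_iff(2)[OF subfield_Reals_CC])
    then interpret R: field "CC\<lparr>carrier := \<real>\<rparr>" .
    have "subfield (carrier (CC\<lparr>carrier := \<real>\<rparr>)) (CC\<lparr>carrier := \<real>\<rparr>)" by (rule R.carrier_is_subfield)
    hence sf: "subfield \<real> (CC\<lparr>carrier := \<real>\<rparr>)" by simp
    thus ?thesis using R.dimension_one[OF sf] True by (simp add: cauchy_lim_image)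
  next
    case False
    have "dimension (Suc 1) \<real> (line_extension \<real> \<i> \<real>)"
      by (rule Suc_dim[OF _ _ dimension_one[OF subfield_Reals_CC]]) (simp_all add: complex_is_Real_iff)
    moreover have "line_extension \<real> \<i> \<real> = UNIV"
    proof -
      have "u \<in> line_extension \<real> \<i> \<real>" for u
        unfolding line_extension_mem_iff
        by (intro bexI[of _ "of_real (Im u)"] bexI[of _ "of_real (Re u)"]) (auto simp: complex_eq_iff)
      thus ?thesis by auto
    qed
    ultimately have dim: "dimension (Suc 1) \<real> UNIV" by simp
    have img: "cauchy_lim ` carrier C = UNIV" using False by (simp add: cauchy_lim_image)
    have eq: "CC\<lparr>carrier := UNIV\<rparr> = CC" by (simp add: ring_of_type_algebra_def)
    show ?thesis unfolding img eq using dim subfield_Reals_CC False by (simp add: numeral_2_eq_2)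
  qed
  thus "ring.dimension (CC\<lparr>carrier := cauchy_lim ` carrier C\<rparr>) (if a \<in> \<real> then 1 else 2) \<real> (cauchy_lim ` carrier C)"
    "subfield \<real> (CC\<lparr>carrier := cauchy_lim ` carrier C\<rparr>)" by blast+
qed

text \<open>Taking limits identifies the completion with \<open>\<real>\<close> or \<open>\<complex>\<close>, and the completion of the rationals with \<open>\<real>\<close>.\<close>

lemma local_degree_emb_place: "local_degree (Qadj x) (emb_place x a) = (if a \<in> \<real> then 1 else 2)"
proof -
  let ?N = "null_sequences (Qadj x) (emb_place x a)" and ?R = "completion (Qadj x) (emb_place x a)"
  let ?S = "CC\<lparr>carrier := cauchy_lim ` carrier C\<rparr>" and ?n = "if a \<in> \<real> then 1 else 2 :: nat"
  interpret h: ring_hom_ring C CC cauchy_lim by (rule ring_hom_cauchy_lim)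
  define \<theta> where "\<theta> U = the_elem (cauchy_lim ` U)" for U
  have R: "?R = C Quot a_kernel C CC cauchy_lim" by (simp add: completion_def kernel_cauchy_lim)
  have \<theta>: "\<theta> \<in> ring_iso ?R ?S" unfolding R \<theta>_def[abs_def] by (rule h.FactRing_iso_set_aux)
  have ringR: "ring ?R" unfolding R by (rule ideal.quotient_is_ring[OF h.kernel_is_ideal])
  have ringS: "ring ?S" by (rule h.img_is_ring)
  have \<theta>coset: "\<theta> (?N +>\<^bsub>C\<^esub> s) = cauchy_lim s" if "s \<in> carrier C" for s
    unfolding \<theta>_def kernel_cauchy_lim[symmetric] by (rule h.the_elem_simp[OF that])
  define \<psi> where "\<psi> = inv_into (carrier ?R) \<theta>"
  have \<psi>: "\<psi> \<in> ring_iso ?S ?R" unfolding \<psi>_def by (rule ring_iso_set_sym[OF ringR \<theta>])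
  have bij: "bij_betw \<theta> (carrier ?R) (carrier ?S)" by (rule ring_iso_memE(5)[OF \<theta>])
  have bij': "bij_betw \<psi> (carrier ?S) (carrier ?R)" by (rule ring_iso_memE(5)[OF \<psi>])
  have rat_sub: "rat_completion (Qadj x) (emb_place x a) \<subseteq> carrier ?R"
    unfolding rat_completion_def R FactRing_def A_RCOSETS_def' kernel_cauchy_lim by auto
  have "\<theta> ` rat_completion (Qadj x) (emb_place x a) = \<real>"
  proof
    show "\<theta> ` rat_completion (Qadj x) (emb_place x a) \<subseteq> \<real>"
      unfolding rat_completion_def using \<theta>coset cauchy_lim_rational by auto
    show "\<real> \<subseteq> \<theta> ` rat_completion (Qadj x) (emb_place x a)"
    proof
      fix z :: complex assume "z \<in> \<real>"
      then obtain r where r: "z = of_real r" by (auto elim: Reals_cases)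
      obtain s where s: "s \<in> carrier C" "range s \<subseteq> \<rat>" "cauchy_lim s = of_real r"
        by (rule rational_cauchy_sequence)
      have "?N +>\<^bsub>C\<^esub> s \<in> rat_completion (Qadj x) (emb_place x a)" unfolding rat_completion_def using s by blast
      moreover have "\<theta> (?N +>\<^bsub>C\<^esub> s) = z" using \<theta>coset[OF s(1)] s(3) r by simp
      ultimately show "z \<in> \<theta> ` rat_completion (Qadj x) (emb_place x a)"
        by (intro image_eqI[of _ _ "?N +>\<^bsub>C\<^esub> s"]) simp_all
    qed
  qed
  hence rat: "\<psi> ` \<real> = rat_completion (Qadj x) (emb_place x a)"
    unfolding \<psi>_def using inv_into_image_cancel[OF bij_betw_imp_inj_on[OF bij] rat_sub] by simp
  have hom: "ring_hom_ring ?S ?R \<psi>"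
    using ring_hom_ringI2[OF ringS ringR] \<psi> by (simp add: ring_iso_def)
  have one_zero: "\<one>\<^bsub>?R\<^esub> \<noteq> \<zero>\<^bsub>?R\<^esub>"
  proof
    assume eq: "\<one>\<^bsub>?R\<^esub> = \<zero>\<^bsub>?R\<^esub>"
    have "\<psi> 1 = \<one>\<^bsub>?R\<^esub>" using ring_iso_memE(4)[OF \<psi>] by simp
    moreover have "\<psi> 0 = \<zero>\<^bsub>?R\<^esub>"
    proof -
      interpret \<psi>: ring_hom_ring ?S ?R \<psi> by (rule hom)
      show ?thesis using \<psi>.hom_zero by simp
    qed
    ultimately have "\<psi> 1 = \<psi> 0" using eq by simp
    moreover have "1 \<in> carrier ?S" "0 \<in> carrier ?S" by (auto simp: cauchy_lim_image)
    ultimately have "(1::complex) = 0" by (intro inj_onD[OF bij_betw_imp_inj_on[OF bij']])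
    thus False by simp
  qed
  have "ring.dimension ?R ?n (\<psi> ` \<real>) (\<psi> ` carrier ?S)"
    using ring_hom_ring.inj_hom_dimension[OF hom dimension_over_Reals(2) one_zero _ dimension_over_Reals(1)] bij'
    by (simp add: bij_betw_imp_inj_on)
  hence dim: "ring.dimension ?R ?n (rat_completion (Qadj x) (emb_place x a)) (carrier ?R)"
    using bij' by (simp only: rat bij_betw_imp_surj_on)
  have "subfield (\<psi> ` \<real>) ?R"
    by (rule ring_hom_ring.img_is_subfield(2)[OF hom dimension_over_Reals(2) one_zero])
  hence "subfield (rat_completion (Qadj x) (emb_place x a)) ?R" by (simp only: rat)
  from ring.dimI[OF ringR this dim] show ?thesis by (simp add: local_degree_def over_def)
qed

end

section \<open>Absolute values on a simple extension\<close>

context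
  fixes x v assumes x: "algebraic x" and av: "absolute_value (Qadj x) v"
begin

lemma av_nonneg: "y \<in> Qadj x \<Longrightarrow> 0 \<le> v y"
  and av_eq_0: "y \<in> Qadj x \<Longrightarrow> v y = 0 \<longleftrightarrow> y = 0"
  and av_mult: "y \<in> Qadj x \<Longrightarrow> z \<in> Qadj x \<Longrightarrow> v (y * z) = v y * v z"
  and av_add: "y \<in> Qadj x \<Longrightarrow> z \<in> Qadj x \<Longrightarrow> v (y + z) \<le> v y + v z"
  using av unfolding absolute_value_def by blast+

lemma av_1: "v 1 = 1"
proof -
  have 1: "1 \<in> Qadj x" by (rule is_subringD(2)[OF is_subring_Qadj])
  have "v 1 * v 1 = v 1" using av_mult[OF 1 1] by simp
  thus ?thesis using av_eq_0[OF 1] by simp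
qed

lemma av_power: "y \<in> Qadj x \<Longrightarrow> v (y ^ n) = v y ^ n"
  by (induction n) (auto simp: av_1 av_mult is_subring_power[OF is_subring_Qadj])

lemma av_minus: assumes y: "y \<in> Qadj x" shows "v (- y) = v y"
proof -
  have m: "- 1 \<in> Qadj x" using is_subringD(2,3)[OF is_subring_Qadj] by blast
  have "v (- 1) * v (- 1) = 1" using av_mult[OF m m] av_1 by simp
  hence "\<bar>v (- 1)\<bar> = 1" by (simp add: abs_square_eq_1[symmetric] power2_eq_square)
  hence "v (- 1) = 1" using av_nonneg[OF m] by simp
  thus ?thesis using av_mult[OF m y] by simp
qed

lemma av_diff_le: assumes y: "y \<in> Qadj x" and z: "z \<in> Qadj x" shows "\<bar>v y - v z\<bar> \<le> v (y - z)"
proof -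
  have d: "y - z \<in> Qadj x" "z - y \<in> Qadj x" using y z by (auto intro: is_subringD[OF is_subring_Qadj])
  have "v y \<le> v (y - z) + v z" using av_add[OF d(1) z] by simp
  moreover have "v z \<le> v (z - y) + v y" using av_add[OF d(2) y] by simp
  moreover have "v (z - y) = v (y - z)" using av_minus[OF d(1)] by simp
  ultimately show ?thesis by linarith
qed

lemma av_0: "v 0 = 0"
  using av_eq_0[OF is_subringD(1)[OF is_subring_Qadj]] by simp

lemma av_sum: "(\<And>i. i \<in> I \<Longrightarrow> f i \<in> Qadj x) \<Longrightarrow> v (sum f I) \<le> (\<Sum>i\<in>I. v (f i))"
proof (induction I rule: infinite_finite_induct)
  case (insert i I)
  have "v (f i + sum f I) \<le> v (f i) + v (sum f I)"
    using insert.prems by (intro av_add is_subring_sum[OF is_subring_Qadj]) auto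
  also have "\<dots> \<le> v (f i) + (\<Sum>i\<in>I. v (f i))" using insert by auto
  finally show ?case using insert.hyps by simp
qed (simp_all add: av_0)

text \<open>
  If the absolute value is at most \<open>1\<close> on the integers, an integral equation \<open>y\<^sup>d = - \<Sum> c\<^sub>i y\<^sup>i\<close> bounds it
  by \<open>2\<close> at every algebraic integer, and applying this to powers improves the bound to \<open>1\<close>.
\<close>

lemma av_algebraic_int_le_1:
  assumes le1: "\<And>k::int. v (of_int k) \<le> 1" and y: "y \<in> Qadj x" "algebraic_int y"
  shows "v y \<le> 1"
proof -
  have le2: "v z \<le> 2" if z: "z \<in> Qadj x" "algebraic_int z" for z
  proof (rule ccontr)
    assume "\<not> v z \<le> 2"
    hence gt: "v z > 2" by simp
    from z(2) obtain p where p: "lead_coeff p = 1" "\<And>i. coeff p i \<in> \<int>" "poly p z = 0"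
      unfolding algebraic_int_iff by blast
    let ?d = "degree p"
    have "0 = (\<Sum>i<Suc ?d. coeff p i * z ^ i)" using p(3) by (simp add: poly_altdef lessThan_Suc_atMost)
    also have "\<dots> = (\<Sum>i<?d. coeff p i * z ^ i) + z ^ ?d" using p(1) by simp
    finally have eq: "z ^ ?d = (\<Sum>i<?d. - coeff p i * z ^ i)" by (simp add: sum_negf add_eq_0_iff)
    have ci: "\<exists>k. coeff p i = of_int k" for i using p(2)[of i] by (auto elim: Ints_cases)
    have mem: "- coeff p i * z ^ i \<in> Qadj x" "coeff p i \<in> Qadj x" "z ^ i \<in> Qadj x" for i
    proof -
      from ci obtain k where "coeff p i = of_int k" by blast
      thus "coeff p i \<in> Qadj x" by (simp add: is_subring_of_int[OF is_subring_Qadj])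
      thus "- coeff p i * z ^ i \<in> Qadj x" "z ^ i \<in> Qadj x"
        using z(1) by (auto intro!: is_subringD[OF is_subring_Qadj] is_subring_power[OF is_subring_Qadj])
    qed
    have summand: "v (- coeff p i * z ^ i) \<le> v z ^ i" for i
    proof -
      from ci obtain k where k: "coeff p i = of_int k" by blast
      have m: "of_int (- k) \<in> Qadj x" by (rule is_subring_of_int[OF is_subring_Qadj])
      have "- coeff p i * z ^ i = of_int (- k) * z ^ i" by (simp add: k)
      hence "v (- coeff p i * z ^ i) = v (of_int (- k)) * v z ^ i"
        by (simp only: av_mult[OF m mem(3)] av_power[OF z(1)])
      also have "\<dots> \<le> 1 * v z ^ i" using le1[of "- k"] av_nonneg[OF z(1)] by (intro mult_right_mono) auto
      finally show ?thesis by simp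
    qed
    have "v z ^ ?d = v (z ^ ?d)" by (simp add: av_power z)
    also have "\<dots> \<le> (\<Sum>i<?d. v (- coeff p i * z ^ i))" unfolding eq using mem by (intro av_sum) auto
    also have "\<dots> \<le> (\<Sum>i<?d. v z ^ i)" by (intro sum_mono summand)
    also have "\<dots> = (v z ^ ?d - 1) / (v z - 1)" using gt by (simp add: geometric_sum)
    also have "\<dots> < v z ^ ?d"
    proof -
      have "v z ^ ?d * 1 \<le> v z ^ ?d * (v z - 1)" using gt by (intro mult_left_mono) auto
      hence "v z ^ ?d - 1 < v z ^ ?d * (v z - 1)" by simp
      thus ?thesis using gt by (simp add: pos_divide_less_eq)
    qed
    finally show False by simp
  qed
  show ?thesis
  proof (rule ccontr)
    assume "\<not> v y \<le> 1"
    then obtain n where n: "2 < v y ^ n" using real_arch_pow[of "v y" 2] by auto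
    have "y ^ n \<in> Qadj x" "algebraic_int (y ^ n)"
      using is_subring_power[OF is_subring_Qadj y(1)] is_subring_power[OF is_subring_algebraic_int, of y n] y(2) by auto
    from le2[OF this] n show False by (simp add: av_power y)
  qed
qed

context
  assumes arch: "\<And>q. v (of_rat q) = \<bar>real_of_rat q\<bar>"
begin

lemma av_qeval_le:
  assumes "degree g \<le> n"
  shows "v (qeval g x) \<le> (\<Sum>i\<le>n. \<bar>real_of_rat (coeff g i)\<bar> * v x ^ i)"
proof -
  have mem: "of_rat q \<in> Qadj x" "x ^ i \<in> Qadj x" for q i
    using is_subfieldD(4)[OF is_subfield_Qadj[OF x]] is_subring_power[OF is_subring_Qadj] by auto
  have "qeval g x = (\<Sum>i\<le>n. of_rat (coeff g i) * x ^ i)"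
    using qeval_lessThan[of g "Suc n" x] assms by (simp add: lessThan_Suc_atMost)
  also have "v \<dots> \<le> (\<Sum>i\<le>n. v (of_rat (coeff g i) * x ^ i))"
    using mem by (intro av_sum is_subringD[OF is_subring_Qadj]) auto
  also have "\<dots> = (\<Sum>i\<le>n. \<bar>real_of_rat (coeff g i)\<bar> * v x ^ i)"
    by (intro sum.cong) (auto simp: av_mult mem arch av_power)
  finally show ?thesis .
qed

text \<open>
  The absolute value extends to a multiplicative seminorm on real polynomials by approximating their
  coefficients by rational numbers.
\<close>

definition rat_approx :: "nat \<Rightarrow> real poly \<Rightarrow> rat poly" where
  "rat_approx k g = map_poly (\<lambda>c. of_int \<lfloor>c * real (Suc k)\<rfloor> / of_nat (Suc k)) g"

definition poly_seminorm :: "real poly \<Rightarrow> real" where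
  "poly_seminorm g = lim (\<lambda>k. v (qeval (rat_approx k g) x))"

lemma coeff_rat_approx: "\<bar>real_of_rat (coeff (rat_approx k g) i) - coeff g i\<bar> \<le> 1 / real (Suc k)"
proof -
  let ?c = "coeff g i" and ?m = "real (Suc k)"
  have "real_of_rat (coeff (rat_approx k g) i) = of_int \<lfloor>?c * ?m\<rfloor> / ?m"
    by (simp add: rat_approx_def coeff_map_poly of_rat_divide del: of_nat_Suc)
  hence "real_of_rat (coeff (rat_approx k g) i) - ?c = (of_int \<lfloor>?c * ?m\<rfloor> - ?c * ?m) / ?m"
    by (simp add: field_simps del: of_nat_Suc)
  moreover have "\<bar>of_int \<lfloor>?c * ?m\<rfloor> - ?c * ?m\<bar> \<le> 1" by linarith
  ultimately show ?thesis by (simp add: divide_right_mono del: of_nat_Suc)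
qed

lemma degree_rat_approx: "degree (rat_approx k g) \<le> degree g"
  unfolding rat_approx_def by (rule degree_map_poly_le)

lemma poly_seminorm_converges: "(\<lambda>k. v (qeval (rat_approx k g) x)) \<longlonglongrightarrow> poly_seminorm g"
proof -
  let ?u = "\<lambda>k. v (qeval (rat_approx k g) x)" and ?n = "degree g"
  define T where "T = (\<Sum>i\<le>?n. v x ^ i)"
  have T: "T \<ge> 0" unfolding T_def by (intro sum_nonneg zero_le_power av_nonneg Qadj_self)
  have bound: "\<bar>?u k - ?u l\<bar> \<le> (1 / real (Suc k) + 1 / real (Suc l)) * T" for k l
  proof -
    have "\<bar>?u k - ?u l\<bar> \<le> v (qeval (rat_approx k g) x - qeval (rat_approx l g) x)"
      by (rule av_diff_le) auto
    also have "\<dots> = v (qeval (rat_approx k g - rat_approx l g) x)" by simp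
    also have "\<dots> \<le> (\<Sum>i\<le>?n. \<bar>real_of_rat (coeff (rat_approx k g - rat_approx l g) i)\<bar> * v x ^ i)"
      by (intro av_qeval_le degree_diff_le degree_rat_approx)
    also have "\<dots> \<le> (\<Sum>i\<le>?n. (1 / real (Suc k) + 1 / real (Suc l)) * v x ^ i)"
    proof (intro sum_mono mult_right_mono)
      fix i
      have "\<bar>real_of_rat (coeff (rat_approx k g) i) - real_of_rat (coeff (rat_approx l g) i)\<bar>
          \<le> 1 / real (Suc k) + 1 / real (Suc l)"
        using coeff_rat_approx[of k g i] coeff_rat_approx[of l g i] by linarith
      thus "\<bar>real_of_rat (coeff (rat_approx k g - rat_approx l g) i)\<bar> \<le> 1 / real (Suc k) + 1 / real (Suc l)"
        by (simp add: of_rat_diff)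
    qed (simp add: av_nonneg)
    finally show ?thesis by (simp add: T_def sum_distrib_left)
  qed
  have "Cauchy ?u"
  proof (rule metric_CauchyI)
    fix e :: real assume e: "e > 0"
    obtain M where M: "real M > 2 * (T + 1) / e" using reals_Archimedean2 by blast
    have "dist (?u k) (?u l) < e" if kl: "k \<ge> M" "l \<ge> M" for k l
    proof -
      have Mpos: "real (Suc M) > 0" by simp
      have "1 / real (Suc k) + 1 / real (Suc l) \<le> 1 / real (Suc M) + 1 / real (Suc M)"
        using kl by (intro add_mono divide_left_mono) auto
      hence "dist (?u k) (?u l) \<le> (2 / real (Suc M)) * T"
        using bound[of k l] T mult_right_mono[of "1 / real (Suc k) + 1 / real (Suc l)" "2 / real (Suc M)" T]
        by (simp add: dist_real_def)
      also have "\<dots> < e"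
      proof -
        have "2 * (T + 1) < e * real (Suc M)" using M e by (simp add: pos_divide_less_eq algebra_simps)
        thus ?thesis using Mpos e by (simp add: pos_divide_less_eq algebra_simps)
      qed
      finally show ?thesis .
    qed
    thus "\<exists>M. \<forall>m\<ge>M. \<forall>n\<ge>M. dist (?u m) (?u n) < e" by blast
  qed
  hence "convergent ?u" by (simp add: Cauchy_convergent_iff)
  thus ?thesis unfolding poly_seminorm_def by (simp add: convergent_LIMSEQ_iff)
qed

lemma poly_seminorm_limit:
  assumes deg: "\<And>k. degree (f k) \<le> n"
    and coeff: "\<And>i. (\<lambda>k. real_of_rat (coeff (f k) i)) \<longlonglongrightarrow> coeff g i"
  shows "(\<lambda>k. v (qeval (f k) x)) \<longlonglongrightarrow> poly_seminorm g"
proof -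
  let ?u = "\<lambda>k. v (qeval (rat_approx k g) x)" and ?w = "\<lambda>k. v (qeval (f k) x)" and ?n = "max n (degree g)"
  let ?b = "\<lambda>k. \<Sum>i\<le>?n. \<bar>real_of_rat (coeff (f k) i) - real_of_rat (coeff (rat_approx k g) i)\<bar> * v x ^ i"
  have ca: "(\<lambda>k. real_of_rat (coeff (rat_approx k g) i)) \<longlonglongrightarrow> coeff g i" for i
  proof -
    have "(\<lambda>k. real_of_rat (coeff (rat_approx k g) i) - coeff g i) \<longlonglongrightarrow> 0"
    proof (rule Lim_null_comparison)
      show "\<forall>\<^sub>F k in sequentially. norm (real_of_rat (coeff (rat_approx k g) i) - coeff g i) \<le> 1 / real (Suc k)"
        by (intro always_eventually allI) (simp only: real_norm_def coeff_rat_approx)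
      show "(\<lambda>k. 1 / real (Suc k)) \<longlonglongrightarrow> 0" by (rule LIMSEQ_Suc[OF lim_1_over_n])
    qed
    thus ?thesis by (simp add: LIM_zero_iff)
  qed
  have "(\<lambda>k. ?b k) \<longlonglongrightarrow> (\<Sum>i\<le>?n. \<bar>coeff g i - coeff g i\<bar> * v x ^ i)"
    by (intro tendsto_sum tendsto_mult tendsto_rabs tendsto_diff coeff ca tendsto_const)
  hence b0: "?b \<longlonglongrightarrow> 0" by simp
  have "(\<lambda>k. ?w k - ?u k) \<longlonglongrightarrow> 0"
  proof (rule Lim_null_comparison[OF _ b0], intro always_eventually allI)
    fix k
    have "\<bar>?w k - ?u k\<bar> \<le> v (qeval (f k) x - qeval (rat_approx k g) x)" by (rule av_diff_le) auto
    also have "\<dots> = v (qeval (f k - rat_approx k g) x)" by simp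
    also have "\<dots> \<le> (\<Sum>i\<le>?n. \<bar>real_of_rat (coeff (f k - rat_approx k g) i)\<bar> * v x ^ i)"
      using deg[of k] degree_rat_approx[of k g] by (intro av_qeval_le degree_diff_le) auto
    also have "\<dots> = ?b k" by (simp add: of_rat_diff)
    finally show "norm (?w k - ?u k) \<le> ?b k" by simp
  qed
  from tendsto_add[OF this poly_seminorm_converges[of g]] show ?thesis by simp
qed

lemma rat_approx_coeff_tendsto: "(\<lambda>k. real_of_rat (coeff (rat_approx k g) i)) \<longlonglongrightarrow> coeff g i"
proof -
  have "(\<lambda>k. real_of_rat (coeff (rat_approx k g) i) - coeff g i) \<longlonglongrightarrow> 0"
  proof (rule Lim_null_comparison)
    show "\<forall>\<^sub>F k in sequentially. norm (real_of_rat (coeff (rat_approx k g) i) - coeff g i) \<le> 1 / real (Suc k)"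
      by (intro always_eventually allI) (simp only: real_norm_def coeff_rat_approx)
    show "(\<lambda>k. 1 / real (Suc k)) \<longlonglongrightarrow> 0" by (rule LIMSEQ_Suc[OF lim_1_over_n])
  qed
  thus ?thesis by (simp add: LIM_zero_iff)
qed

lemma poly_seminorm_mult: "poly_seminorm (f * g) = poly_seminorm f * poly_seminorm g"
proof -
  have "(\<lambda>k. v (qeval (rat_approx k f * rat_approx k g) x)) \<longlonglongrightarrow> poly_seminorm (f * g)"
  proof (rule poly_seminorm_limit[of _ "degree f + degree g"])
    show "degree (rat_approx k f * rat_approx k g) \<le> degree f + degree g" for k
      using degree_mult_le[of "rat_approx k f" "rat_approx k g"] degree_rat_approx[of k f] degree_rat_approx[of k g]
      by linarith
    fix i
    have "(\<lambda>k. \<Sum>j\<le>i. real_of_rat (coeff (rat_approx k f) j) * real_of_rat (coeff (rat_approx k g) (i - j)))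
        \<longlonglongrightarrow> (\<Sum>j\<le>i. coeff f j * coeff g (i - j))"
      by (intro tendsto_sum tendsto_mult rat_approx_coeff_tendsto)
    thus "(\<lambda>k. real_of_rat (coeff (rat_approx k f * rat_approx k g) i)) \<longlonglongrightarrow> coeff (f * g) i"
      by (simp add: coeff_mult of_rat_sum of_rat_mult)
  qed
  moreover have "(\<lambda>k. v (qeval (rat_approx k f * rat_approx k g) x)) \<longlonglongrightarrow> poly_seminorm f * poly_seminorm g"
    using tendsto_mult[OF poly_seminorm_converges[of f] poly_seminorm_converges[of g]] by (simp add: av_mult)
  ultimately show ?thesis by (rule LIMSEQ_unique)
qed

lemma poly_seminorm_add: "poly_seminorm (f + g) \<le> poly_seminorm f + poly_seminorm g"
proof -
  have 1: "(\<lambda>k. v (qeval (rat_approx k f + rat_approx k g) x)) \<longlonglongrightarrow> poly_seminorm (f + g)"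
  proof (rule poly_seminorm_limit[of _ "max (degree f) (degree g)"])
    show "degree (rat_approx k f + rat_approx k g) \<le> max (degree f) (degree g)" for k
      using degree_rat_approx[of k f] degree_rat_approx[of k g] by (intro degree_add_le) auto
    fix i
    show "(\<lambda>k. real_of_rat (coeff (rat_approx k f + rat_approx k g) i)) \<longlonglongrightarrow> coeff (f + g) i"
      using tendsto_add[OF rat_approx_coeff_tendsto[of f i] rat_approx_coeff_tendsto[of g i]] by (simp add: of_rat_add)
  qed
  have 2: "(\<lambda>k. v (qeval (rat_approx k f) x) + v (qeval (rat_approx k g) x)) \<longlonglongrightarrow> poly_seminorm f + poly_seminorm g"
    by (intro tendsto_add poly_seminorm_converges)
  have "v (qeval (rat_approx k f + rat_approx k g) x) \<le> v (qeval (rat_approx k f) x) + v (qeval (rat_approx k g) x)" for k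
    by (simp add: av_add)
  thus ?thesis by (intro LIMSEQ_le[OF 1 2]) blast
qed

lemma poly_seminorm_of_rat: "poly_seminorm (map_poly of_rat g) = v (qeval g x)"
proof -
  have "(\<lambda>k. v (qeval g x)) \<longlonglongrightarrow> poly_seminorm (map_poly of_rat g)"
    by (rule poly_seminorm_limit[of "\<lambda>_. g" "degree g"]) simp_all
  thus ?thesis by (simp add: LIMSEQ_const_iff)
qed

lemma poly_seminorm_const: "poly_seminorm [:c:] = \<bar>c\<bar>"
proof -
  have "rat_approx k [:c:] = [:of_int \<lfloor>c * real (Suc k)\<rfloor> / of_nat (Suc k):]" for k
    by (intro poly_eqI) (simp add: rat_approx_def coeff_map_poly coeff_pCons split: nat.split)
  hence "v (qeval (rat_approx k [:c:]) x) = \<bar>real_of_rat (coeff (rat_approx k [:c:]) 0)\<bar>" for k by (simp add: arch)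
  moreover have "(\<lambda>k. \<bar>real_of_rat (coeff (rat_approx k [:c:]) 0)\<bar>) \<longlonglongrightarrow> \<bar>coeff [:c:] 0\<bar>"
    by (intro tendsto_rabs rat_approx_coeff_tendsto)
  ultimately have "(\<lambda>k. v (qeval (rat_approx k [:c:]) x)) \<longlonglongrightarrow> \<bar>c\<bar>" by simp
  with poly_seminorm_converges show ?thesis by (rule LIMSEQ_unique)
qed

lemma poly_seminorm_prod: "poly_seminorm (prod f I) = (\<Prod>i\<in>I. poly_seminorm (f i))"
proof -
  have "poly_seminorm 1 = 1" using poly_seminorm_const[of 1] by (simp add: one_pCons)
  thus ?thesis by (induction I rule: infinite_finite_induct) (auto simp: poly_seminorm_mult)
qed

lemma poly_seminorm_power: "poly_seminorm (f ^ n) = poly_seminorm f ^ n"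
  using poly_seminorm_prod[of "\<lambda>_. f" "{..<n}"] by simp

text \<open>
  The square of the minimal polynomial is the product of the real quadratic polynomials
  \<open>(X - a) (X - cnj a)\<close>, so the seminorm vanishes at one of them.  Modulo this polynomial every real
  polynomial \<open>g\<close> is linear, with coefficients bounded by a multiple of \<open>cmod (g a)\<close>, and powers of \<open>g\<close>
  remove the constant.
\<close>

definition conj_quadratic :: "complex \<Rightarrow> real poly" where
  "conj_quadratic a = [:(cmod a)\<^sup>2, - 2 * Re a, 1:]"

lemma conj_quadratic_complex: "map_poly complex_of_real (conj_quadratic a) = [:- a, 1:] * [:- cnj a, 1:]"
proof -
  have "complex_of_real ((cmod a)\<^sup>2) = a * cnj a" by (rule complex_norm_square)
  moreover have "complex_of_real (- 2 * Re a) = - a - cnj a" by (simp add: complex_eq_iff)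
  ultimately show ?thesis
    by (simp add: conj_quadratic_def map_poly_pCons del: of_real_power of_real_mult)
qed

lemma poly_conj_quadratic: "poly (map_poly complex_of_real (conj_quadratic a)) a = 0"
  by (simp add: conj_quadratic_complex)

lemma exists_null_quadratic: "\<exists>a\<in>conjs x. poly_seminorm (conj_quadratic a) = 0"
proof -
  let ?P = "map_poly of_rat (minpoly x) :: real poly"
  interpret cr: map_poly_inj_idom_hom complex_of_real ..
  have cP: "map_poly complex_of_real ?P = (\<Prod>a\<in>conjs x. [:- a, 1:])"
  proof -
    have "map_poly complex_of_real ?P = map_poly of_rat (minpoly x)"
      by (intro poly_eqI) (simp add: coeff_map_poly complex_of_real_of_rat)
    thus ?thesis by (simp add: minpoly_factorization[OF x])
  qed
  have "map_poly complex_of_real (\<Prod>a\<in>conjs x. conj_quadratic a) =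
      (\<Prod>a\<in>conjs x. [:- a, 1:]) * (\<Prod>a\<in>conjs x. [:- cnj a, 1:])"
    by (simp only: cr.hom_prod conj_quadratic_complex prod.distrib)
  also have "(\<Prod>a\<in>conjs x. [:- cnj a, 1:]) = (\<Prod>a\<in>conjs x. [:- a, 1:])"
    by (rule prod.reindex_bij_betw[OF bij_betw_cnj_conjs])
  also have "(\<Prod>a\<in>conjs x. [:- a, 1:]) * (\<Prod>a\<in>conjs x. [:- a, 1:]) = map_poly complex_of_real (?P * ?P)"
    by (simp only: cr.hom_mult cP)
  finally have "(\<Prod>a\<in>conjs x. conj_quadratic a) = ?P * ?P" by (simp only: cr.eq_iff)
  hence "(\<Prod>a\<in>conjs x. poly_seminorm (conj_quadratic a)) = poly_seminorm ?P * poly_seminorm ?P"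
    by (simp only: poly_seminorm_prod[symmetric] poly_seminorm_mult)
  also have "poly_seminorm ?P = 0"
    using minpoly(2)[OF x] by (simp add: poly_seminorm_of_rat av_eq_0 is_subringD[OF is_subring_Qadj])
  finally show ?thesis using finite_conjs[OF x] by simp
qed

lemma poly_seminorm_nonneg: "0 \<le> poly_seminorm g"
  by (rule LIMSEQ_le_const[OF poly_seminorm_converges]) (auto intro: av_nonneg)

lemma poly_seminorm_bound:
  assumes null: "poly_seminorm (conj_quadratic a) = 0"
  shows "\<exists>C\<ge>0. \<forall>g. poly_seminorm g \<le> C * cmod (poly (map_poly complex_of_real g) a)"
proof (cases "Im a = 0")
  case True
  define l where "l = [:- Re a, 1:]"
  have "(cmod a)\<^sup>2 = (Re a)\<^sup>2" using True by (simp add: cmod_power2)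
  hence "conj_quadratic a = l * l" unfolding conj_quadratic_def l_def by (simp add: power2_eq_square)
  hence l0: "poly_seminorm l = 0" using null by (simp add: poly_seminorm_mult)
  have "poly_seminorm g \<le> 1 * cmod (poly (map_poly complex_of_real g) a)" for g
  proof -
    have a: "a = of_real (Re a)" using True by (simp add: complex_eq_iff)
    have "poly (map_poly complex_of_real g) a = poly (map_poly complex_of_real g) (of_real (Re a))" using a by simp
    also have "\<dots> = of_real (poly g (Re a))" by (rule of_real_hom.poly_map_poly)
    finally have ev: "cmod (poly (map_poly complex_of_real g) a) = \<bar>poly g (Re a)\<bar>" by simp
    have "poly (g - [:poly g (Re a):]) (Re a) = 0" by simp
    then obtain h where h: "g - [:poly g (Re a):] = l * h" unfolding l_def poly_eq_0_iff_dvd by (elim dvdE)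
    have "poly_seminorm g = poly_seminorm (l * h + [:poly g (Re a):])" by (simp flip: h)
    also have "\<dots> \<le> poly_seminorm (l * h) + poly_seminorm [:poly g (Re a):]" by (rule poly_seminorm_add)
    finally show ?thesis by (simp add: poly_seminorm_mult l0 poly_seminorm_const ev)
  qed
  thus ?thesis by (intro exI[of _ 1]) auto
next
  case False
  define t where "t = poly_seminorm [:0, 1:]"
  have t: "t \<ge> 0" unfolding t_def by (rule poly_seminorm_nonneg)
  \<comment> \<open>a bound for the seminorm of a linear polynomial whose value at \<open>a\<close> has modulus \<open>1\<close>\<close>
  define C where "C = 1 + cmod a / \<bar>Im a\<bar> + t / \<bar>Im a\<bar>"
  have "poly_seminorm g \<le> C * cmod (poly (map_poly complex_of_real g) a)" for g
  proof -
    interpret cr: map_poly_inj_idom_hom complex_of_real ..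
    let ?q = "conj_quadratic a"
    define r where "r = g mod ?q"
    have q0: "?q \<noteq> 0" "degree ?q = 2" by (simp_all add: conj_quadratic_def)
    have "degree r < 2" using degree_mod_less'[of ?q g] q0 by (cases "r = 0") (auto simp: r_def)
    then obtain b c where bc: "r = [:b, c:]"
      by (metis One_nat_def coeff_eq_0 degree_pCons_eq_if less_2_cases_iff pCons_cases degree_eq_zeroE pCons_0_0 Suc_inject nat.distinct(1) degree_0)
    have g: "g = g div ?q * ?q + r" by (simp add: r_def)
    have ev: "poly (map_poly complex_of_real g) a = of_real b + of_real c * a"
    proof -
      have "map_poly complex_of_real g = map_poly complex_of_real (g div ?q) * map_poly complex_of_real ?q + map_poly complex_of_real r"
        by (subst g) (simp only: cr.hom_add cr.hom_mult)
      moreover have "map_poly complex_of_real r = [:of_real b, of_real c:]"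
        by (intro poly_eqI) (simp add: bc coeff_map_poly coeff_pCons split: nat.split)
      ultimately show ?thesis by (simp add: poly_conj_quadratic)
    qed
    let ?z = "of_real b + of_real c * a"
    have "\<bar>Im ?z\<bar> = \<bar>c\<bar> * \<bar>Im a\<bar>" by (simp add: abs_mult)
    hence "\<bar>c\<bar> * \<bar>Im a\<bar> \<le> cmod ?z" using abs_Im_le_cmod[of ?z] by simp
    hence c: "\<bar>c\<bar> \<le> cmod ?z / \<bar>Im a\<bar>" using False by (simp add: pos_le_divide_eq)
    have "\<bar>b\<bar> = cmod (?z - of_real c * a)" by simp
    also have "\<dots> \<le> cmod ?z + cmod (of_real c * a)" by (rule norm_triangle_ineq4)
    also have "cmod (of_real c * a) = \<bar>c\<bar> * cmod a" by (simp add: norm_mult)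
    also have "\<bar>c\<bar> * cmod a \<le> cmod ?z / \<bar>Im a\<bar> * cmod a" using c by (intro mult_right_mono) auto
    finally have b: "\<bar>b\<bar> \<le> cmod ?z + cmod ?z / \<bar>Im a\<bar> * cmod a" by simp
    have r_eq: "r = [:b:] + [:c:] * [:0, 1:]" by (simp add: bc)
    have "poly_seminorm g \<le> poly_seminorm (g div ?q * ?q) + poly_seminorm r"
      using poly_seminorm_add[of "g div ?q * ?q" r] g by simp
    also have "poly_seminorm (g div ?q * ?q) = 0" by (simp add: poly_seminorm_mult null)
    also have "0 + poly_seminorm r \<le> \<bar>b\<bar> + \<bar>c\<bar> * t"
      using poly_seminorm_add[of "[:b:]" "[:c:] * [:0, 1:]"]
      by (simp only: r_eq poly_seminorm_mult poly_seminorm_const t_def)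
    also have "\<dots> \<le> (cmod ?z + cmod ?z / \<bar>Im a\<bar> * cmod a) + cmod ?z / \<bar>Im a\<bar> * t"
      using b c t by (intro add_mono mult_right_mono)
    also have "\<dots> = C * cmod ?z" by (simp add: C_def algebra_simps)
    finally show ?thesis by (simp only: ev)
  qed
  moreover have "C \<ge> 0" using t by (simp add: C_def)
  ultimately show ?thesis by (intro exI[of _ C]) auto
qed

lemma power_bound_imp_le:
  fixes s t C :: real
  assumes "s \<ge> 0" "t \<ge> 0" "\<And>n. s ^ n \<le> C * t ^ n"
  shows "s \<le> t"
proof (rule ccontr)
  assume "\<not> s \<le> t"
  hence st: "t < s" by simp
  have s: "s > 0" using st assms(2) by simp
  define q where "q = (s + t) / (2 * s)"
  have q: "q < 1" "q > 0" "t \<le> q * s" using st s assms(2) by (simp_all add: q_def field_simps)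
  have "1 \<le> C * q ^ n" for n
  proof -
    have C: "C \<ge> 0" using assms(3)[of 0] by simp
    have "s ^ n \<le> C * t ^ n" by (rule assms(3))
    also have "\<dots> \<le> C * (q * s) ^ n" using C q assms(2) by (intro mult_left_mono power_mono) auto
    finally have "s ^ n * 1 \<le> s ^ n * (C * q ^ n)" by (simp add: power_mult_distrib mult_ac)
    thus ?thesis using s by simp
  qed
  moreover have "(\<lambda>n. C * q ^ n) \<longlonglongrightarrow> C * 0" using q by (intro tendsto_mult tendsto_const LIMSEQ_realpow_zero) auto
  ultimately have "1 \<le> C * 0" by (intro LIMSEQ_le_const) auto
  thus False by simp
qed

text \<open>
  The seminorm of \<open>g\<^sup>n\<close> is at most a constant times \<open>cmod (g a)\<^sup>n\<close> for all \<open>n\<close>, so \<open>v\<close> is bounded by the absolute value of the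
  embedding at \<open>a\<close>.  The same bound for inverses gives equality.
\<close>

lemma archimedean_place: "\<exists>a\<in>conjs x. v = emb_place x a"
proof -
  from exists_null_quadratic obtain a where a: "a \<in> conjs x" "poly_seminorm (conj_quadratic a) = 0" by blast
  from poly_seminorm_bound[OF a(2)] obtain C where C: "\<And>g. poly_seminorm g \<le> C * cmod (poly (map_poly complex_of_real g) a)"
    by blast
  have le: "v y \<le> cmod (emb x a y)" if y: "y \<in> Qadj x" for y
  proof (rule power_bound_imp_le)
    show "0 \<le> v y" by (rule av_nonneg[OF y])
    fix n
    from y obtain g where g: "y = qeval g x" by (auto simp: Qadj_def)
    have "v y ^ n = poly_seminorm (map_poly of_rat g ^ n)"
      by (simp add: poly_seminorm_power poly_seminorm_of_rat g)
    also have "\<dots> = poly_seminorm (map_poly of_rat (g ^ n))" by (simp add: map_poly_of_rat)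
    also have "\<dots> \<le> C * cmod (poly (map_poly complex_of_real (map_poly of_rat (g ^ n))) a)" by (rule C)
    also have "map_poly complex_of_real (map_poly of_rat (g ^ n)) = map_poly of_rat (g ^ n)"
      by (intro poly_eqI) (simp add: coeff_map_poly complex_of_real_of_rat)
    also have "poly (map_poly of_rat (g ^ n)) a = qeval g a ^ n" by (simp flip: qeval_def)
    also have "qeval g a = emb x a y" by (simp add: g emb_qeval[OF x a(1)])
    finally show "v y ^ n \<le> C * cmod (emb x a y) ^ n" by (simp add: norm_power)
  qed simp
  have "v y = emb_place x a y" for y
  proof (cases "y \<in> Qadj x")
    case False
    thus ?thesis using av by (auto simp: absolute_value_def emb_place_def extensional_def)
  next
    case y: True
    show ?thesis
    proof (cases "y = 0")
      case True
      thus ?thesis using y by (simp add: emb_place_def emb_0[OF x a(1)] av_eq_0)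
    next
      case False
      have iy: "inverse y \<in> Qadj x" by (rule is_subfieldD(2)[OF is_subfield_Qadj[OF x] y])
      have "v y * v (inverse y) = 1" using av_mult[OF y iy] False av_1 by simp
      moreover have "cmod (emb x a y) * cmod (emb x a (inverse y)) = 1"
        using emb_mult[OF x a(1) y iy] False emb_1[OF x a(1)] by (simp flip: norm_mult)
      moreover have "v y > 0" using av_nonneg[OF y] av_eq_0[OF y] False by simp
      ultimately have "cmod (emb x a y) \<le> v y"
      proof -
        assume 1: "v y * v (inverse y) = 1" and 2: "cmod (emb x a y) * cmod (emb x a (inverse y)) = 1" and 3: "v y > 0"
        have "cmod (emb x a y) * 1 = cmod (emb x a y) * v (inverse y) * v y" using 1 by (simp add: mult_ac)
        also have "\<dots> \<le> cmod (emb x a y) * cmod (emb x a (inverse y)) * v y"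
          using le[OF iy] 3 by (intro mult_right_mono mult_left_mono) auto
        finally show ?thesis using 2 by simp
      qed
      thus ?thesis using le[OF y] y by (simp add: emb_place_def)
    qed
  qed
  hence "v = emb_place x a" by (rule ext)
  thus ?thesis using a(1) by blast
qed

end
end

section \<open>The Weil height of an algebraic integer\<close>

lemma padic_abs_int_le_1:
  assumes "Factorial_Ring.prime p" shows "padic_abs p (of_int k) \<le> 1"
proof -
  have p: "real p \<ge> 1" using prime_ge_1_nat[OF assms] by simp
  have "(real p) powi (- int m) \<le> 1" for m
    using p by (simp add: power_int_minus inverse_le_1_iff one_le_power)
  moreover have "quotient_of (of_int k) = (k, 1)" by (simp add: quotient_of_int)
  ultimately show ?thesis by (simp add: padic_abs_def)
qed

text \<open>
  The distances of a complex number from \<open>0\<close> and from \<open>1\<close> determine it up to complex conjugation; they are the values of the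
  place at \<open>x\<close> and \<open>x - 1\<close>.
\<close>

lemma emb_place_eq_iff:
  assumes x: "algebraic x" and a: "a \<in> conjs x" and b: "b \<in> conjs x"
  shows "emb_place x a = emb_place x b \<longleftrightarrow> b = a \<or> b = cnj a"
proof
  assume eq: "emb_place x a = emb_place x b"
  have 1: "1 \<in> Qadj x" by (rule is_subringD(2)[OF is_subring_Qadj])
  have "x - 1 \<in> Qadj x" by (rule is_subringD(6)[OF is_subring_Qadj Qadj_self 1])
  hence "cmod (a - 1) = cmod (b - 1)"
    using fun_cong[OF eq, of "x - 1"] by (simp add: emb_place_def emb_diff[OF x _ Qadj_self 1] emb_self[OF x] emb_1[OF x] a b)
  hence e1: "(cmod (a - 1))\<^sup>2 = (cmod (b - 1))\<^sup>2" by simp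
  have "cmod a = cmod b" using fun_cong[OF eq, of x] by (simp add: emb_place_def emb_self[OF x] a b)
  hence e0: "(cmod a)\<^sup>2 = (cmod b)\<^sup>2" by simp
  have re: "Re a = Re b" using e0 e1 unfolding cmod_power2 by (simp add: power2_eq_square algebra_simps)
  hence "(Im a)\<^sup>2 = (Im b)\<^sup>2" using e0 by (simp add: cmod_power2)
  hence "Im a = Im b \<or> Im a = - Im b" by (simp add: power2_eq_iff)
  thus "b = a \<or> b = cnj a" using re by (auto simp: complex_eq_iff)
next
  assume "b = a \<or> b = cnj a"
  thus "emb_place x a = emb_place x b"
  proof
    assume "b = cnj a"
    thus ?thesis unfolding emb_place_def by (intro restrict_ext) (simp add: emb_cnj[OF x a])
  qed simp
qed

text \<open>
  Nonarchimedean places have values at most \<open>1\<close> at an algebraic integer.  An archimedean place comes from one real conjugate or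
  from two complex conjugates, and its local degree is \<open>1\<close> or \<open>2\<close> accordingly, so the sum over places weighted by local
  degrees is the sum over conjugates.
\<close>

theorem log_weil_height_algebraic_int:
  assumes "algebraic_int x"
  shows "log_weil_height x = (\<Sum>a\<in>conjs x. ln (max 1 (cmod a))) / real (deg x)"
proof -
  have x: "algebraic x" by (rule algebraic_int_imp_algebraic[OF assms])
  let ?K = "Qadj x"
  define A where "A = {a\<in>conjs x. max 1 (cmod a) \<noteq> 1}"
  have finA: "finite A" unfolding A_def using finite_conjs[OF x] by simp
  have AC: "a \<in> conjs x" if "a \<in> A" for a using that by (simp add: A_def)
  have val: "emb_place x a x = cmod a" if "a \<in> conjs x" for a
    using that by (simp add: emb_place_def emb_self[OF x])
  have V: "{v. v \<in> places ?K \<and> max 1 (v x) \<noteq> 1} = emb_place x ` A"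
  proof (intro equalityI subsetI)
    fix v assume "v \<in> {v. v \<in> places ?K \<and> max 1 (v x) \<noteq> 1}"
    hence v: "v \<in> places ?K" "v x > 1" by auto
    hence av: "absolute_value ?K v" by (simp add: places_def)
    have "\<forall>q. v (of_rat q) = \<bar>real_of_rat q\<bar>"
    proof (rule ccontr)
      assume "\<not> ?thesis"
      then obtain p where p: "Factorial_Ring.prime p" "\<And>q. v (of_rat q) = padic_abs p q"
        using v(1) unfolding places_def by blast
      have "v (of_int k) \<le> 1" for k
        using p(2)[of "of_int k"] padic_abs_int_le_1[OF p(1), of k] by simp
      from av_algebraic_int_le_1[OF x av this Qadj_self assms] v(2) show False by simp
    qed
    hence "\<And>q. v (of_rat q) = \<bar>real_of_rat q\<bar>" by blast
    from archimedean_place[OF x av this] obtain a where a: "a \<in> conjs x" "v = emb_place x a" by blast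
    hence "a \<in> A" using v(2) val[OF a(1)] by (simp add: A_def)
    thus "v \<in> emb_place x ` A" using a(2) by blast
  next
    fix v assume "v \<in> emb_place x ` A"
    then obtain a where a: "a \<in> A" "v = emb_place x a" by blast
    have "max 1 (v x) \<noteq> 1" using a(1) val[OF AC[OF a(1)]] by (simp add: a(2) A_def)
    thus "v \<in> {v. v \<in> places ?K \<and> max 1 (v x) \<noteq> 1}"
      using emb_place_in_places[OF x AC[OF a(1)]] a(2) by blast
  qed
  have fibre: "(\<Sum>b | b \<in> A \<and> emb_place x b = emb_place x a. ln (max 1 (cmod b))) =
      real (local_degree ?K (emb_place x a)) * ln (max 1 (emb_place x a x))" if a: "a \<in> A" for a
  proof -
    note ac = AC[OF a]
    have "{b. b \<in> A \<and> emb_place x b = emb_place x a} = {a, cnj a}"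
    proof (intro equalityI subsetI)
      fix b assume "b \<in> {b. b \<in> A \<and> emb_place x b = emb_place x a}"
      thus "b \<in> {a, cnj a}" using emb_place_eq_iff[OF x ac AC, of b] by auto
    next
      fix b assume "b \<in> {a, cnj a}"
      moreover have "cnj a \<in> A" using a cnj_conjs[OF ac] by (simp add: A_def)
      ultimately show "b \<in> {b. b \<in> A \<and> emb_place x b = emb_place x a}"
        using a emb_place_eq_iff[OF x ac AC, of b] by auto
    qed
    moreover have "(a \<in> \<real>) = (cnj a = a)" by (rule Reals_cnj_iff)
    ultimately show ?thesis by (simp add: local_degree_emb_place[OF x ac] val[OF ac])
  qed
  have "weil_height x = (\<Prod>v\<in>emb_place x ` A. max 1 (v x) powr (real (local_degree ?K v) / real (deg x)))"
    unfolding weil_height_def weil_height_in_def generate_field_eq_Qadj[OF x] V field_degree_Qadj[OF x] ..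
  also have "ln \<dots> = (\<Sum>v\<in>emb_place x ` A. ln (max 1 (v x) powr (real (local_degree ?K v) / real (deg x))))"
    by (rule ln_prod) (use finA in auto)
  also have "\<dots> = (\<Sum>v\<in>emb_place x ` A. real (local_degree ?K v) * ln (max 1 (v x)) / real (deg x))"
    by (intro sum.cong) (auto simp: ln_powr)
  also have "\<dots> = (\<Sum>v\<in>emb_place x ` A. real (local_degree ?K v) * ln (max 1 (v x))) / real (deg x)"
    by (simp add: sum_divide_distrib)
  also have "(\<Sum>v\<in>emb_place x ` A. real (local_degree ?K v) * ln (max 1 (v x))) =
      (\<Sum>v\<in>emb_place x ` A. \<Sum>b | b \<in> A \<and> emb_place x b = v. ln (max 1 (cmod b)))"
    by (intro sum.cong) (auto simp: fibre)
  also have "\<dots> = (\<Sum>b\<in>A. ln (max 1 (cmod b)))" by (rule sum.image_gen[OF finA, symmetric])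
  also have "\<dots> = (\<Sum>b\<in>conjs x. ln (max 1 (cmod b)))"
    unfolding A_def using finite_conjs[OF x] by (intro sum.mono_neutral_left) auto
  finally show ?thesis by (simp add: log_weil_height_def)
qed

section \<open>Heights and embeddings\<close>

text \<open>
  The embeddings of a larger field take \<open>y\<close> equally often to each of its conjugates, so the height is also the average over
  these embeddings.
\<close>

lemma sum_ln_over_embeddings:
  assumes z: "algebraic z" and y: "y \<in> Qadj z" "algebraic_int y"
  shows "(\<Sum>a\<in>conjs z. ln (max 1 (cmod (emb z a y)))) = real (deg z) * log_weil_height y"
proof -
  note alg = algebraic_int_imp_algebraic[OF y(2)]
  from prod_over_embeddings(2)[OF z y(1)] obtain k where k: "deg z = deg y * k" by (rule dvdE)
  have pos: "(\<Prod>b\<in>conjs y. max 1 (cmod b)) > 0" by (intro prod_pos) auto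
  have "(\<Sum>a\<in>conjs z. ln (max 1 (cmod (emb z a y)))) = ln (\<Prod>a\<in>conjs z. max 1 (cmod (emb z a y)))"
    by (rule ln_prod[symmetric]) (use finite_conjs[OF z] in auto)
  also have "(\<Prod>a\<in>conjs z. max 1 (cmod (emb z a y))) = (\<Prod>b\<in>conjs y. max 1 (cmod b)) ^ (deg z div deg y)"
    by (rule prod_over_embeddings(1)[OF z y(1), of "\<lambda>b. max 1 (cmod b)"])
  also have "ln \<dots> = real (deg z div deg y) * ln (\<Prod>b\<in>conjs y. max 1 (cmod b))" by (simp add: ln_realpow pos)
  also have "ln (\<Prod>b\<in>conjs y. max 1 (cmod b)) = (\<Sum>b\<in>conjs y. ln (max 1 (cmod b)))"
    by (rule ln_prod) (use finite_conjs[OF alg] in auto)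
  also have "\<dots> = real (deg y) * log_weil_height y"
    using deg_pos[OF alg] by (simp add: log_weil_height_algebraic_int[OF y(2)])
  also have "real (deg z div deg y) * (real (deg y) * log_weil_height y) = real (deg z) * log_weil_height y"
    using deg_pos[OF alg] by (simp add: k)
  finally show ?thesis .
qed

lemma log_weil_height_nonneg: "algebraic_int y \<Longrightarrow> 0 \<le> log_weil_height y"
  unfolding log_weil_height_algebraic_int by (intro divide_nonneg_nonneg sum_nonneg) auto

lemma qeval_in_subring:
  assumes S: "is_subring S" "\<rat> \<subseteq> S" and y: "y \<in> S"
  shows "qeval g y \<in> S"
  unfolding qeval_altdef using S(2) y
  by (intro is_subring_sum[OF S(1)] is_subringD(5)[OF S(1)] is_subring_power[OF S(1)]) auto

text \<open>
  The inverse of an algebraic number is a polynomial expression in the number.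
\<close>

lemma is_subfield_of_algebraic:
  assumes S: "is_subring S" "\<rat> \<subseteq> S" and alg: "\<And>y. y \<in> S \<Longrightarrow> algebraic y"
  shows "is_subfield S"
  unfolding is_subfield_def
proof (intro conjI ballI)
  fix y assume y: "y \<in> S"
  from inverse_in_Qadj[OF alg[OF y]] obtain g where "inverse y = qeval g y" by (auto simp: Qadj_def)
  thus "inverse y \<in> S" using qeval_in_subring[OF S y] by simp
qed (rule S(1))

lemma comm_ring_hom_qeval: "comm_ring_hom (\<lambda>g. qeval g a)"
  by unfold_locales auto

text \<open>
  A matrix over a simple extension lifts to rational polynomials, so determinants and characteristic
  polynomials commute with embeddings, although these are homomorphisms on a subfield only.
\<close>

lemma
  assumes f: "algebraic f" and \<tau>: "\<tau> \<in> conjs f" and A: "A \<in> carrier_mat n n"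
    and mem: "\<forall>i<n. \<forall>j<n. A $$ (i, j) \<in> Qadj f"
  shows emb_det: "emb f \<tau> (det A) = det (map_mat (emb f \<tau>) A)"
    and emb_char_poly: "emb f \<tau> (coeff (char_poly A) k) = coeff (char_poly (map_mat (emb f \<tau>) A)) k"
    and char_poly_coeff_Qadj: "coeff (char_poly A) k \<in> Qadj f"
    and det_Qadj: "det A \<in> Qadj f"
proof -
  have "\<forall>i j. \<exists>g. i < n \<longrightarrow> j < n \<longrightarrow> A $$ (i, j) = qeval g f"
    using mem by (auto simp: Qadj_def)
  hence "\<forall>p. \<exists>g. case p of (i, j) \<Rightarrow> i < n \<longrightarrow> j < n \<longrightarrow> A $$ (i, j) = qeval g f" by auto
  from choice[OF this] obtain g where g: "\<forall>p. case p of (i, j) \<Rightarrow> i < n \<longrightarrow> j < n \<longrightarrow> A $$ (i, j) = qeval (g p) f"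
    by (rule exE)
  define G where "G = mat n n g"
  have G: "G \<in> carrier_mat n n" by (simp add: G_def)
  have AG: "A = map_mat (\<lambda>h. qeval h f) G" using A g by (intro eq_matI) (auto simp: G_def)
  have A\<tau>: "map_mat (emb f \<tau>) A = map_mat (\<lambda>h. qeval h \<tau>) G"
    unfolding AG using G by (intro eq_matI) (auto simp: emb_qeval[OF f \<tau>])
  interpret hf: comm_ring_hom "\<lambda>h. qeval h f" by (rule comm_ring_hom_qeval)
  interpret h\<tau>: comm_ring_hom "\<lambda>h. qeval h \<tau>" by (rule comm_ring_hom_qeval)
  have det: "det A = qeval (det G) f" unfolding AG by (rule hf.hom_det)
  show "det A \<in> Qadj f" by (simp add: det)
  have "det (map_mat (emb f \<tau>) A) = qeval (det G) \<tau>" unfolding A\<tau> by (rule h\<tau>.hom_det)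
  thus "emb f \<tau> (det A) = det (map_mat (emb f \<tau>) A)" by (simp add: det emb_qeval[OF f \<tau>])
  have cp: "coeff (char_poly A) k = qeval (coeff (char_poly G) k) f"
    unfolding AG hf.char_poly_hom[OF G] by (rule hf.coeff_map_poly_hom)
  show "coeff (char_poly A) k \<in> Qadj f" by (simp add: cp)
  have "coeff (char_poly (map_mat (emb f \<tau>) A)) k = qeval (coeff (char_poly G) k) \<tau>"
    unfolding A\<tau> h\<tau>.char_poly_hom[OF G] by (rule h\<tau>.coeff_map_poly_hom)
  thus "emb f \<tau> (coeff (char_poly A) k) = coeff (char_poly (map_mat (emb f \<tau>) A)) k"
    by (simp add: cp emb_qeval[OF f \<tau>])
qed

text \<open>
  Each of the \<open>n!\<close> summands of the Leibniz formula contains one entry per row, and an entry in row \<open>i\<close> is at most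
  \<open>max 1 \<bar>e\<^sub>i\<bar>\<^sup>n\<^sup>-\<^sup>1\<close> in modulus.
\<close>

lemma det_powers_bound:
  fixes e :: "nat \<Rightarrow> complex"
  shows "cmod (det (mat n n (\<lambda>(i, k). e i ^ k))) \<le> fact n * (\<Prod>i<n. max 1 (cmod (e i))) ^ (n - 1)"
proof -
  let ?V = "mat n n (\<lambda>(i, k). e i ^ k)" and ?P = "{p. p permutes {0..<n}}"
  have V: "?V \<in> carrier_mat n n" by simp
  have "cmod (det ?V) \<le> (\<Sum>p\<in>?P. cmod (signof p * (\<Prod>i = 0..<n. ?V $$ (i, p i))))"
    unfolding det_def'[OF V] by (rule norm_sum)
  also have "\<dots> \<le> (\<Sum>p\<in>?P. (\<Prod>i<n. max 1 (cmod (e i))) ^ (n - 1))"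
  proof (rule sum_mono)
    fix p assume "p \<in> ?P"
    hence p: "p permutes {0..<n}" by simp
    have "cmod (signof p * (\<Prod>i = 0..<n. ?V $$ (i, p i))) = (\<Prod>i = 0..<n. cmod (?V $$ (i, p i)))"
      by (simp add: norm_mult prod_norm sign_def)
    also have "\<dots> \<le> (\<Prod>i = 0..<n. max 1 (cmod (e i)) ^ (n - 1))"
    proof (rule prod_mono)
      fix i assume i: "i \<in> {0..<n}"
      hence pi: "p i < n" using permutes_in_image[OF p, of i] by simp
      have "cmod (?V $$ (i, p i)) = cmod (e i) ^ p i" using i pi by (simp add: norm_power)
      also have "\<dots> \<le> max 1 (cmod (e i)) ^ p i" by (intro power_mono) auto
      also have "\<dots> \<le> max 1 (cmod (e i)) ^ (n - 1)" using pi by (intro power_increasing) auto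
      finally show "0 \<le> cmod (?V $$ (i, p i)) \<and> cmod (?V $$ (i, p i)) \<le> max 1 (cmod (e i)) ^ (n - 1)" by simp
    qed
    finally show "cmod (signof p * (\<Prod>i = 0..<n. ?V $$ (i, p i))) \<le> (\<Prod>i<n. max 1 (cmod (e i))) ^ (n - 1)"
      by (simp add: prod_power_distrib lessThan_atLeast0)
  qed
  also have "\<dots> = fact n * (\<Prod>i<n. max 1 (cmod (e i))) ^ (n - 1)"
    by (simp add: card_permutations)
  finally show ?thesis .
qed

section \<open>One step of the tower\<close>

text \<open>
  The situation of one step of the tower: \<open>S\<close> is the field and \<open>T\<close> the ring reached so far, and the number field \<open>Qadj x\<close>
  with integral basis \<open>\<omega>\<close> is adjoined.
\<close>

locale disjoint_step =
  fixes S T :: "complex set" and x :: complex and \<omega> :: "nat \<Rightarrow> complex"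
  assumes S: "is_subfield S" and S_alg: "\<And>y. y \<in> S \<Longrightarrow> algebraic y"
    and T: "is_subring T" and TS: "T \<subseteq> S" and T_int: "\<And>y. y \<in> T \<Longrightarrow> algebraic_int y"
    and x: "algebraic x" and ib: "int_basis x \<omega>"
    and indep: "\<And>c j. (\<And>j. j < deg x \<Longrightarrow> c j \<in> S) \<Longrightarrow> (\<Sum>j<deg x. c j * \<omega> j) = 0 \<Longrightarrow> j < deg x \<Longrightarrow> c j = 0"
begin

abbreviation (input) "d \<equiv> deg x"

definition span_of :: "complex set \<Rightarrow> complex set" where
  "span_of A = {\<Sum>j<d. c j * \<omega> j | c. \<forall>j<d. c j \<in> A}"

lemma omega: "\<omega> 0 = 1" "j < d \<Longrightarrow> \<omega> j \<in> Qadj x" "j < d \<Longrightarrow> algebraic_int (\<omega> j)" "det (emb_mat x \<omega>) \<noteq> 0"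
  using ib by (auto simp: int_basis_def)

lemma int_coords: "y \<in> Qadj x \<Longrightarrow> algebraic_int y \<Longrightarrow> \<exists>c::nat \<Rightarrow> int. y = (\<Sum>j<d. of_int (c j) * \<omega> j)"
  using ib by (auto simp: int_basis_def)

lemma dpos: "d > 0" by (rule deg_pos[OF x])

lemma span_ofE:
  assumes "y \<in> span_of A"
  obtains c where "y = (\<Sum>j<d. c j * \<omega> j)" "\<forall>j<d. c j \<in> A"
  using assms unfolding span_of_def by blast

lemma span_ofI: "(\<And>j. j < d \<Longrightarrow> c j \<in> A) \<Longrightarrow> (\<Sum>j<d. c j * \<omega> j) \<in> span_of A"
  unfolding span_of_def by blast

lemma span_of_scalar: assumes "y \<in> A" "0 \<in> A" shows "y \<in> span_of A"
proof -
  have "(\<Sum>j<d. (if j = 0 then y else 0) * \<omega> j) = (\<Sum>j<d. if j = 0 then y else 0)"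
    by (intro sum.cong) (auto simp: omega(1))
  also have "\<dots> = y" using dpos by simp
  finally show ?thesis using span_ofI[of "\<lambda>j. if j = 0 then y else 0" A] assms by simp
qed

lemma span_of_add:
  assumes A: "is_subring A" and "y \<in> span_of A" "z \<in> span_of A"
  shows "y + z \<in> span_of A"
proof -
  from assms(2) obtain c where c: "y = (\<Sum>j<d. c j * \<omega> j)" "\<forall>j<d. c j \<in> A" by (rule span_ofE)
  from assms(3) obtain c' where c': "z = (\<Sum>j<d. c' j * \<omega> j)" "\<forall>j<d. c' j \<in> A" by (rule span_ofE)
  have "y + z = (\<Sum>j<d. (c j + c' j) * \<omega> j)" by (simp add: c c' sum.distrib distrib_right)
  also have "\<dots> \<in> span_of A" using c c' by (intro span_ofI is_subringD[OF A]) auto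
  finally show ?thesis .
qed

lemma span_of_smult:
  assumes A: "is_subring A" and "y \<in> span_of A" "a \<in> A"
  shows "a * y \<in> span_of A"
proof -
  from assms(2) obtain c where c: "y = (\<Sum>j<d. c j * \<omega> j)" "\<forall>j<d. c j \<in> A" by (rule span_ofE)
  have "a * y = (\<Sum>j<d. (a * c j) * \<omega> j)" by (simp add: c sum_distrib_left mult.assoc)
  also have "\<dots> \<in> span_of A" using c assms(3) by (intro span_ofI is_subringD[OF A]) auto
  finally show ?thesis .
qed

lemma span_of_sum:
  assumes A: "is_subring A" and "\<And>i. i \<in> I \<Longrightarrow> f i \<in> span_of A"
  shows "sum f I \<in> span_of A"
  using assms(2)
  by (induction I rule: infinite_finite_induct)
    (auto intro: span_of_add[OF A] span_of_scalar is_subringD[OF A])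

lemma integer_in_span_of:
  assumes A: "is_subring A" and y: "y \<in> Qadj x" "algebraic_int y"
  shows "y \<in> span_of A"
proof -
  from int_coords[OF y] obtain c :: "nat \<Rightarrow> int" where "y = (\<Sum>j<d. of_int (c j) * \<omega> j)" by blast
  thus ?thesis using span_ofI[of "\<lambda>j. of_int (c j)" A] is_subring_of_int[OF A] by simp
qed

text \<open>
  The products \<open>\<omega>\<^sub>i \<omega>\<^sub>j\<close> are algebraic integers of the number field and have integral coordinates.
\<close>

lemma is_subring_span_of:
  assumes A: "is_subring A" shows "is_subring (span_of A)"
proof -
  have "y * z \<in> span_of A" if y: "y \<in> span_of A" and z: "z \<in> span_of A" for y z
  proof -
    from y obtain c where c: "y = (\<Sum>j<d. c j * \<omega> j)" "\<forall>j<d. c j \<in> A" by (rule span_ofE)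
    from z obtain c' where c': "z = (\<Sum>j<d. c' j * \<omega> j)" "\<forall>j<d. c' j \<in> A" by (rule span_ofE)
    have "y * z = (\<Sum>i<d. \<Sum>j<d. (c i * c' j) * (\<omega> i * \<omega> j))"
      unfolding c(1) c'(1) sum_product by (intro sum.cong refl) (simp add: algebra_simps)
    also have "\<dots> \<in> span_of A"
    proof (rule span_of_sum[OF A], rule span_of_sum[OF A])
      fix i j assume "i \<in> {..<d}" "j \<in> {..<d}"
      hence i: "i < d" and j: "j < d" by auto
      have "\<omega> i * \<omega> j \<in> span_of A"
        by (intro integer_in_span_of[OF A] is_subringD(5)[OF is_subring_Qadj] algebraic_int_mult omega i j)
      moreover have "c i * c' j \<in> A" using c(2) c'(2) i j by (intro is_subringD(5)[OF A]) auto
      ultimately show "(c i * c' j) * (\<omega> i * \<omega> j) \<in> span_of A" by (rule span_of_smult[OF A])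
    qed
    finally show ?thesis .
  qed
  moreover have "- y \<in> span_of A" if "y \<in> span_of A" for y
    using span_of_smult[OF A that is_subringD(3)[OF A is_subringD(2)[OF A]]] by simp
  ultimately show ?thesis
    unfolding is_subring_def using span_of_scalar[of _ A] is_subringD[OF A] span_of_add[OF A] by auto
qed

lemma omega_in_span_of: "is_subring A \<Longrightarrow> j < d \<Longrightarrow> \<omega> j \<in> span_of A"
  using integer_in_span_of omega(2,3) by blast

lemma span_of_T_algebraic_int: "y \<in> span_of T \<Longrightarrow> algebraic_int y"
proof -
  assume "y \<in> span_of T"
  then obtain c where c: "y = (\<Sum>j<d. c j * \<omega> j)" "\<forall>j<d. c j \<in> T" by (rule span_ofE)
  have "y \<in> {z. algebraic_int z}" unfolding c(1)
    using c(2) T_int omega(3)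
    by (intro is_subring_sum[OF is_subring_algebraic_int] is_subringD(5)[OF is_subring_algebraic_int]) auto
  thus ?thesis by simp
qed

text \<open>
  By independence the coordinates are unique, and an element of \<open>S\<close> is its own coordinate at \<open>\<omega>\<^sub>0 = 1\<close>.
\<close>

lemma span_of_T_inter_S:
  assumes "y \<in> span_of T" "y \<in> S" shows "y \<in> T"
proof -
  from assms(1) obtain c where c: "y = (\<Sum>j<d. c j * \<omega> j)" "\<forall>j<d. c j \<in> T" by (rule span_ofE)
  define c' where "c' j = c j - (if j = 0 then y else 0)" for j
  have "(\<Sum>j<d. c' j * \<omega> j) = (\<Sum>j<d. c j * \<omega> j - (if j = 0 then y else 0))"
    by (intro sum.cong) (auto simp: c'_def omega(1) algebra_simps)
  also have "\<dots> = 0" using dpos by (simp add: sum_subtractf c(1)[symmetric])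
  finally have sum0: "(\<Sum>j<d. c' j * \<omega> j) = 0" .
  have "c' j \<in> S" if "j < d" for j
    using c(2) TS assms(2) that is_subringD[OF is_subfieldD(1)[OF S]] by (auto simp: c'_def)
  hence "c' 0 = 0" by (rule indep[OF _ sum0 dpos])
  hence "y = c 0" by (simp add: c'_def)
  thus ?thesis using c(2) dpos by simp
qed

lemma qindep_omega: "qindep d \<omega>"
  by (rule qindep_of_emb_mat[OF x omega(2,4)])

text \<open>
  By disjointness the compositum of \<open>Qadj x\<close> with a number field \<open>Qadj f\<close> inside \<open>S\<close> has the product of
  the degrees as its degree, so every pair of embeddings of the two fields extends to it.
\<close>

lemma compositum:
  assumes f: "f \<in> S"
  shows "\<exists>z. algebraic z \<and> deg z = deg f * d \<and> f \<in> Qadj z \<and> x \<in> Qadj z \<and>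
    bij_betw (\<lambda>\<rho>. (emb z \<rho> f, emb z \<rho> x)) (conjs z) (conjs f \<times> conjs x)"
proof -
  note fa = S_alg[OF f]
  have al: "algebraic a" if "a \<in> {f, x}" for a using that fa x by auto
  have fin: "finite {f, x}" by simp
  have "\<exists>z. algebraic z \<and> {f, x} \<subseteq> Qadj z \<and> (\<forall>U. is_subfield U \<longrightarrow> {f, x} \<subseteq> U \<longrightarrow> z \<in> U)"
    by (rule primitive_element[OF fin]) (rule al)
  then obtain z where z: "algebraic z" "{f, x} \<subseteq> Qadj z"
    "\<forall>U. is_subfield U \<longrightarrow> {f, x} \<subseteq> U \<longrightarrow> z \<in> U" by (elim exE conjE)
  let ?F = "Qadj f"
  have F: "is_subring ?F" by (rule is_subring_Qadj)
  have FS: "?F \<subseteq> S" by (rule Qadj_subset[OF S f])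
  have Fz: "?F \<subseteq> Qadj z" and xz: "Qadj x \<subseteq> Qadj z" using z(2) by (auto intro: Qadj_mono[THEN subsetD])
  have ratF: "\<rat> \<subseteq> ?F" using is_subfieldD(4)[OF is_subfield_Qadj[OF fa]] by (auto elim: Rats_cases)
  have sub: "span_of ?F \<subseteq> Qadj z"
  proof
    fix y assume "y \<in> span_of ?F"
    then obtain c where "y = (\<Sum>j<d. c j * \<omega> j)" "\<forall>j<d. c j \<in> ?F" by (rule span_ofE)
    moreover have "c j * \<omega> j \<in> Qadj z" if "j < d" for j
      using calculation(2) that Fz xz omega(2)[OF that] by (intro is_subringD(5)[OF is_subring_Qadj]) auto
    ultimately show "y \<in> Qadj z" by (auto intro!: is_subring_sum[OF is_subring_Qadj])
  qed
  have "\<rat> \<subseteq> span_of ?F" using ratF span_of_scalar[of _ ?F] is_subringD(1)[OF F] by auto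
  hence sf: "is_subfield (span_of ?F)"
    using sub Qadj_algebraic[OF z(1)] by (intro is_subfield_of_algebraic is_subring_span_of[OF F]) auto
  have fmem: "f \<in> span_of ?F" using span_of_scalar[of f ?F] is_subringD(1)[OF F] by simp
  have xmem: "x \<in> span_of ?F"
  proof -
    have "Qadj x = qspan d \<omega>" by (rule spanning_of_qindep[OF x qindep_omega omega(2)])
    then obtain q where "x = (\<Sum>j<d. of_rat (q j) * \<omega> j)" using Qadj_self[of x] by (auto simp: qspan_def)
    moreover have "of_rat (q j) \<in> ?F" for j using ratF by auto
    ultimately show ?thesis using span_ofI[of "\<lambda>j. of_rat (q j)" ?F] by simp
  qed
  have zmem: "z \<in> span_of ?F" using z(3)[rule_format, OF sf] fmem xmem by simp
  have span: "Qadj z = span_of ?F" using sub Qadj_subset[OF sf zmem] by blast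
  let ?m = "deg f"
  \<comment> \<open>the products of the powers of \<open>f\<close> with \<open>\<omega>\<close>, numbered by \<open>k = i * d + j\<close>\<close>
  define \<beta> where "\<beta> k = f ^ (k div d) * \<omega> (k mod d)" for k
  have reindex: "(\<Sum>k<?m * d. h (k div d) (k mod d)) = (\<Sum>j<d. \<Sum>i<?m. h i j)" for h :: "nat \<Rightarrow> nat \<Rightarrow> complex"
  proof -
    have bnd: "i * d + j < ?m * d" if "i < ?m" "j < d" for i j
    proof -
      have "i * d + j < i * d + d" using that by simp
      also have "\<dots> = Suc i * d" by simp
      also have "\<dots> \<le> ?m * d" using that by (intro mult_le_mono1) simp
      finally show ?thesis .
    qed
    have "(\<Sum>k<?m * d. h (k div d) (k mod d)) = (\<Sum>(i, j)\<in>{..<?m} \<times> {..<d}. h i j)"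
      using dpos bnd
      by (intro sum.reindex_bij_witness[of _ "\<lambda>(i, j). i * d + j" "\<lambda>k. (k div d, k mod d)"])
        (auto simp: less_mult_imp_div_less)
    also have "\<dots> = (\<Sum>i<?m. \<Sum>j<d. h i j)" by (simp add: sum.cartesian_product)
    finally show ?thesis by (subst sum.swap)
  qed
  have \<beta>mem: "\<beta> k \<in> Qadj z" if "k < ?m * d" for k
    unfolding \<beta>_def using z(2) xz omega(2) dpos
    by (intro is_subringD(5)[OF is_subring_Qadj] is_subring_power[OF is_subring_Qadj]) auto
  have "deg z \<le> ?m * d"
  proof (rule deg_le_of_spanning[OF z(1), of _ \<beta>], rule subsetI)
    fix y assume "y \<in> Qadj z"
    hence "y \<in> span_of ?F" by (simp add: span)
    then obtain c where c: "y = (\<Sum>j<d. c j * \<omega> j)" "\<forall>j<d. c j \<in> ?F" by (rule span_ofE)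
    have "\<forall>j. \<exists>q. j < d \<longrightarrow> c j = (\<Sum>i<?m. of_rat (q i) * f ^ i)"
    proof
      fix j
      show "\<exists>q. j < d \<longrightarrow> c j = (\<Sum>i<?m. of_rat (q i) * f ^ i)"
        using c(2) Qadj_eq_qspan_powers[OF fa] by (cases "j < d") (auto simp: qspan_def)
    qed
    from choice[OF this] obtain q where q: "\<forall>j. j < d \<longrightarrow> c j = (\<Sum>i<?m. of_rat (q j i) * f ^ i)" by (rule exE)
    have "y = (\<Sum>j<d. \<Sum>i<?m. of_rat (q j i) * (f ^ i * \<omega> j))"
      unfolding c(1) using q by (intro sum.cong) (auto simp: sum_distrib_right mult.assoc)
    also have "\<dots> = (\<Sum>k<?m * d. of_rat (q (k mod d) (k div d)) * \<beta> k)"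
      unfolding \<beta>_def by (rule reindex[symmetric, of "\<lambda>i j. of_rat (q j i) * (f ^ i * \<omega> j)"])
    finally show "y \<in> qspan (?m * d) \<beta>" using qspan_memI[of "\<lambda>k. q (k mod d) (k div d)" \<beta>] by simp
  qed
  moreover have "?m * d \<le> deg z"
  proof (rule qindep_le_deg[OF z(1) _ \<beta>mem])
    show "qindep (?m * d) \<beta>"
      unfolding qindep_def
    proof (intro allI impI)
      fix q k assume eq: "(\<Sum>k<?m * d. of_rat (q k) * \<beta> k) = 0" and k: "k < ?m * d"
      define r where "r i j = q (i * d + j)" for i j
      have qr: "q k = r (k div d) (k mod d)" for k by (simp add: r_def)
      define c where "c j = (\<Sum>i<?m. of_rat (r i j) * f ^ i)" for j
      have "0 = (\<Sum>k<?m * d. of_rat (r (k div d) (k mod d)) * (f ^ (k div d) * \<omega> (k mod d)))"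
        using eq unfolding qr \<beta>_def by simp
      also have "\<dots> = (\<Sum>j<d. \<Sum>i<?m. of_rat (r i j) * (f ^ i * \<omega> j))" by (rule reindex)
      also have "\<dots> = (\<Sum>j<d. c j * \<omega> j)" by (simp add: c_def sum_distrib_right mult.assoc)
      finally have sum0: "(\<Sum>j<d. c j * \<omega> j) = 0" by simp
      have "c j \<in> S" for j
        using FS ratF unfolding c_def
        by (intro subsetD[OF FS] is_subring_sum[OF F] is_subringD(5)[OF F] is_subring_power[OF F] Qadj_self) auto
      hence "c (k mod d) = 0" using indep[OF _ sum0] dpos by simp
      moreover have "k div d < ?m" using k by (simp add: less_mult_imp_div_less)
      ultimately show "q k = 0"
        using qindepD[OF qindep_powers[OF fa], of "\<lambda>i. r i (k mod d)" "k div d"] by (simp add: c_def qr)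
    qed
  qed
  ultimately have deg: "deg z = ?m * d" by simp
  let ?e = "\<lambda>\<rho>. (emb z \<rho> f, emb z \<rho> x)"
  have fz: "f \<in> Qadj z" and xz': "x \<in> Qadj z" using z(2) by auto
  have img: "?e ` conjs z \<subseteq> conjs f \<times> conjs x"
    using emb_in_conjs[OF z(1) _ fz] emb_in_conjs[OF z(1) _ xz'] by auto
  have inj: "inj_on ?e (conjs z)"
  proof (rule inj_onI)
    fix \<rho> \<rho>' assume \<rho>: "\<rho> \<in> conjs z" "\<rho>' \<in> conjs z" "?e \<rho> = ?e \<rho>'"
    from zmem obtain c where c: "z = (\<Sum>j<d. c j * \<omega> j)" "\<forall>j<d. c j \<in> ?F" by (rule span_ofE)
    have "emb z \<sigma> z = (\<Sum>j<d. emb z \<sigma> (c j) * emb z \<sigma> (\<omega> j))" if \<sigma>: "\<sigma> \<in> conjs z" for \<sigma>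
    proof -
      have m: "c j \<in> Qadj z" "\<omega> j \<in> Qadj z" if "j < d" for j using that c(2) omega(2) Fz xz by auto
      have "emb z \<sigma> (\<Sum>j<d. c j * \<omega> j) = (\<Sum>j<d. emb z \<sigma> (c j * \<omega> j))"
        using m by (intro emb_sum[OF z(1) \<sigma>] is_subringD(5)[OF is_subring_Qadj]) auto
      also have "\<dots> = (\<Sum>j<d. emb z \<sigma> (c j) * emb z \<sigma> (\<omega> j))"
        using m by (intro sum.cong) (auto simp: emb_mult[OF z(1) \<sigma>])
      finally show ?thesis by (simp flip: c(1))
    qed
    moreover have "emb z \<rho> (c j) = emb z \<rho>' (c j)" "emb z \<rho> (\<omega> j) = emb z \<rho>' (\<omega> j)" if j: "j < d" for j
    proof -
      from c(2) j obtain g where "c j = qeval g f" by (auto simp: Qadj_def)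
      thus "emb z \<rho> (c j) = emb z \<rho>' (c j)" using \<rho> fz by (simp add: emb_qeval_comp[OF z(1)])
      from omega(2)[OF j] obtain h where "\<omega> j = qeval h x" by (auto simp: Qadj_def)
      thus "emb z \<rho> (\<omega> j) = emb z \<rho>' (\<omega> j)" using \<rho> xz' by (simp add: emb_qeval_comp[OF z(1)])
    qed
    ultimately have "emb z \<rho> z = emb z \<rho>' z" using \<rho>(1,2) by simp
    thus "\<rho> = \<rho>'" using \<rho>(1,2) by (simp add: emb_self[OF z(1)])
  qed
  have "card (conjs f \<times> conjs x) = card (conjs z)"
    by (simp add: card_cartesian_product card_conjs[OF fa] card_conjs[OF x] card_conjs[OF z(1)] deg)
  hence "?e ` conjs z = conjs f \<times> conjs x"
    using img inj by (intro card_subset_eq) (auto simp: finite_conjs[OF fa] finite_conjs[OF x] card_image)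
  hence "bij_betw ?e (conjs z) (conjs f \<times> conjs x)" using inj by (simp add: bij_betw_def)
  thus ?thesis using z(1) deg fz xz' by (intro exI[of _ z] conjI)
qed

text \<open>
  Here \<open>e \<tau> i\<close> is the value at \<open>\<alpha>\<close> of the embedding of the compositum that extends \<open>\<tau>\<close> and the \<open>i\<close>-th embedding of \<open>Qadj x\<close>.
  Every embedding of the compositum arises in this way, so these values compute the height of \<open>\<alpha>\<close>.  The equation is the
  image of a coordinate equation.  It is used twice: with \<open>k = 1\<close> and \<open>y = \<omega>\<^sub>j\<close> it shows the \<open>e \<tau> i\<close> to be the eigenvalues of the
  image under \<open>\<tau>\<close> of the matrix of \<open>\<alpha>\<close>, and with \<open>y = 1\<close> it describes the images of the powers of \<open>\<alpha>\<close>.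
\<close>

lemma extended_embeddings:
  assumes f: "f \<in> S" and \<alpha>: "\<alpha> \<in> span_of (Qadj f)" "algebraic_int \<alpha>"
  shows "\<exists>e. (\<Sum>\<tau>\<in>conjs f. \<Sum>i<d. ln (max 1 (cmod (e \<tau> i)))) = real (deg f) * real d * log_weil_height \<alpha> \<and>
    (\<forall>\<tau>\<in>conjs f. \<forall>i<d. \<forall>y c k. (\<forall>j<d. c j \<in> Qadj f) \<longrightarrow> y \<in> Qadj x \<longrightarrow> \<alpha> ^ k * y = (\<Sum>j<d. c j * \<omega> j) \<longrightarrow>
      e \<tau> i ^ k * emb x (cj x i) y = (\<Sum>j<d. emb f \<tau> (c j) * emb x (cj x i) (\<omega> j)))"
proof -
  note fa = S_alg[OF f]
  from compositum[OF f] obtain z where z: "algebraic z" "deg z = deg f * d" "f \<in> Qadj z" "x \<in> Qadj z"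
    and bij: "bij_betw (\<lambda>\<rho>. (emb z \<rho> f, emb z \<rho> x)) (conjs z) (conjs f \<times> conjs x)" by (elim exE conjE)
  let ?e = "\<lambda>\<rho>. (emb z \<rho> f, emb z \<rho> x)"
  define r where "r = inv_into (conjs z) ?e"
  have r: "r (\<tau>, \<sigma>) \<in> conjs z" "emb z (r (\<tau>, \<sigma>)) f = \<tau>" "emb z (r (\<tau>, \<sigma>)) x = \<sigma>"
    if "\<tau> \<in> conjs f" "\<sigma> \<in> conjs x" for \<tau> \<sigma>
  proof -
    have mem: "(\<tau>, \<sigma>) \<in> ?e ` conjs z" using bij that by (simp add: bij_betw_def)
    show "r (\<tau>, \<sigma>) \<in> conjs z" unfolding r_def by (rule inv_into_into[OF mem])
    have "?e (r (\<tau>, \<sigma>)) = (\<tau>, \<sigma>)" unfolding r_def by (rule f_inv_into_f[OF mem])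
    thus "emb z (r (\<tau>, \<sigma>)) f = \<tau>" "emb z (r (\<tau>, \<sigma>)) x = \<sigma>" by auto
  qed
  have Fz: "Qadj f \<subseteq> Qadj z" and xz: "Qadj x \<subseteq> Qadj z" using Qadj_mono[OF z(3)] Qadj_mono[OF z(4)] by auto
  have \<alpha>z: "\<alpha> \<in> Qadj z"
  proof -
    from \<alpha>(1) obtain c where "\<alpha> = (\<Sum>j<d. c j * \<omega> j)" "\<forall>j<d. c j \<in> Qadj f" by (rule span_ofE)
    moreover have "c j * \<omega> j \<in> Qadj z" if "j < d" for j
      using calculation(2) that Fz xz omega(2)[OF that] by (intro is_subringD(5)[OF is_subring_Qadj]) auto
    ultimately show ?thesis by (auto intro!: is_subring_sum[OF is_subring_Qadj])
  qed
  define e where "e \<tau> i = emb z (r (\<tau>, cj x i)) \<alpha>" for \<tau> i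
  have "(\<Sum>\<tau>\<in>conjs f. \<Sum>i<d. ln (max 1 (cmod (e \<tau> i)))) =
      (\<Sum>\<tau>\<in>conjs f. \<Sum>\<sigma>\<in>conjs x. ln (max 1 (cmod (emb z (r (\<tau>, \<sigma>)) \<alpha>))))"
    unfolding e_def by (intro sum.cong refl sum.reindex_bij_betw[OF bij_betw_cj[OF x]])
  also have "\<dots> = (\<Sum>p\<in>conjs f \<times> conjs x. ln (max 1 (cmod (emb z (r p) \<alpha>))))"
    by (simp add: sum.cartesian_product)
  also have "\<dots> = (\<Sum>\<rho>\<in>conjs z. ln (max 1 (cmod (emb z (r (?e \<rho>)) \<alpha>))))"
    by (rule sum.reindex_bij_betw[OF bij, symmetric])
  also have "\<dots> = (\<Sum>\<rho>\<in>conjs z. ln (max 1 (cmod (emb z \<rho> \<alpha>))))"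
    using inv_into_f_f[OF bij_betw_imp_inj_on[OF bij]] by (intro sum.cong) (simp_all add: r_def)
  also have "\<dots> = real (deg z) * log_weil_height \<alpha>" by (rule sum_ln_over_embeddings[OF z(1) \<alpha>z \<alpha>(2)])
  finally have sum: "(\<Sum>\<tau>\<in>conjs f. \<Sum>i<d. ln (max 1 (cmod (e \<tau> i)))) = real (deg f) * real d * log_weil_height \<alpha>"
    by (simp add: z(2))
  have "e \<tau> i ^ k * emb x (cj x i) y = (\<Sum>j<d. emb f \<tau> (c j) * emb x (cj x i) (\<omega> j))"
    if \<tau>: "\<tau> \<in> conjs f" and i: "i < d" and c: "\<forall>j<d. c j \<in> Qadj f" and y: "y \<in> Qadj x"
      and eq: "\<alpha> ^ k * y = (\<Sum>j<d. c j * \<omega> j)" for \<tau> i y c k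
  proof -
    note \<sigma> = cj_in_conjs[OF x i]
    let ?\<rho> = "r (\<tau>, cj x i)"
    note \<rho> = r[OF \<tau> \<sigma>]
    have ex: "emb z ?\<rho> w = emb x (cj x i) w" if w: "w \<in> Qadj x" for w
    proof -
      from w obtain h where "w = qeval h x" by (auto simp: Qadj_def)
      thus ?thesis using \<rho> z(4) by (simp add: emb_qeval_comp[OF z(1)] emb_qeval[OF x \<sigma>])
    qed
    have ef: "emb z ?\<rho> w = emb f \<tau> w" if w: "w \<in> Qadj f" for w
    proof -
      from w obtain h where "w = qeval h f" by (auto simp: Qadj_def)
      thus ?thesis using \<rho> z(3) by (simp add: emb_qeval_comp[OF z(1)] emb_qeval[OF fa \<tau>])
    qed
    have yz: "y \<in> Qadj z" using y xz by auto
    have m: "c j \<in> Qadj z" "\<omega> j \<in> Qadj z" if "j < d" for j using that c omega(2) Fz xz by auto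
    have "e \<tau> i ^ k * emb x (cj x i) y = emb z ?\<rho> (\<alpha> ^ k * y)"
      using emb_mult[OF z(1) \<rho>(1) is_subring_power[OF is_subring_Qadj \<alpha>z] yz]
      by (simp add: e_def emb_power[OF z(1) \<rho>(1) \<alpha>z] ex[OF y])
    also have "\<dots> = (\<Sum>j<d. emb z ?\<rho> (c j * \<omega> j))"
      unfolding eq using m by (intro emb_sum[OF z(1) \<rho>(1)] is_subringD(5)[OF is_subring_Qadj]) auto
    also have "\<dots> = (\<Sum>j<d. emb f \<tau> (c j) * emb x (cj x i) (\<omega> j))"
      using m c omega(2) by (intro sum.cong) (auto simp: emb_mult[OF z(1) \<rho>(1)] ef ex)
    finally show ?thesis .
  qed
  thus ?thesis using sum by (intro exI[of _ e] conjI ballI allI impI)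
qed

lemma common_field:
  assumes "finite Z" "Z \<subseteq> S"
  shows "\<exists>f\<in>S. Z \<subseteq> Qadj f"
proof -
  have al: "algebraic a" if "a \<in> Z" for a using that assms(2) S_alg by auto
  have "\<exists>z. algebraic z \<and> Z \<subseteq> Qadj z \<and> (\<forall>U. is_subfield U \<longrightarrow> Z \<subseteq> U \<longrightarrow> z \<in> U)"
    by (rule primitive_element[OF assms(1)]) (rule al)
  then obtain z where z: "algebraic z" "Z \<subseteq> Qadj z"
    "\<forall>U. is_subfield U \<longrightarrow> Z \<subseteq> U \<longrightarrow> z \<in> U" by (elim exE conjE)
  have "z \<in> S" using z(3)[rule_format, OF S assms(2)] .
  with z(2) show ?thesis by (intro bexI[of _ z])
qed

lemma coordinate_matrix:
  assumes "\<forall>j<d. y j \<in> span_of B"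
  shows "\<exists>A\<in>carrier_mat d d. (\<forall>j<d. \<forall>k<d. A $$ (j, k) \<in> B) \<and> (\<forall>j<d. y j = (\<Sum>k<d. A $$ (j, k) * \<omega> k))"
proof -
  have "\<forall>j. \<exists>c. j < d \<longrightarrow> (\<forall>k<d. c k \<in> B) \<and> y j = (\<Sum>k<d. c k * \<omega> k)"
  proof
    fix j
    show "\<exists>c. j < d \<longrightarrow> (\<forall>k<d. c k \<in> B) \<and> y j = (\<Sum>k<d. c k * \<omega> k)"
    proof (cases "j < d")
      case True
      from span_ofE[OF assms[rule_format, OF True]] obtain c where "y j = (\<Sum>k<d. c k * \<omega> k)" "\<forall>k<d. c k \<in> B" .
      thus ?thesis by (intro exI[of _ c]) simp
    qed simp
  qed
  from choice[OF this] obtain c where c: "\<forall>j. j < d \<longrightarrow> (\<forall>k<d. c j k \<in> B) \<and> y j = (\<Sum>k<d. c j k * \<omega> k)"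
    by (rule exE)
  show ?thesis by (rule bexI[of _ "mat d d (\<lambda>(j, k). c j k)"]) (use c in auto)
qed

lemma matrix_entries_common_field:
  assumes "A \<in> carrier_mat d d" "\<forall>j<d. \<forall>k<d. A $$ (j, k) \<in> T" "\<forall>j<d. a j \<in> T"
  shows "\<exists>f\<in>S. (\<forall>j<d. \<forall>k<d. A $$ (j, k) \<in> Qadj f) \<and> (\<forall>j<d. a j \<in> Qadj f)"
proof -
  let ?Z = "(\<lambda>(j, k). A $$ (j, k)) ` ({..<d} \<times> {..<d}) \<union> a ` {..<d}"
  have "finite ?Z" "?Z \<subseteq> S" using assms TS by auto
  from common_field[OF this] obtain f where f: "f \<in> S" "?Z \<subseteq> Qadj f" by (rule bexE)
  have "A $$ (j, k) \<in> Qadj f" if "j < d" "k < d" for j k using f(2) that by auto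
  moreover have "a j \<in> Qadj f" if "j < d" for j using f(2) that by auto
  ultimately show ?thesis using f(1) by (intro bexI[of _ f]) auto
qed

lemma emb_mat_entry: "i < d \<Longrightarrow> j < d \<Longrightarrow> emb_mat x \<omega> $$ (i, j) = emb x (cj x i) (\<omega> j)"
  by (simp add: emb_mat_def)

text \<open>
  The polynomial is the characteristic polynomial of multiplication by \<open>\<alpha>\<close> on the basis \<open>\<omega>\<close>.  Its image under an
  embedding \<open>\<tau>\<close> of a number field containing the matrix has the roots \<open>e \<tau> i\<close>, so a coefficient is bounded there by
  \<open>2\<^sup>d \<Prod> max 1 \<bar>e \<tau> i\<bar>\<close>.  Averaging the logarithms over all \<open>\<tau>\<close> gives heights on both sides.
\<close>

lemma monic_poly_of_bounded_height:
  assumes \<alpha>: "\<alpha> \<in> span_of T"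
  shows "\<exists>p. lead_coeff p = 1 \<and> degree p = d \<and> poly p \<alpha> = 0 \<and>
    (\<forall>k. coeff p k \<in> T \<and> log_weil_height (coeff p k) \<le> real d * ln 2 + real d * log_weil_height \<alpha>)"
proof -
  have sr: "is_subring (span_of T)" by (rule is_subring_span_of[OF T])
  have "\<alpha> * \<omega> j \<in> span_of T" if "j < d" for j
    by (rule is_subringD(5)[OF sr \<alpha> omega_in_span_of[OF T that]])
  hence "\<forall>j<d. \<alpha> * \<omega> j \<in> span_of T" by simp
  from coordinate_matrix[OF this] obtain A where A: "A \<in> carrier_mat d d" "\<forall>j<d. \<forall>k<d. A $$ (j, k) \<in> T"
    "\<forall>j<d. \<alpha> * \<omega> j = (\<Sum>k<d. A $$ (j, k) * \<omega> k)" by (elim bexE conjE)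
  from span_ofE[OF \<alpha>] obtain a where a: "\<alpha> = (\<Sum>j<d. a j * \<omega> j)" "\<forall>j<d. a j \<in> T" .
  from matrix_entries_common_field[OF A(1,2) a(2)] obtain f where f: "f \<in> S"
    "\<forall>j<d. \<forall>k<d. A $$ (j, k) \<in> Qadj f" "\<forall>j<d. a j \<in> Qadj f" by (elim bexE conjE)
  note fa = S_alg[OF f(1)]
  have \<alpha>f: "\<alpha> \<in> span_of (Qadj f)" unfolding a(1) using f(3) by (intro span_ofI) simp
  note \<alpha>int = span_of_T_algebraic_int[OF \<alpha>]
  from extended_embeddings[OF f(1) \<alpha>f \<alpha>int] obtain e where
    e: "(\<Sum>\<tau>\<in>conjs f. \<Sum>i<d. ln (max 1 (cmod (e \<tau> i)))) = real (deg f) * real d * log_weil_height \<alpha>"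
    and e2: "\<forall>\<tau>\<in>conjs f. \<forall>i<d. \<forall>y c k. (\<forall>j<d. c j \<in> Qadj f) \<longrightarrow> y \<in> Qadj x \<longrightarrow> \<alpha> ^ k * y = (\<Sum>j<d. c j * \<omega> j) \<longrightarrow>
      e \<tau> i ^ k * emb x (cj x i) y = (\<Sum>j<d. emb f \<tau> (c j) * emb x (cj x i) (\<omega> j))" by (elim exE conjE)
  let ?p = "char_poly A"
  have "lead_coeff ?p = 1" "degree ?p = d" using degree_monic_char_poly[OF A(1)] by auto
  moreover have "poly ?p \<alpha> = 0"
    by (rule char_poly_eigenvalue[OF A(1) dpos, of \<omega>]) (use A(3) omega(1) in auto)
  moreover have coeff: "coeff ?p k \<in> T" for k
    by (rule char_poly_coeffs_in_subring[OF T A(1)]) (use A(2) in auto)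
  moreover have "log_weil_height (coeff ?p k) \<le> real d * ln 2 + real d * log_weil_height \<alpha>" for k
  proof -
    have bound: "ln (max 1 (cmod (emb f \<tau> (coeff ?p k)))) \<le> real d * ln 2 + (\<Sum>i<d. ln (max 1 (cmod (e \<tau> i))))"
      if \<tau>: "\<tau> \<in> conjs f" for \<tau>
    proof -
      have "char_poly (map_mat (emb f \<tau>) A) = (\<Prod>i<d. [:- e \<tau> i, 1:])"
      proof (rule char_poly_diagonalised[of _ _ "emb_mat x \<omega>"])
        fix i j assume i: "i < d" and j: "j < d"
        have "\<forall>k<d. A $$ (j, k) \<in> Qadj f" "\<alpha> ^ 1 * \<omega> j = (\<Sum>k<d. A $$ (j, k) * \<omega> k)"
          using f(2) A(3) j by auto
        from e2[rule_format, OF \<tau> i this(1)[rule_format] omega(2)[OF j] this(2)]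
        have "e \<tau> i * emb x (cj x i) (\<omega> j) = (\<Sum>k<d. emb f \<tau> (A $$ (j, k)) * emb x (cj x i) (\<omega> k))" by simp
        thus "e \<tau> i * emb_mat x \<omega> $$ (i, j) = (\<Sum>k<d. map_mat (emb f \<tau>) A $$ (j, k) * emb_mat x \<omega> $$ (i, k))"
          using A(1) i j by (simp add: emb_mat_entry)
      qed (use A(1) omega(4) in auto)
      hence "emb f \<tau> (coeff ?p k) = coeff (\<Prod>i<d. [:- e \<tau> i, 1:]) k"
        by (simp add: emb_char_poly[OF fa \<tau> A(1) f(2)])
      hence "cmod (emb f \<tau> (coeff ?p k)) \<le> 2 ^ card {..<d} * (\<Prod>i<d. max 1 (cmod (e \<tau> i)))"
        using coeff_prod_linear_bound[of "{..<d}" "e \<tau>" k] by simp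
      moreover have "1 \<le> 2 ^ card {..<d} * (\<Prod>i<d. max 1 (cmod (e \<tau> i)))"
        by (rule order.trans[OF _ mult_mono[of 1 _ 1]]) (auto intro!: prod_ge_1)
      ultimately have "ln (max 1 (cmod (emb f \<tau> (coeff ?p k)))) \<le> ln (2 ^ d * (\<Prod>i<d. max 1 (cmod (e \<tau> i))))"
        by (intro ln_mono) auto
      also have "\<dots> = ln (2 ^ d) + ln (\<Prod>i<d. max 1 (cmod (e \<tau> i)))"
        by (rule ln_mult_pos) (auto intro!: prod_pos)
      also have "ln (\<Prod>i<d. max 1 (cmod (e \<tau> i))) = (\<Sum>i<d. ln (max 1 (cmod (e \<tau> i))))"
        by (intro ln_prod) auto
      finally show ?thesis by (simp add: ln_realpow)
    qed
    have "real (deg f) * log_weil_height (coeff ?p k) = (\<Sum>\<tau>\<in>conjs f. ln (max 1 (cmod (emb f \<tau> (coeff ?p k)))))"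
      by (rule sum_ln_over_embeddings[OF fa char_poly_coeff_Qadj[OF fa conjs_self[OF fa] A(1) f(2)] T_int[OF coeff], symmetric])
    also have "\<dots> \<le> (\<Sum>\<tau>\<in>conjs f. real d * ln 2 + (\<Sum>i<d. ln (max 1 (cmod (e \<tau> i)))))"
      by (rule sum_mono) (rule bound)
    also have "\<dots> = real (deg f) * (real d * ln 2 + real d * log_weil_height \<alpha>)"
      by (simp add: sum.distrib e card_conjs[OF fa] algebra_simps)
    finally show ?thesis using deg_pos[OF fa] by simp
  qed
  ultimately show ?thesis by (intro exI[of _ ?p] conjI allI)
qed

lemma northcott_span_of:
  assumes "northcott T"
  shows "northcott (span_of T)"
  unfolding northcott_def
proof (intro allI impI)
  fix B :: real assume B: "B \<ge> 0"
  let ?C = "{c \<in> T. log_weil_height c \<le> real d * ln 2 + real d * B}"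
  let ?P = "{p. degree p \<le> d \<and> (\<forall>i. coeff p i \<in> ?C)} - {0}"
  have "finite ?C" using assms B unfolding northcott_def by simp
  hence "finite ?P" by (intro finite_Diff finite_polys_bounded)
  hence "finite (\<Union>p\<in>?P. {z. poly p z = 0})" by (intro finite_UN_I) (auto intro: poly_roots_finite)
  moreover have "{\<alpha> \<in> span_of T. log_weil_height \<alpha> \<le> B} \<subseteq> (\<Union>p\<in>?P. {z. poly p z = 0})"
  proof
    fix \<alpha> assume "\<alpha> \<in> {\<alpha> \<in> span_of T. log_weil_height \<alpha> \<le> B}"
    hence \<alpha>: "\<alpha> \<in> span_of T" "log_weil_height \<alpha> \<le> B" by auto
    from monic_poly_of_bounded_height[OF \<alpha>(1)] obtain p where p: "lead_coeff p = 1" "degree p = d" "poly p \<alpha> = 0"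
      "\<forall>k. coeff p k \<in> T \<and> log_weil_height (coeff p k) \<le> real d * ln 2 + real d * log_weil_height \<alpha>"
      by (elim exE conjE)
    have "real d * log_weil_height \<alpha> \<le> real d * B" using \<alpha>(2) by (intro mult_left_mono) auto
    hence "coeff p k \<in> ?C" for k using spec[OF p(4), of k] by simp
    hence "p \<in> ?P" using p(1,2) by auto
    thus "\<alpha> \<in> (\<Union>p\<in>?P. {z. poly p z = 0})" using p(3) by blast
  qed
  ultimately show "finite {\<alpha> \<in> span_of T. log_weil_height \<alpha> \<le> B}" by (rule rev_finite_subset)
qed

text \<open>
  The powers of \<open>\<alpha>\<close> are combinations of \<open>\<omega>\<close> with matrix \<open>C\<close>.  Conversely, a polynomial expression of \<open>\<omega>\<^sub>j\<close> in \<open>\<alpha>\<close> can be reduced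
  to degree below \<open>d\<close> by the monic equation of \<open>\<alpha>\<close>, which yields a matrix \<open>G\<close> with \<open>G C = 1\<close> because \<open>\<omega>\<close> is independent.
\<close>

lemma change_of_basis_nonsingular:
  assumes \<alpha>: "\<alpha> \<in> span_of T"
    and gen: "\<And>j. j < d \<Longrightarrow> \<exists>g. (\<forall>i. coeff g i \<in> S) \<and> \<omega> j = poly g \<alpha>"
    and C: "C \<in> carrier_mat d d" "\<forall>k<d. \<forall>l<d. C $$ (k, l) \<in> T" "\<forall>k<d. \<alpha> ^ k = (\<Sum>l<d. C $$ (k, l) * \<omega> l)"
  shows "det C \<noteq> 0"
proof -
  note Sr = is_subfieldD(1)[OF S]
  from monic_poly_of_bounded_height[OF \<alpha>] obtain p where p: "lead_coeff p = 1" "degree p = d" "poly p \<alpha> = 0"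
    "\<forall>k. coeff p k \<in> T \<and> log_weil_height (coeff p k) \<le> real d * ln 2 + real d * log_weil_height \<alpha>"
    by (elim exE conjE)
  have pS: "coeff p k \<in> S" for k using p(4) TS by auto
  have "\<forall>j. \<exists>c. j < d \<longrightarrow> (\<forall>k. c k \<in> S) \<and> \<omega> j = (\<Sum>k<d. c k * \<alpha> ^ k)"
  proof
    fix j
    show "\<exists>c. j < d \<longrightarrow> (\<forall>k. c k \<in> S) \<and> \<omega> j = (\<Sum>k<d. c k * \<alpha> ^ k)"
    proof (cases "j < d")
      case True
      from gen[OF True] obtain g where g: "\<forall>i. coeff g i \<in> S" "\<omega> j = poly g \<alpha>" by (elim exE conjE)
      from monic_division[OF Sr p(1) pS g(1)[rule_format]] obtain r where
        r: "\<forall>i. coeff r i \<in> S" "p dvd g - r" "r = 0 \<or> degree r < degree p" by (elim exE conjE)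
      from r(2) obtain q where "g - r = p * q" by (rule dvdE)
      hence "poly (g - r) \<alpha> = 0" using p(3) by simp
      hence "\<omega> j = poly r \<alpha>" using g(2) by simp
      also have "\<dots> = (\<Sum>k<d. coeff r k * \<alpha> ^ k)"
        unfolding poly_altdef using r(3) p(2) dpos
        by (intro sum.mono_neutral_left) (auto simp: coeff_eq_0 not_le)
      finally show ?thesis using r(1) by (intro exI[of _ "coeff r"]) simp
    qed simp
  qed
  from choice[OF this] obtain c where c: "\<forall>j. j < d \<longrightarrow> (\<forall>k. c j k \<in> S) \<and> \<omega> j = (\<Sum>k<d. c j k * \<alpha> ^ k)"
    by (rule exE)
  define G where "G = mat d d (\<lambda>(j, k). c j k)"
  have G: "G \<in> carrier_mat d d" by (simp add: G_def)
  have "G * C = 1\<^sub>m d"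
  proof (rule eq_matI)
    fix j l assume "j < dim_row (1\<^sub>m d :: complex mat)" "l < dim_col (1\<^sub>m d :: complex mat)"
    hence j: "j < d" and l: "l < d" by auto
    \<comment> \<open>the coordinates of \<open>\<omega>\<^sub>j - \<omega>\<^sub>j\<close> after substituting the powers of \<open>\<alpha>\<close>\<close>
    define b where "b m = (\<Sum>k<d. c j k * C $$ (k, m)) - (if m = j then 1 else 0)" for m
    have "\<omega> j = (\<Sum>k<d. c j k * (\<Sum>m<d. C $$ (k, m) * \<omega> m))" using c j C(3) by simp
    also have "\<dots> = (\<Sum>m<d. \<Sum>k<d. c j k * C $$ (k, m) * \<omega> m)"
      unfolding sum_distrib_left by (subst sum.swap) (simp add: mult.assoc)
    finally have eq: "(\<Sum>m<d. (\<Sum>k<d. c j k * C $$ (k, m)) * \<omega> m) = \<omega> j" by (simp add: sum_distrib_right)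
    have "(\<Sum>m<d. b m * \<omega> m) = (\<Sum>m<d. (\<Sum>k<d. c j k * C $$ (k, m)) * \<omega> m) - (\<Sum>m<d. (if m = j then 1 else 0) * \<omega> m)"
      by (simp add: b_def left_diff_distrib sum_subtractf)
    also have "(\<Sum>m<d. (if m = j then 1 else 0) * \<omega> m) = (\<Sum>m<d. if m = j then \<omega> m else 0)"
      by (intro sum.cong) auto
    also have "\<dots> = \<omega> j" using j by simp
    finally have sum0: "(\<Sum>m<d. b m * \<omega> m) = 0" using eq by simp
    have "b m \<in> S" if "m < d" for m
    proof -
      have "(\<Sum>k<d. c j k * C $$ (k, m)) \<in> S"
        by (intro is_subring_sum[OF Sr] is_subringD(5)[OF Sr]) (use c j C(2) that TS in auto)
      thus ?thesis unfolding b_def by (intro is_subringD(6)[OF Sr]) (auto intro: is_subringD[OF Sr])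
    qed
    hence "b l = 0" by (rule indep[OF _ sum0 l])
    thus "(G * C) $$ (j, l) = 1\<^sub>m d $$ (j, l)"
      using G C(1) j l by (auto simp: b_def G_def scalar_prod_def lessThan_atLeast0 split: if_splits)
  qed (use G C(1) in auto)
  hence "det G * det C = 1" using det_mult[OF G C(1)] by simp
  thus ?thesis by auto
qed

text \<open>
  For every embedding \<open>\<tau>\<close> the matrix of the powers of the values \<open>e \<tau> i\<close> is the product of the matrix \<open>W\<close> of the embeddings of
  \<open>\<omega>\<close> and the transpose of \<open>\<tau> C\<close>.  In the product of the determinants over the \<open>m\<close> embeddings \<open>\<tau>\<close>, the factors \<open>\<tau> (det C)\<close>
  multiply to a number of modulus at least \<open>1\<close>, which leaves \<open>\<bar>det W\<bar>\<^sup>m\<close> bounded by the Vandermonde determinants.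
\<close>

lemma discr_le_height:
  assumes \<alpha>: "\<alpha> \<in> span_of T"
    and gen: "\<And>j. j < d \<Longrightarrow> \<exists>g. (\<forall>i. coeff g i \<in> S) \<and> \<omega> j = poly g \<alpha>"
  shows "discr x \<omega> \<le> exp (2 * (ln (fact d) + real d * real d * log_weil_height \<alpha>))"
proof -
  have "\<forall>k<d. \<alpha> ^ k \<in> span_of T" using is_subring_power[OF is_subring_span_of[OF T] \<alpha>] by simp
  from coordinate_matrix[OF this] obtain C where C: "C \<in> carrier_mat d d" "\<forall>k<d. \<forall>l<d. C $$ (k, l) \<in> T"
    "\<forall>k<d. \<alpha> ^ k = (\<Sum>l<d. C $$ (k, l) * \<omega> l)" by (elim bexE conjE)
  have det0: "det C \<noteq> 0" by (rule change_of_basis_nonsingular[OF \<alpha> _ C]) (rule gen)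
  from span_ofE[OF \<alpha>] obtain a where a: "\<alpha> = (\<Sum>j<d. a j * \<omega> j)" "\<forall>j<d. a j \<in> T" .
  from matrix_entries_common_field[OF C(1,2) a(2)] obtain f where f: "f \<in> S"
    "\<forall>j<d. \<forall>k<d. C $$ (j, k) \<in> Qadj f" "\<forall>j<d. a j \<in> Qadj f" by (elim bexE conjE)
  note fa = S_alg[OF f(1)]
  have \<alpha>f: "\<alpha> \<in> span_of (Qadj f)" unfolding a(1) using f(3) by (intro span_ofI) simp
  note \<alpha>int = span_of_T_algebraic_int[OF \<alpha>]
  from extended_embeddings[OF f(1) \<alpha>f \<alpha>int] obtain e where
    e: "(\<Sum>\<tau>\<in>conjs f. \<Sum>i<d. ln (max 1 (cmod (e \<tau> i)))) = real (deg f) * real d * log_weil_height \<alpha>"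
    and e2: "\<forall>\<tau>\<in>conjs f. \<forall>i<d. \<forall>y c k. (\<forall>j<d. c j \<in> Qadj f) \<longrightarrow> y \<in> Qadj x \<longrightarrow> \<alpha> ^ k * y = (\<Sum>j<d. c j * \<omega> j) \<longrightarrow>
      e \<tau> i ^ k * emb x (cj x i) y = (\<Sum>j<d. emb f \<tau> (c j) * emb x (cj x i) (\<omega> j))" by (elim exE conjE)
  have detC: "det C \<in> T" by (rule det_in_subring[OF T C(1)]) (use C(2) in auto)
  let ?W = "emb_mat x \<omega>" and ?M = "\<lambda>\<tau>. \<Prod>i<d. max 1 (cmod (e \<tau> i))"
  have bound: "cmod (det ?W) * cmod (emb f \<tau> (det C)) \<le> fact d * ?M \<tau> ^ (d - 1)" if \<tau>: "\<tau> \<in> conjs f" for \<tau>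
  proof -
    let ?V = "mat d d (\<lambda>(i, k). e \<tau> i ^ k)" and ?C = "map_mat (emb f \<tau>) C"
    have CT: "transpose_mat ?C \<in> carrier_mat d d" using C(1) by simp
    have "?V = ?W * transpose_mat ?C"
    proof (rule eq_matI)
      fix i k assume "i < dim_row (?W * transpose_mat ?C)" "k < dim_col (?W * transpose_mat ?C)"
      hence i: "i < d" and k: "k < d" using C(1) by (auto simp: emb_mat_def)
      have one: "1 \<in> Qadj x" by (rule is_subringD(2)[OF is_subring_Qadj])
      have "\<forall>l<d. C $$ (k, l) \<in> Qadj f" "\<alpha> ^ k * 1 = (\<Sum>l<d. C $$ (k, l) * \<omega> l)"
        using f(2) C(3) k by auto
      from e2[rule_format, OF \<tau> i this(1)[rule_format] one this(2)]
      have "e \<tau> i ^ k = (\<Sum>l<d. emb f \<tau> (C $$ (k, l)) * emb x (cj x i) (\<omega> l))"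
        by (simp add: emb_1[OF x cj_in_conjs[OF x i]])
      also have "\<dots> = (\<Sum>l<d. emb x (cj x i) (\<omega> l) * emb f \<tau> (C $$ (k, l)))" by (simp add: mult.commute)
      finally show "?V $$ (i, k) = (?W * transpose_mat ?C) $$ (i, k)"
        using i k C(1) by (simp add: scalar_prod_def emb_mat_def lessThan_atLeast0)
    qed (use C(1) in \<open>auto simp: emb_mat_def\<close>)
    hence "det ?V = det ?W * emb f \<tau> (det C)"
      using C(1) det_mult[OF emb_mat_carrier CT] det_transpose[of ?C d] emb_det[OF fa \<tau> C(1) f(2)] by simp
    hence "cmod (det ?W) * cmod (emb f \<tau> (det C)) = cmod (det ?V)" by (simp add: norm_mult)
    also have "\<dots> \<le> fact d * ?M \<tau> ^ (d - 1)" by (rule det_powers_bound)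
    finally show ?thesis .
  qed
  let ?w = "cmod (det ?W)"
  have w: "?w > 0" using omega(4) by simp
  have M: "1 \<le> ?M \<tau>" for \<tau> by (intro prod_ge_1) auto
  have "?w ^ deg f \<le> ?w ^ deg f * (\<Prod>\<tau>\<in>conjs f. cmod (emb f \<tau> (det C)))"
    using norm_ge_1[OF fa det_Qadj[OF fa conjs_self[OF fa] C(1) f(2)] T_int[OF detC] det0] w by simp
  also have "\<dots> = (\<Prod>\<tau>\<in>conjs f. ?w * cmod (emb f \<tau> (det C)))"
    by (simp add: prod.distrib card_conjs[OF fa])
  also have "\<dots> \<le> (\<Prod>\<tau>\<in>conjs f. fact d * ?M \<tau> ^ (d - 1))" using bound by (intro prod_mono) auto
  finally have "ln (?w ^ deg f) \<le> ln (\<Prod>\<tau>\<in>conjs f. fact d * ?M \<tau> ^ (d - 1))"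
    using w by (intro ln_mono) auto
  also have "\<dots> = (\<Sum>\<tau>\<in>conjs f. ln (fact d * ?M \<tau> ^ (d - 1)))"
    using M by (intro ln_prod) (auto simp: finite_conjs[OF fa] intro!: mult_pos_pos zero_less_power prod_pos)
  also have "\<dots> = (\<Sum>\<tau>\<in>conjs f. ln (fact d) + real (d - 1) * (\<Sum>i<d. ln (max 1 (cmod (e \<tau> i)))))"
  proof (rule sum.cong[OF refl])
    fix \<tau>
    have pos: "?M \<tau> > 0" using M[of \<tau>] by linarith
    have "ln (fact d * ?M \<tau> ^ (d - 1)) = ln (fact d) + ln (?M \<tau> ^ (d - 1))" using pos by (intro ln_mult_pos) auto
    also have "ln (?M \<tau> ^ (d - 1)) = real (d - 1) * ln (?M \<tau>)" using pos by (simp add: ln_realpow)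
    also have "ln (?M \<tau>) = (\<Sum>i<d. ln (max 1 (cmod (e \<tau> i))))" by (intro ln_prod) auto
    finally show "ln (fact d * ?M \<tau> ^ (d - 1)) = ln (fact d) + real (d - 1) * (\<Sum>i<d. ln (max 1 (cmod (e \<tau> i))))" .
  qed
  also have "\<dots> = real (deg f) * (ln (fact d) + real (d - 1) * real d * log_weil_height \<alpha>)"
    unfolding sum.distrib sum_distrib_left[symmetric] e by (simp add: card_conjs[OF fa] distrib_left)
  finally have "real (deg f) * ln ?w \<le> real (deg f) * (ln (fact d) + real (d - 1) * real d * log_weil_height \<alpha>)"
    using w by (simp add: ln_realpow)
  hence "ln ?w \<le> ln (fact d) + real (d - 1) * real d * log_weil_height \<alpha>" using deg_pos[OF fa] by simp
  also have "\<dots> \<le> ln (fact d) + real d * real d * log_weil_height \<alpha>"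
    using log_weil_height_nonneg[OF \<alpha>int] by (intro add_left_mono mult_right_mono) auto
  finally have ln: "ln ?w \<le> ln (fact d) + real d * real d * log_weil_height \<alpha>" .
  have "discr x \<omega> = exp (2 * ln ?w)" 
    using w unfolding discr_def mult_2 exp_add power2_eq_square by simp
  also have "\<dots> \<le> exp (2 * (ln (fact d) + real d * real d * log_weil_height \<alpha>))" using ln by simp
  finally show ?thesis .
qed

end

section \<open>Linear disjointness\<close>

text \<open>
  The linear extension of \<open>w\<close> to the free rational vector space on the tuples.
\<close>

definition lin_ext :: "((nat \<Rightarrow> complex) \<Rightarrow> complex) \<Rightarrow> ((nat \<Rightarrow> complex) \<Rightarrow>\<^sub>0 rat) \<Rightarrow> complex" where
  "lin_ext w f = (\<Sum>y\<in>Poly_Mapping.keys f. of_rat (Poly_Mapping.lookup f y) * w y)"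

lemma product_map_eq_lin_ext: "product_map J f = lin_ext (\<lambda>y. \<Prod>i\<in>J. y i) f"
  by (simp add: product_map_def lin_ext_def)

lemma lin_ext_superset:
  assumes "finite A" "Poly_Mapping.keys f \<subseteq> A"
  shows "lin_ext w f = (\<Sum>y\<in>A. of_rat (Poly_Mapping.lookup f y) * w y)"
  unfolding lin_ext_def using assms by (intro sum.mono_neutral_left) (auto simp: in_keys_iff)

lemma lin_ext_add: "lin_ext w (f + g) = lin_ext w f + lin_ext w g"
proof -
  let ?A = "Poly_Mapping.keys f \<union> Poly_Mapping.keys g"
  have "finite ?A" by simp
  from lin_ext_superset[OF this] show ?thesis
    using Poly_Mapping.keys_add[of f g]
    by (simp add: lookup_add of_rat_add distrib_right sum.distrib)
qed

lemma lin_ext_0 [simp]: "lin_ext w 0 = 0"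
  by (simp add: lin_ext_def)

lemma lin_ext_diff: "lin_ext w (f - g) = lin_ext w f - lin_ext w g"
  using lin_ext_add[of w "f - g" g] by simp

lemma lin_ext_single [simp]: "lin_ext w (Poly_Mapping.single y q) = of_rat q * w y"
  by (simp add: lin_ext_def)

lemma lin_ext_sum: "lin_ext w (sum f A) = (\<Sum>j\<in>A. lin_ext w (f j))"
  by (induction A rule: infinite_finite_induct) (simp_all add: lin_ext_add)

text \<open>
  A multilinear function on tuples factors through the tensor product.
\<close>

lemma lin_ext_tensor_relations:
  assumes add: "\<And>y i a b. y \<in> PiE J F \<Longrightarrow> i \<in> J \<Longrightarrow> a \<in> F i \<Longrightarrow> b \<in> F i \<Longrightarrow>
      w (y(i := a + b)) = w (y(i := a)) + w (y(i := b))"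
    and scale: "\<And>y i a r. y \<in> PiE J F \<Longrightarrow> i \<in> J \<Longrightarrow> a \<in> F i \<Longrightarrow>
      w (y(i := of_rat r * a)) = of_rat r * w (y(i := a))"
    and f: "f \<in> tensor_relations J F"
  shows "lin_ext w f = 0"
  using f
proof induction
  case (additive y i a b q)
  show ?case by (simp add: lin_ext_diff lin_ext_add add[OF additive] distrib_left)
next
  case (homogeneous y i a r q)
  show ?case by (simp add: lin_ext_diff scale[OF homogeneous] of_rat_mult)
qed (simp_all add: lin_ext_add)

text \<open>
  The values of tensors: sums of products with one factor from each \<open>F i\<close>.  If the \<open>F i\<close> are rings, these sums form the composite
  ring, as a minus sign can be absorbed into a factor.
\<close>

inductive_set product_sums :: "nat set \<Rightarrow> (nat \<Rightarrow> complex set) \<Rightarrow> complex set" for I F where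
  zero: "0 \<in> product_sums I F"
| step: "u \<in> product_sums I F \<Longrightarrow> y \<in> PiE I F \<Longrightarrow> (\<Prod>i\<in>I. y i) + u \<in> product_sums I F"

lemma product_sums_prod: "y \<in> PiE I F \<Longrightarrow> (\<Prod>i\<in>I. y i) \<in> product_sums I F"
  using product_sums.step[OF product_sums.zero] by simp

lemma product_sums_add: "u \<in> product_sums I F \<Longrightarrow> v \<in> product_sums I F \<Longrightarrow> u + v \<in> product_sums I F"
  by (induction rule: product_sums.induct) (auto simp: add.assoc intro: product_sums.step)

lemma subset_product_sums:
  assumes I: "finite I" "i \<in> I" and F: "\<forall>i\<in>I. is_subring (F i)"
  shows "F i \<subseteq> product_sums I F"
proof
  fix a assume a: "a \<in> F i"
  let ?y = "\<lambda>j. if j \<in> I then if j = i then a else 1 else undefined"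
  have "?y \<in> PiE I F"
  proof (rule PiE_I)
    fix j assume "j \<in> I"
    thus "?y j \<in> F j" using a is_subringD(2)[OF bspec[OF F]] by simp
  qed simp
  hence "(\<Prod>j\<in>I. ?y j) \<in> product_sums I F" by (rule product_sums_prod)
  also have "(\<Prod>j\<in>I. ?y j) = (\<Prod>j\<in>I. if j = i then a else 1)" by (intro prod.cong) auto
  also have "\<dots> = a" using I by simp
  finally show "a \<in> product_sums I F" .
qed

lemma is_subring_product_sums:
  assumes I: "finite I" "k \<in> I" and F: "\<forall>i\<in>I. is_subring (F i)"
  shows "is_subring (product_sums I F)"
proof -
  have pp: "(\<Prod>i\<in>I. y i) * (\<Prod>i\<in>I. z i) \<in> product_sums I F" if "y \<in> PiE I F" "z \<in> PiE I F" for y z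
  proof -
    let ?y = "\<lambda>j. if j \<in> I then y j * z j else undefined"
    have "?y \<in> PiE I F"
    proof (rule PiE_I)
      fix j assume j: "j \<in> I"
      thus "?y j \<in> F j" using is_subringD(5)[OF bspec[OF F j] PiE_mem[OF that(1) j] PiE_mem[OF that(2) j]] by simp
    qed simp
    hence "(\<Prod>j\<in>I. ?y j) \<in> product_sums I F" by (rule product_sums_prod)
    also have "(\<Prod>j\<in>I. ?y j) = (\<Prod>j\<in>I. y j * z j)" by (intro prod.cong) auto
    finally show ?thesis by (simp add: prod.distrib)
  qed
  have pm: "(\<Prod>i\<in>I. y i) * v \<in> product_sums I F" if y: "y \<in> PiE I F" and "v \<in> product_sums I F" for y v
    using that(2) by induction (auto simp: distrib_left intro: product_sums.zero product_sums_add pp[OF y])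
  have mult: "u * v \<in> product_sums I F" if "u \<in> product_sums I F" and v: "v \<in> product_sums I F" for u v
    using that(1) by induction (auto simp: distrib_right intro: product_sums.zero product_sums_add pm[OF _ v])
  have "F k \<subseteq> product_sums I F" by (rule subset_product_sums[OF I F])
  hence "1 \<in> product_sums I F" "- 1 \<in> product_sums I F" using is_subringD(2,3)[OF bspec[OF F I(2)]] by auto
  moreover have "- u \<in> product_sums I F" if "u \<in> product_sums I F" for u
    using mult[OF calculation(2) that] by simp
  ultimately show ?thesis
    unfolding is_subring_def by (intro conjI ballI mult product_sums_add product_sums.zero)
qed

text \<open>
  The tensor representing a product \<open>u * a\<close> is chosen together with the value on it of a functional
  that multiplies out the first \<open>N\<close> components and applies \<open>\<mu>\<close> to the last one.
\<close>

lemma tensor_of_product_sums: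
  assumes "u \<in> product_sums {..<N} F" and a: "a \<in> F N"
  shows "\<exists>f. Poly_Mapping.keys f \<subseteq> PiE {..N} F \<and> product_map {..N} f = u * a \<and>
    lin_ext (\<lambda>y. (\<Prod>i<N. y i) * \<mu> (y N)) f = u * \<mu> a"
  using assms(1)
proof induction
  case zero
  show ?case by (intro exI[of _ 0]) (simp add: product_map_eq_lin_ext)
next
  case (step u y)
  from step.IH obtain f where f: "Poly_Mapping.keys f \<subseteq> PiE {..N} F" "product_map {..N} f = u * a"
    "lin_ext (\<lambda>y. (\<Prod>i<N. y i) * \<mu> (y N)) f = u * \<mu> a" by (elim exE conjE)
  let ?y = "y(N := a)"
  let ?g = "Poly_Mapping.single ?y (1::rat) + f"
  have ym: "?y \<in> PiE {..N} F"
  proof (rule PiE_I)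
    fix i assume "i \<in> {..N}"
    thus "?y i \<in> F i" using PiE_mem[OF step.hyps(2), of i] a by auto
  next
    fix i assume "i \<notin> {..N}"
    thus "?y i = undefined" using PiE_arb[OF step.hyps(2), of i] by auto
  qed
  have p: "(\<Prod>i<N. ?y i) = (\<Prod>i<N. y i)" by (intro prod.cong) auto
  have "Poly_Mapping.keys ?g \<subseteq> PiE {..N} F"
    using Poly_Mapping.keys_add[of "Poly_Mapping.single ?y (1::rat)" f] f(1) ym by auto
  moreover have "product_map {..N} ?g = ((\<Prod>i<N. y i) + u) * a"
    using f(2) p by (simp add: product_map_eq_lin_ext lin_ext_add distrib_right flip: lessThan_Suc_atMost)
  moreover have "lin_ext (\<lambda>y. (\<Prod>i<N. y i) * \<mu> (y N)) ?g = ((\<Prod>i<N. y i) + u) * \<mu> a"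
    using f(3) p by (simp add: lin_ext_add distrib_right)
  ultimately show ?case by (intro exI[of _ ?g] conjI)
qed

text \<open>
  Write the vanishing combination as the image of a tensor.  By injectivity the tensor is zero, so every multilinear function
  vanishes on it.  The function that multiplies the factors with index below \<open>N\<close> and takes the coordinate at \<open>\<omega>\<^sub>k\<close> of the last one has
  the value \<open>c\<^sub>k\<close> there.
\<close>

lemma disjoint_family_indep:
  assumes disj: "linearly_disjoint_family F" and x: "algebraic x" and FN: "F N = Qadj x"
    and ind: "qindep (deg x) \<omega>" and \<omega>: "\<And>j. j < deg x \<Longrightarrow> \<omega> j \<in> Qadj x"
    and c: "\<And>j. j < deg x \<Longrightarrow> c j \<in> product_sums {..<N} F"
    and sum0: "(\<Sum>j<deg x. c j * \<omega> j) = 0" and k: "k < deg x"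
  shows "c k = 0"
proof -
  let ?d = "deg x"
  have span: "Qadj x = qspan ?d \<omega>" by (rule spanning_of_qindep[OF x ind \<omega>])
  define q where "q y = (SOME q. y = (\<Sum>j<?d. of_rat (q j) * \<omega> j))" for y
  have q: "y = (\<Sum>j<?d. of_rat (q y j) * \<omega> j)" if "y \<in> Qadj x" for y
  proof -
    have "\<exists>q. y = (\<Sum>j<?d. of_rat (q j) * \<omega> j)" using that unfolding span qspan_def by auto
    thus ?thesis unfolding q_def by (rule someI_ex)
  qed
  have unique: "q y k = r k" if "y \<in> Qadj x" "y = (\<Sum>j<?d. of_rat (r j) * \<omega> j)" for y r
  proof -
    have "(\<Sum>j<?d. of_rat (q y j - r j) * \<omega> j) = 0"
      using q[OF that(1)] that(2) by (simp add: of_rat_diff left_diff_distrib sum_subtractf)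
    thus ?thesis using qindepD[OF ind, of "\<lambda>j. q y j - r j" k] k by simp
  qed
  define \<mu> :: "complex \<Rightarrow> complex" where "\<mu> y = of_rat (q y k)" for y
  have \<mu>add: "\<mu> (a + b) = \<mu> a + \<mu> b" if a: "a \<in> Qadj x" and b: "b \<in> Qadj x" for a b
  proof -
    have "a + b = (\<Sum>j<?d. of_rat (q a j + q b j) * \<omega> j)"
      using q[OF a] q[OF b] by (simp add: of_rat_add distrib_right sum.distrib)
    from unique[OF is_subringD(4)[OF is_subring_Qadj a b] this] show ?thesis by (simp add: \<mu>_def of_rat_add)
  qed
  have \<mu>scale: "\<mu> (of_rat r * a) = of_rat r * \<mu> a" if a: "a \<in> Qadj x" for r a
  proof -
    have "(\<Sum>j<?d. of_rat (r * q a j) * \<omega> j) = of_rat r * (\<Sum>j<?d. of_rat (q a j) * \<omega> j)"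
      unfolding sum_distrib_left of_rat_mult by (simp only: mult.assoc)
    also have "\<dots> = of_rat r * a" by (simp only: q[OF a, symmetric])
    finally have eq: "of_rat r * a = (\<Sum>j<?d. of_rat (r * q a j) * \<omega> j)" by (rule sym)
    have "of_rat r * a \<in> Qadj x"
      by (rule is_subringD(5)[OF is_subring_Qadj is_subfieldD(4)[OF is_subfield_Qadj[OF x]] a])
    from unique[OF this eq] show ?thesis by (simp only: \<mu>_def of_rat_mult)
  qed
  have \<mu>\<omega>: "\<mu> (\<omega> j) = (if j = k then 1 else 0)" if j: "j < ?d" for j
  proof -
    have "(\<Sum>i<?d. of_rat (if i = j then 1 else 0) * \<omega> i) = (\<Sum>i<?d. if i = j then \<omega> i else 0)"
      by (intro sum.cong) auto
    also have "\<dots> = \<omega> j" using j by simp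
    finally have "(\<Sum>i<?d. of_rat (if i = j then 1 else 0) * \<omega> i) = \<omega> j" .
    hence "q (\<omega> j) k = (if k = j then 1 else 0)" by (intro unique[OF \<omega>[OF j]]) (rule sym)
    thus ?thesis by (cases "j = k") (simp_all add: \<mu>_def)
  qed
  let ?w = "\<lambda>y. (\<Prod>i<N. y i) * \<mu> (y N)"
  have "\<forall>j. \<exists>f. j < ?d \<longrightarrow> Poly_Mapping.keys f \<subseteq> PiE {..N} F \<and> product_map {..N} f = c j * \<omega> j \<and>
      lin_ext ?w f = c j * \<mu> (\<omega> j)"
  proof
    fix j
    show "\<exists>f. j < ?d \<longrightarrow> Poly_Mapping.keys f \<subseteq> PiE {..N} F \<and> product_map {..N} f = c j * \<omega> j \<and>
      lin_ext ?w f = c j * \<mu> (\<omega> j)"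
    proof (cases "j < ?d")
      case True
      have "\<omega> j \<in> F N" using \<omega>[OF True] FN by simp
      from tensor_of_product_sums[OF c[OF True] this, of \<mu>] show ?thesis using True by simp
    qed simp
  qed
  from choice[OF this] obtain f where f: "\<forall>j. j < ?d \<longrightarrow> Poly_Mapping.keys (f j) \<subseteq> PiE {..N} F \<and>
      product_map {..N} (f j) = c j * \<omega> j \<and> lin_ext ?w (f j) = c j * \<mu> (\<omega> j)" by (rule exE)
  let ?f = "\<Sum>j<?d. f j"
  have "Poly_Mapping.keys ?f \<subseteq> (\<Union>j<?d. Poly_Mapping.keys (f j))" by (rule Poly_Mapping.keys_sum)
  hence "Poly_Mapping.keys ?f \<subseteq> PiE {..N} F" using f by blast
  moreover have "product_map {..N} ?f = 0"
    using f sum0 by (simp add: product_map_eq_lin_ext lin_ext_sum)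
  ultimately have rel: "?f \<in> tensor_relations {..N} F"
    using disj by (simp add: linearly_disjoint_family_def tensor_map_injective_def)
  have upd: "(\<Prod>l<N. (y(i := a)) l) = a * (\<Prod>l\<in>{..<N} - {i}. y l)" if "i < N" for y :: "nat \<Rightarrow> complex" and i a
  proof -
    have "(\<Prod>l<N. (y(i := a)) l) = (y(i := a)) i * (\<Prod>l\<in>{..<N} - {i}. (y(i := a)) l)"
      by (rule prod.remove) (use that in auto)
    also have "(\<Prod>l\<in>{..<N} - {i}. (y(i := a)) l) = (\<Prod>l\<in>{..<N} - {i}. y l)" by (intro prod.cong) auto
    finally show ?thesis by simp
  qed
  have updN: "(\<Prod>l<N. (y(N := a)) l) = (\<Prod>l<N. y l)" for y :: "nat \<Rightarrow> complex" and a
    by (intro prod.cong) auto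
  define w where "w = ?w"
  have add: "w (y(i := a + b)) = w (y(i := a)) + w (y(i := b))"
    if i: "i \<in> {..N}" and a: "a \<in> F i" and b: "b \<in> F i" for y i a b
  proof (cases "i = N")
    case True
    have "a \<in> Qadj x" "b \<in> Qadj x" using a b by (simp_all only: True FN)
    thus ?thesis unfolding True w_def updN by (simp only: fun_upd_same \<mu>add distrib_left)
  next
    case False
    hence "i < N" using i by simp
    thus ?thesis unfolding w_def upd[OF \<open>i < N\<close>] by (simp only: fun_upd_other[OF False[symmetric]] distrib_right)
  qed
  have scale: "w (y(i := of_rat r * a)) = of_rat r * w (y(i := a))"
    if i: "i \<in> {..N}" and a: "a \<in> F i" for y i r a
  proof (cases "i = N")
    case True
    have "a \<in> Qadj x" using a by (simp only: True FN)
    thus ?thesis unfolding True w_def updN by (simp only: fun_upd_same \<mu>scale mult.left_commute)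
  next
    case False
    hence "i < N" using i by simp
    thus ?thesis unfolding w_def upd[OF \<open>i < N\<close>] by (simp only: fun_upd_other[OF False[symmetric]] mult.assoc)
  qed
  have "lin_ext w ?f = 0" by (rule lin_ext_tensor_relations[OF add scale rel])
  hence "lin_ext ?w ?f = 0" unfolding w_def .
  moreover have "lin_ext ?w ?f = (\<Sum>j<?d. c j * \<mu> (\<omega> j))"
    unfolding lin_ext_sum using f by (intro sum.cong) auto
  ultimately have "0 = (\<Sum>j<?d. c j * \<mu> (\<omega> j))" by (rule trans[OF sym])
  also have "\<dots> = (\<Sum>j<?d. if j = k then c j else 0)" by (intro sum.cong) (auto simp: \<mu>\<omega>)
  also have "\<dots> = c k" using k by simp
  finally show ?thesis by simp
qed

section \<open>The tower\<close>

lemma northcott_subset: "northcott B \<Longrightarrow> A \<subseteq> B \<Longrightarrow> northcott A"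
  unfolding northcott_def
proof (intro allI impI)
  fix C :: real assume fin: "\<forall>C\<ge>0. finite {\<alpha> \<in> B. log_weil_height \<alpha> \<le> C}" and "A \<subseteq> B" "C \<ge> 0"
  from \<open>A \<subseteq> B\<close> have "{\<alpha> \<in> A. log_weil_height \<alpha> \<le> C} \<subseteq> {\<alpha> \<in> B. log_weil_height \<alpha> \<le> C}" by auto
  thus "finite {\<alpha> \<in> A. log_weil_height \<alpha> \<le> C}" using fin \<open>C \<ge> 0\<close> by (auto intro: finite_subset)
qed

locale tower =
  fixes L\<^sub>0 :: "complex set" and K :: "nat \<Rightarrow> complex set" and L R :: "nat \<Rightarrow> complex set"
    and x :: "nat \<Rightarrow> complex" and \<omega> :: "nat \<Rightarrow> nat \<Rightarrow> complex"
  assumes L0: "is_subfield L\<^sub>0" "L\<^sub>0 \<subseteq> {y. algebraic y}"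
    and gen: "\<And>n. algebraic (x n)" "\<And>n. n \<ge> 1 \<Longrightarrow> K n = Qadj (x n)"
    and ib: "\<And>n. int_basis (x n) (\<omega> n)"
    and deg_gt_1: "\<And>n. n \<ge> 1 \<Longrightarrow> deg (x n) > 1"
    and disj: "linearly_disjoint_family (\<lambda>i. if i = 0 then L\<^sub>0 else K i)"
    and L: "\<And>n. L n = composite_ring (insert L\<^sub>0 (K ` {1..n}))"
    and R: "\<And>n. R n = composite_ring (insert (ring_of_integers L\<^sub>0) ((\<lambda>i. ring_of_integers (K i)) ` {1..n}))"
    and no_intermediate: "\<And>n M. is_subfield M \<Longrightarrow> L n \<subset> M \<Longrightarrow> \<not> M \<subset> L (Suc n)"
begin

lemma is_subring_K: "n \<ge> 1 \<Longrightarrow> is_subring (K n)"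
  by (simp add: gen is_subring_Qadj)

lemma is_subring_L: "is_subring (L n)" and is_subring_R: "is_subring (R n)"
  unfolding L R by (rule is_subring_composite_ring)+

lemma L0_subset_L: "L\<^sub>0 \<subseteq> L n"
  unfolding L by (rule composite_ring_upper) simp

lemma K_subset_L: "1 \<le> m \<Longrightarrow> m \<le> n \<Longrightarrow> K m \<subseteq> L n"
  unfolding L by (rule composite_ring_upper) simp

lemma Rats_subset_L: "\<rat> \<subseteq> L n"
  using L0_subset_L is_subfieldD(4)[OF L0(1)] by (auto elim!: Rats_cases)

lemma L_algebraic: "y \<in> L n \<Longrightarrow> algebraic y"
proof -
  have "L n \<subseteq> {y. algebraic y}"
    unfolding L using L0(2) Qadj_algebraic[OF gen(1)] gen(2)
    by (intro composite_ring_least[OF is_subring_algebraic]) auto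
  thus "y \<in> L n \<Longrightarrow> algebraic y" by auto
qed

lemma is_subfield_L: "is_subfield (L n)"
  by (rule is_subfield_of_algebraic[OF is_subring_L Rats_subset_L L_algebraic])

lemma L_mono: "L n \<subseteq> L (Suc n)"
  unfolding L[of n]
proof (rule composite_ring_least[OF is_subring_L])
  fix A assume "A \<in> insert L\<^sub>0 (K ` {1..n})"
  thus "A \<subseteq> L (Suc n)"
  proof (elim insertE imageE)
    assume "A = L\<^sub>0"
    thus ?thesis using L0_subset_L by simp
  next
    fix i assume "A = K i" "i \<in> {1..n}"
    thus ?thesis using K_subset_L[of i "Suc n"] by simp
  qed
qed

lemma R_subset_L: "R n \<subseteq> L n"
  unfolding R
proof (rule composite_ring_least[OF is_subring_L])
  fix A assume "A \<in> insert (ring_of_integers L\<^sub>0) ((\<lambda>i. ring_of_integers (K i)) ` {1..n})"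
  thus "A \<subseteq> L n"
  proof (elim insertE imageE)
    assume "A = ring_of_integers L\<^sub>0"
    thus ?thesis using L0_subset_L[of n] by (auto simp: ring_of_integers_def)
  next
    fix i assume "A = ring_of_integers (K i)" "i \<in> {1..n}"
    thus ?thesis using K_subset_L[of i n] by (auto simp: ring_of_integers_def)
  qed
qed

lemma R_algebraic_int: "y \<in> R n \<Longrightarrow> algebraic_int y"
proof -
  have "R n \<subseteq> {y. algebraic_int y}"
    unfolding R by (rule composite_ring_least[OF is_subring_algebraic_int]) (auto simp: ring_of_integers_def)
  thus "y \<in> R n \<Longrightarrow> algebraic_int y" by auto
qed

lemma disjoint_step: "disjoint_step (L n) (R n) (x (Suc n)) (\<omega> (Suc n))"
proof
  let ?F = "\<lambda>i. if i = 0 then L\<^sub>0 else K i"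
  have F: "\<forall>i\<in>{..<Suc n}. is_subring (?F i)"
  proof
    fix i
    show "is_subring (?F i)"
    proof (cases "i = 0")
      case True
      thus ?thesis by (simp only: refl if_True is_subfieldD(1)[OF L0(1)])
    next
      case False
      hence "1 \<le> i" by simp
      from is_subring_K[OF this] show ?thesis by (simp only: False if_False)
    qed
  qed
  have fin: "finite {..<Suc n}" and zero: "0 \<in> {..<Suc n}" by auto
  have Lp: "L n \<subseteq> product_sums {..<Suc n} ?F"
    unfolding L
  proof (rule composite_ring_least[OF is_subring_product_sums[OF fin zero F]])
    fix A assume "A \<in> insert L\<^sub>0 (K ` {1..n})"
    thus "A \<subseteq> product_sums {..<Suc n} ?F"
    proof (elim insertE imageE)
      assume "A = L\<^sub>0"
      thus ?thesis using subset_product_sums[OF fin zero F] by (simp only: refl if_True)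
    next
      fix i assume i: "i \<in> {1..n}" "A = K i"
      have i': "i \<in> {..<Suc n}" "i \<noteq> 0" using i(1) by auto
      show ?thesis using subset_product_sums[OF fin i'(1) F] by (simp only: i'(2) i(2) if_False)
    qed
  qed
  have ib': "\<forall>j<deg (x (Suc n)). \<omega> (Suc n) j \<in> Qadj (x (Suc n))" "det (emb_mat (x (Suc n)) (\<omega> (Suc n))) \<noteq> 0"
    using ib[of "Suc n"] unfolding int_basis_def by simp_all
  have FN: "?F (Suc n) = Qadj (x (Suc n))" using gen(2) by simp
  show "c k = 0" if c: "\<And>j. j < deg (x (Suc n)) \<Longrightarrow> c j \<in> L n"
    and sum0: "(\<Sum>j<deg (x (Suc n)). c j * \<omega> (Suc n) j) = 0" and k: "k < deg (x (Suc n))" for c k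
  proof (rule disjoint_family_indep[OF disj gen(1) FN _ _ _ sum0 k])
    show "qindep (deg (x (Suc n))) (\<omega> (Suc n))"
      by (rule qindep_of_emb_mat[OF gen(1) ib'(1)[rule_format] ib'(2)])
    fix j assume j: "j < deg (x (Suc n))"
    show "\<omega> (Suc n) j \<in> Qadj (x (Suc n))" using ib'(1) j by simp
    show "c j \<in> product_sums {..<Suc n} ?F" using c[OF j] Lp by auto
  qed
qed (rule is_subfield_L is_subring_R R_subset_L gen(1) ib | erule L_algebraic R_algebraic_int)+

text \<open>
  The integers of the new field have integral coordinates with respect to \<open>\<omega>\<close>, and the other generators are scalars; the span is
  a ring containing both.
\<close>

lemma R_Suc_subset: "R (Suc n) \<subseteq> disjoint_step.span_of (x (Suc n)) (\<omega> (Suc n)) (R n)"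
proof -
  interpret disjoint_step "L n" "R n" "x (Suc n)" "\<omega> (Suc n)" by (rule disjoint_step)
  show ?thesis
    unfolding R[of "Suc n"]
  proof (rule composite_ring_least[OF is_subring_span_of[OF is_subring_R]])
    fix A assume "A \<in> insert (ring_of_integers L\<^sub>0) ((\<lambda>i. ring_of_integers (K i)) ` {1..Suc n})"
    moreover have "{1..Suc n} = insert (Suc n) {1..n}" by auto
    ultimately consider "A \<in> insert (ring_of_integers L\<^sub>0) ((\<lambda>i. ring_of_integers (K i)) ` {1..n})"
      | "A = ring_of_integers (K (Suc n))" by auto
    thus "A \<subseteq> span_of (R n)"
    proof cases
      case 1
      hence "A \<subseteq> R n" unfolding R by (rule composite_ring_upper)
      thus ?thesis using span_of_scalar[of _ "R n"] is_subringD(1)[OF is_subring_R] by auto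
    next
      case 2
      thus ?thesis using integer_in_span_of[OF is_subring_R] gen(2)[of "Suc n"] by (auto simp: ring_of_integers_def)
    qed
  qed
qed

lemma northcott_R:
  assumes "northcott L\<^sub>0"
  shows "northcott (R n)"
proof (induction n)
  case 0
  have "R 0 \<subseteq> L\<^sub>0"
    unfolding R by (rule composite_ring_least[OF is_subfieldD(1)[OF L0(1)]]) (auto simp: ring_of_integers_def)
  thus ?case by (rule northcott_subset[OF assms])
next
  case (Suc n)
  interpret disjoint_step "L n" "R n" "x (Suc n)" "\<omega> (Suc n)" by (rule disjoint_step)
  show ?case by (rule northcott_subset[OF northcott_span_of[OF Suc.IH] R_Suc_subset])
qed

text \<open>
  If \<open>K n\<close> were an earlier field, then \<open>\<omega>\<^sub>1\<close> would be a scalar and hence a multiple of \<open>\<omega>\<^sub>0 = 1\<close>.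
\<close>

lemma inj_on_K: "inj_on K {1..}"
proof (rule linorder_inj_onI')
  fix m n :: nat assume mn: "m \<in> {1..}" "n \<in> {1..}" "m < n"
  show "K m \<noteq> K n"
  proof
    assume eq: "K m = K n"
    obtain k where k: "n = Suc k" using mn by (cases n) auto
    interpret disjoint_step "L k" "R k" "x (Suc k)" "\<omega> (Suc k)" by (rule disjoint_step)
    have d: "1 < deg (x (Suc k))" using deg_gt_1 by simp
    have "\<omega> (Suc k) 1 \<in> K n" using omega(2)[OF d] gen(2) k by simp
    hence w: "\<omega> (Suc k) 1 \<in> L k" using K_subset_L[of m k] mn k eq by auto
    define c where "c j = (if j = 0 then \<omega> (Suc k) 1 else if j = 1 then - 1 else 0)" for j :: nat
    have "(\<Sum>j<deg (x (Suc k)). c j * \<omega> (Suc k) j) = (\<Sum>j\<in>{0, 1}. c j * \<omega> (Suc k) j)"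
      using d by (intro sum.mono_neutral_right) (auto simp: c_def)
    also have "\<dots> = 0" using omega(1) by (simp add: c_def)
    finally have sum0: "(\<Sum>j<deg (x (Suc k)). c j * \<omega> (Suc k) j) = 0" .
    have "c j \<in> L k" for j
      using w is_subringD(1,2)[OF is_subring_L[of k]] is_subringD(3)[OF is_subring_L[of k]] by (simp add: c_def)
    hence "c 1 = 0" by (rule indep[OF _ sum0 d])
    thus False by (simp add: c_def)
  qed
qed

text \<open>
  The polynomial expressions in \<open>\<alpha>\<close> over \<open>L n\<close> form a field that is larger than \<open>L n\<close>.
\<close>

lemma generator_of_new_element:
  assumes \<alpha>: "\<alpha> \<in> L (Suc n)" "\<alpha> \<notin> L n" and y: "y \<in> L (Suc n)"
  shows "\<exists>g. (\<forall>i. coeff g i \<in> L n) \<and> y = poly g \<alpha>"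
proof -
  let ?P = "{g. \<forall>i. coeff g i \<in> L n}"
  let ?M = "(\<lambda>g. poly g \<alpha>) ` ?P"
  note P = is_subring_poly_coeffs[OF is_subring_L[of n]]
  have M: "is_subring ?M"
    unfolding is_subring_def
  proof (intro conjI ballI)
    show "0 \<in> ?M" by (rule image_eqI[of _ _ 0]) (simp, rule is_subringD(1)[OF P])
    show "1 \<in> ?M" by (rule image_eqI[of _ _ 1]) (simp, rule is_subringD(2)[OF P])
    fix a assume "a \<in> ?M"
    then obtain g where g: "a = poly g \<alpha>" "g \<in> ?P" by (rule imageE)
    show "- a \<in> ?M" by (rule image_eqI[of _ _ "- g"]) (simp add: g(1), rule is_subringD(3)[OF P g(2)])
    fix b assume "b \<in> ?M"
    then obtain h where h: "b = poly h \<alpha>" "h \<in> ?P" by (rule imageE)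
    show "a + b \<in> ?M" by (rule image_eqI[of _ _ "g + h"]) (simp add: g(1) h(1), rule is_subringD(4)[OF P g(2) h(2)])
    show "a * b \<in> ?M" by (rule image_eqI[of _ _ "g * h"]) (simp add: g(1) h(1), rule is_subringD(5)[OF P g(2) h(2)])
  qed
  have LM: "L n \<subseteq> ?M"
  proof
    fix a assume "a \<in> L n"
    hence "[:a:] \<in> ?P" using is_subringD(1)[OF is_subring_L[of n]] by (auto simp: coeff_pCons split: nat.split)
    thus "a \<in> ?M" by (rule rev_image_eqI) simp
  qed
  have "[:0, 1:] \<in> ?P" using is_subringD(1,2)[OF is_subring_L[of n]] by (auto simp: coeff_pCons split: nat.split)
  hence "\<alpha> \<in> ?M" by (rule rev_image_eqI) simp
  hence strict: "L n \<subset> ?M" using LM \<alpha>(2) by blast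
  have M_le: "?M \<subseteq> L (Suc n)"
  proof
    fix a assume "a \<in> ?M"
    then obtain g where g: "a = poly g \<alpha>" "g \<in> ?P" by (rule imageE)
    have "coeff g i \<in> L (Suc n)" for i using g(2) L_mono[of n] by auto
    thus "a \<in> L (Suc n)"
      unfolding g(1) poly_altdef using \<alpha>(1) \<open>\<And>i. coeff g i \<in> L (Suc n)\<close>
      by (intro is_subring_sum[OF is_subring_L] is_subringD(5)[OF is_subring_L] is_subring_power[OF is_subring_L])
  qed
  have "\<rat> \<subseteq> ?M" using Rats_subset_L[of n] LM by (rule order.trans)
  hence "is_subfield ?M" by (rule is_subfield_of_algebraic[OF M]) (rule L_algebraic[OF subsetD[OF M_le]])
  from no_intermediate[OF this strict] M_le have "?M = L (Suc n)" by (simp add: psubset_eq)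
  with y have "y \<in> ?M" by simp
  then obtain g where "y = poly g \<alpha>" "g \<in> ?P" by (rule imageE)
  thus ?thesis by (intro exI[of _ g]) simp
qed

lemma new_element_discr:
  assumes \<alpha>: "\<alpha> \<in> R (Suc n)" "\<alpha> \<notin> R n"
  shows "discr (x (Suc n)) (\<omega> (Suc n)) \<le>
    exp (2 * (ln (fact (deg (x (Suc n)))) + real (deg (x (Suc n))) * real (deg (x (Suc n))) * log_weil_height \<alpha>))"
proof -
  interpret disjoint_step "L n" "R n" "x (Suc n)" "\<omega> (Suc n)" by (rule disjoint_step)
  have \<alpha>s: "\<alpha> \<in> span_of (R n)" using \<alpha>(1) R_Suc_subset by (rule rev_subsetD)
  have \<alpha>L: "\<alpha> \<notin> L n" using span_of_T_inter_S[OF \<alpha>s] \<alpha>(2) by auto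
  have \<alpha>L': "\<alpha> \<in> L (Suc n)" using \<alpha>(1) R_subset_L by auto
  show ?thesis
  proof (rule discr_le_height[OF \<alpha>s])
    fix j assume "j < deg (x (Suc n))"
    hence "\<omega> (Suc n) j \<in> K (Suc n)" using omega(2) gen(2) by simp
    hence "\<omega> (Suc n) j \<in> L (Suc n)" using K_subset_L[of "Suc n" "Suc n"] by auto
    thus "\<exists>g. (\<forall>i. coeff g i \<in> L n) \<and> \<omega> (Suc n) j = poly g \<alpha>" by (rule generator_of_new_element[OF \<alpha>L' \<alpha>L])
  qed
qed

text \<open>
  An element of bounded height that appears first in \<open>R n\<close> bounds the discriminant of \<open>K n\<close>, so \<open>n\<close> is one of finitely many
  indices.
\<close>

theorem northcott_union:
  assumes "northcott L\<^sub>0" and D: "\<And>n. n \<ge> 1 \<Longrightarrow> deg (x n) \<le> D"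
  shows "northcott (\<Union>n. R n)"
  unfolding northcott_def
proof (intro allI impI)
  fix B :: real assume B: "B \<ge> 0"
  define E where "E = exp (2 * (ln (fact D) + real D * real D * B))"
  define I where "I = {n. n \<ge> 1 \<and> discr (x n) (\<omega> n) \<le> E}"
  have "K ` I \<subseteq> {K. \<exists>x \<omega>. algebraic x \<and> K = Qadj x \<and> deg x \<le> D \<and> int_basis x \<omega> \<and> discr x \<omega> \<le> E}"
  proof (rule image_subsetI, rule CollectI)
    fix n assume "n \<in> I"
    hence n: "n \<ge> 1" "discr (x n) (\<omega> n) \<le> E" by (auto simp: I_def)
    show "\<exists>x \<omega>. algebraic x \<and> K n = Qadj x \<and> deg x \<le> D \<and> int_basis x \<omega> \<and> discr x \<omega> \<le> E"
      using gen(1) gen(2)[OF n(1)] D[OF n(1)] ib n(2) by (intro exI[of _ "x n"] exI[of _ "\<omega> n"] conjI)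
  qed
  hence "finite (K ` I)" using hermite_finiteness by (rule finite_subset)
  moreover have "inj_on K I" by (rule inj_on_subset[OF inj_on_K]) (auto simp: I_def)
  ultimately have I: "finite I" by (rule finite_imageD)
  let ?A = "\<lambda>n. {\<alpha> \<in> R n. log_weil_height \<alpha> \<le> B}"
  have "finite (?A n)" for n using northcott_R[OF assms(1), of n] B unfolding northcott_def by simp
  hence "finite (\<Union>n\<in>insert 0 I. ?A n)" using I by simp
  moreover have "{\<alpha> \<in> (\<Union>n. R n). log_weil_height \<alpha> \<le> B} \<subseteq> (\<Union>n\<in>insert 0 I. ?A n)"
  proof
    fix \<alpha> assume "\<alpha> \<in> {\<alpha> \<in> (\<Union>n. R n). log_weil_height \<alpha> \<le> B}"
    then obtain m where m: "\<alpha> \<in> R m" and h: "log_weil_height \<alpha> \<le> B" by auto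
    define n where "n = (LEAST n. \<alpha> \<in> R n)"
    have n: "\<alpha> \<in> R n" unfolding n_def by (rule LeastI[of "\<lambda>n. \<alpha> \<in> R n", OF m])
    have "n \<in> insert 0 I"
    proof (cases n)
      case (Suc k)
      have "\<alpha> \<notin> R k" using not_less_Least[of k "\<lambda>n. \<alpha> \<in> R n"] Suc by (simp add: n_def)
      note bound = new_element_discr[OF n[unfolded Suc] this, folded Suc]
      have d: "deg (x n) \<le> D" using D[of n] Suc by simp
      have "ln (fact (deg (x n)) :: real) \<le> ln (fact D)" using d by (intro ln_mono fact_mono) auto
      moreover have "real (deg (x n)) * real (deg (x n)) * log_weil_height \<alpha> \<le> real D * real D * B"
        using d h B log_weil_height_nonneg[OF R_algebraic_int[OF n]] by (intro mult_mono) auto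
      ultimately have "2 * (ln (fact (deg (x n))) + real (deg (x n)) * real (deg (x n)) * log_weil_height \<alpha>)
        \<le> 2 * (ln (fact D) + real D * real D * B)" by (rule mult_left_mono[OF add_mono]) simp
      hence "discr (x n) (\<omega> n) \<le> E"
        unfolding E_def by (intro order.trans[OF bound] iffD2[OF exp_le_cancel_iff])
      thus ?thesis using Suc by (simp add: I_def)
    qed simp
    thus "\<alpha> \<in> (\<Union>n\<in>insert 0 I. ?A n)" using n h by blast
  qed
  ultimately show "finite {\<alpha> \<in> (\<Union>n. R n). log_weil_height \<alpha> \<le> B}" by (rule rev_finite_subset)
qed

end

theorem corollary1:
  fixes L\<^sub>0 :: "complex set" and K :: "nat \<Rightarrow> complex set"
    and L R :: "nat \<Rightarrow> complex set"
  assumes "subfield L\<^sub>0 CC" and "L\<^sub>0 \<subseteq> Qbar" and "northcott L\<^sub>0"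
    and "\<And>i. i \<ge> 1 \<Longrightarrow> number_field (K i)"
    and "\<And>i. i \<ge> 1 \<Longrightarrow> field_degree (K i) > 1"
    and "linearly_disjoint_family (\<lambda>i. if i = 0 then L\<^sub>0 else K i)"
    and "\<exists>D. \<forall>i\<ge>1. field_degree (K i) \<le> D"
    and "\<And>n. L n = composite_ring (insert L\<^sub>0 (K ` {1..n}))"
    and "\<And>n. R n = composite_ring (insert (ring_of_integers L\<^sub>0) ((\<lambda>i. ring_of_integers (K i)) ` {1..n}))"
    and "\<And>n. n \<ge> 1 \<Longrightarrow> \<not> (\<exists>M. subfield M CC \<and> L (n - 1) \<subset> M \<and> M \<subset> L n)"
  shows "northcott (\<Union>n. R n)"
proof -
  have "\<forall>i. \<exists>x. algebraic x \<and> (i \<ge> 1 \<longrightarrow> K i = Qadj x)"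
  proof
    fix i
    show "\<exists>x. algebraic x \<and> (i \<ge> 1 \<longrightarrow> K i = Qadj x)"
    proof (cases "i \<ge> 1")
      case True
      from number_field_imp_Qadj[OF assms(4)[OF True]] obtain x where "algebraic x" "K i = Qadj x" .
      thus ?thesis by (intro exI[of _ x]) simp
    next
      case False
      thus ?thesis by (intro exI[of _ 0]) simp
    qed
  qed
  from choice[OF this] obtain x where x: "\<forall>i. algebraic (x i) \<and> (i \<ge> 1 \<longrightarrow> K i = Qadj (x i))" by (rule exE)
  have "\<forall>i. \<exists>\<omega>. int_basis (x i) \<omega>" using int_basis_exists x by simp
  from choice[OF this] obtain \<omega> where \<omega>: "\<forall>i. int_basis (x i) (\<omega> i)" by (rule exE)
  have deg: "field_degree (K i) = deg (x i)" if "i \<ge> 1" for i using field_degree_Qadj x that by simp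
  interpret tower L\<^sub>0 K L R x \<omega>
  proof
    show "is_subfield L\<^sub>0" using assms(1) by (simp add: subfield_CC_iff)
    show "L\<^sub>0 \<subseteq> {y. algebraic y}" using assms(2) by (simp add: Qbar_def)
    show "\<not> M \<subset> L (Suc n)" if "is_subfield M" "L n \<subset> M" for n M
    proof
      assume "M \<subset> L (Suc n)"
      hence "subfield M CC \<and> L (Suc n - 1) \<subset> M \<and> M \<subset> L (Suc n)" using that by (simp add: subfield_CC_iff)
      hence "\<exists>M. subfield M CC \<and> L (Suc n - 1) \<subset> M \<and> M \<subset> L (Suc n)" by (rule exI)
      moreover have "Suc n \<ge> 1" by simp
      from assms(10)[OF this] calculation show False by (rule notE)
    qed
    show "deg (x n) > 1" if "n \<ge> 1" for n using assms(5)[OF that] deg[OF that] by simp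
  qed (use x \<omega> in \<open>simp_all only: assms(6) assms(8,9) simp_thms\<close>)
  from assms(7) obtain D where D: "\<forall>i\<ge>1. field_degree (K i) \<le> D" by (rule exE)
  have "deg (x n) \<le> D" if "n \<ge> 1" for n using D[rule_format, OF that] deg[OF that] by simp
  thus ?thesis by (rule northcott_union[OF assms(3)])
qed

end
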